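(* Let $N\ge 2$ and $M\ge 1$ be integers and let $f:[0,1]\to\mathbb R$ be a concave function. Then for every density matrix $\rho$ on $\mathcal H_M$ and every unit vector $u\in\mathbb C^N$, $$\int_{SU(N)} f\big(\langle \otimes^M(Ru)\,|\,\rho\,|\,\otimes^M(Ru)\rangle\big)\,dR\;\ge\;\int_{SU(N)} f\big(|\langle \otimes^M(Ru)\,|\,\otimes^M u\rangle|^2\big)\,dR .$$ That is, among all density matrices the left side is minimized by the coherent state $\rho=|\otimes^M u\rangle\langle\otimes^M u|$.
   Context: For $n\ge 0$, $\mathcal H_n=P_n(\mathbb C^N)^{\otimes n}$ denotes the totally symmetric subspace, where $P_n$ is the orthogonal projection with $P_n\, u_1\otimes\cdots\otimes u_n=\frac1{n!}\sum_{\sigma\in S_n}u_{\sigma(1)}\otimes\cdots\otimes u_{\sigma(n)}$. $SU(N)$ acts on $\mathcal H_n$ by $R\mapsto R\otimes\cdots\otimes R$. $\otimes^M u=u\otimes\cdots\otimes u$ ($M$ factors). $dR$ is the normalized Haar measure on $SU(N)$. A density matrix is a positive semidefinite operator of trace one. *)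

theory Defs
  imports "HOL-Analysis.Analysis" "HOL-Probability.Probability" "HOL-Combinatorics.Permutations"
begin

text \<open>Tensors in (C^N)^{\<otimes>M} are functions on words (lists of length M over the index type 'n).\<close>

definition words :: "nat \<Rightarrow> 'n::finite list set" where
  "words M = {w. length w = M}"

definition tensor_pow :: "nat \<Rightarrow> complex^'n \<Rightarrow> ('n::finite list \<Rightarrow> complex)" where
  "tensor_pow M v = (\<lambda>w. prod_list (map (\<lambda>i. v $ i) w))"

definition tinner :: "nat \<Rightarrow> ('n::finite list \<Rightarrow> complex) \<Rightarrow> ('n list \<Rightarrow> complex) \<Rightarrow> complex" where
  "tinner M x y = (\<Sum>w\<in>words M. cnj (x w) * y w)"

definition qform :: "nat \<Rightarrow> ('n::finite list \<Rightarrow> 'n list \<Rightarrow> complex) \<Rightarrow> ('n list \<Rightarrow> complex) \<Rightarrow> complex" where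
  "qform M \<rho> x = (\<Sum>a\<in>words M. \<Sum>b\<in>words M. cnj (x a) * \<rho> a b * x b)"

text \<open>Matrix of the symmetrizer P_M: P e_b = (1/M!) sum over sigma of e_{b o sigma}.\<close>
definition sym_proj :: "nat \<Rightarrow> 'n::finite list \<Rightarrow> 'n list \<Rightarrow> complex" where
  "sym_proj M a b = of_nat (card {\<sigma>. \<sigma> permutes {..<M} \<and> (\<forall>i<M. a ! i = b ! (\<sigma> i))}) / of_nat (fact M)"

text \<open>Density matrix on the symmetric subspace H_M: positive semidefinite, trace one,
  and supported on H_M (P rho = rho = rho P).\<close>
definition density_sym :: "nat \<Rightarrow> ('n::finite list \<Rightarrow> 'n list \<Rightarrow> complex) \<Rightarrow> bool" where
  "density_sym M \<rho> \<longleftrightarrow>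
     (\<forall>x. Im (qform M \<rho> x) = 0 \<and> 0 \<le> Re (qform M \<rho> x)) \<and>
     (\<Sum>a\<in>words M. \<rho> a a) = 1 \<and>
     (\<forall>a\<in>words M. \<forall>b\<in>words M. (\<Sum>c\<in>words M. sym_proj M a c * \<rho> c b) = \<rho> a b) \<and>
     (\<forall>a\<in>words M. \<forall>b\<in>words M. (\<Sum>c\<in>words M. \<rho> a c * sym_proj M c b) = \<rho> a b)"

definition cadj :: "complex^'n^'n \<Rightarrow> complex^'n^'n" where
  "cadj R = (\<chi> i j. cnj (R $ j $ i))"

definition SU :: "(complex^'n::finite^'n) set" where
  "SU = {R. R ** cadj R = mat 1 \<and> det R = 1}"

definition haar_SU :: "(complex^'n::finite^'n) measure \<Rightarrow> bool" where
  "haar_SU \<mu> \<longleftrightarrow> prob_space \<mu> \<and> sets \<mu> = sets (restrict_space borel SU) \<and>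
     (\<forall>S\<in>SU. distr \<mu> \<mu> (\<lambda>R. S ** R) = \<mu>)"

end

(*
  Lieb and Solovej's argument. Multiplication V by a homogeneous polynomial g of degree M maps H_k to
  H_{k+M}; if |g><g| is the given (pure) state, then up to a constant V V^* is the image of the state under the coherent
  quantum channel, and <v^{k+M}| V V^* |v^{k+M}> is a multiple of |<g|v^M>|^2. The operators V V^* on H_{k+M} and V^* V
  on H_k have the same nonzero eigenvalues, and normal ordering writes V^* V as a sum of operators W W^* on H_k, where W is
  multiplication by a derivative of g. Hence, by induction on the target space, the spectrum of V V^* is
  majorized by the one for g = z_1^M: in that case all summands are diagonal in the monomials and ordered in the same way.
  A Berezin-Lieb inequality transfers this to the integrals of (x - t)_+. The averages of functions of
  the occupation number n_1 over the monomials of degree K are integrals of Bernstein polynomials in |(Ru)_1|^2,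
  which gives the limit K -> infinity. Concave functions are limits of affine functions minus
  nonnegative combinations of the functions (x - t)_+.
*)
theory Submission
  imports Defs "HOL-Library.Function_Algebras" "HOL-Combinatorics.Multiset_Permutations"
begin

section \<open>Hermitian forms and singular values\<close>

text \<open>Spectra enter only through weighted orthonormal systems: for orthonormal
  \<open>x i\<close> and weights \<open>\<gamma> i\<close> in [0,1], the weighted sum of the
  expectations of A is at most t times the total weight plus the trace of (A - t)_+. In this Ky Fan
  form, bounds for different operators and the same \<open>x\<close>, \<open>\<gamma>\<close> add
  up, eigenvalues never need sorting, and averages of coherent projections can serve as test
  operators. The obstacle is that the sum of the positive parts usually exceeds the positive part of
  the sum. Addition is exact here if all thresholds are taken at one common integer
  \<open>m\<close>; the price is a discrete set of thresholds, which becomes dense only in the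
  limit. Mixed states cost nothing extra: the bound is the same for every unit vector g, and the
  test region can be fixed before averaging over the eigenvectors of the state. Invariance is given
  for left translations by SU(N). The integrands that matter ignore phases, which makes all of U(N)
  available; diagonal phases and a polynomial identity then yield the resolution of the
  identity.\<close>

definition cip :: "'a set \<Rightarrow> ('a \<Rightarrow> complex) \<Rightarrow> ('a \<Rightarrow> complex) \<Rightarrow> complex" where
  "cip S x y = (\<Sum>s\<in>S. cnj (x s) * y s)"

definition nrm2 :: "'a set \<Rightarrow> ('a \<Rightarrow> complex) \<Rightarrow> real" where
  "nrm2 S x = (\<Sum>s\<in>S. (cmod (x s))\<^sup>2)"

definition sesq :: "'a set \<Rightarrow> ('a \<Rightarrow> 'a \<Rightarrow> complex) \<Rightarrow> ('a \<Rightarrow> complex) \<Rightarrow> ('a \<Rightarrow> complex) \<Rightarrow> complex" where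
  "sesq S h x y = (\<Sum>s\<in>S. \<Sum>t\<in>S. cnj (x s) * h s t * y t)"

definition orthonormal_on :: "'a set \<Rightarrow> 'i set \<Rightarrow> ('i \<Rightarrow> 'a \<Rightarrow> complex) \<Rightarrow> bool" where
  "orthonormal_on S I e \<longleftrightarrow> (\<forall>l\<in>I. \<forall>m\<in>I. cip S (e l) (e m) = (if l = m then 1 else 0))"

lemma cip_self: "cip S x x = of_real (nrm2 S x)"
  unfolding cip_def nrm2_def of_real_sum
  by (intro sum.cong refl) (simp add: complex_norm_square mult.commute del: of_real_power)

lemma nrm2_nonneg [simp]: "0 \<le> nrm2 S x"
  by (simp add: nrm2_def sum_nonneg)

lemma cip_commute: "cip S y x = cnj (cip S x y)"
  by (simp add: cip_def mult.commute)

lemma cip_add_right: "cip S x (\<lambda>s. y s + c * z s) = cip S x y + c * cip S x z"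
  by (simp add: cip_def sum.distrib sum_distrib_left algebra_simps)

lemma cip_add_left: "cip S (\<lambda>s. y s + c * z s) x = cip S y x + cnj c * cip S z x"
  by (simp add: cip_def sum.distrib sum_distrib_left algebra_simps)

lemma sesq_add_right: "sesq S h x (\<lambda>s. y s + c * z s) = sesq S h x y + c * sesq S h x z"
  by (simp add: sesq_def sum.distrib sum_distrib_left algebra_simps)

lemma sesq_add_left: "sesq S h (\<lambda>s. y s + c * z s) x = sesq S h y x + cnj c * sesq S h z x"
  by (simp add: sesq_def sum.distrib sum_distrib_left algebra_simps)

lemma cip_sum_right: "cip S x (\<lambda>s. \<Sum>i\<in>I. c i * y i s) = (\<Sum>i\<in>I. c i * cip S x (y i))"
  unfolding cip_def sum_distrib_left
  by (subst sum.swap) (simp add: algebra_simps)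

lemma sesq_sum_right: "sesq S h x (\<lambda>s. \<Sum>i\<in>I. c i * y i s) = (\<Sum>i\<in>I. c i * sesq S h x (y i))"
proof -
  have "sesq S h x (\<lambda>s. \<Sum>i\<in>I. c i * y i s) = (\<Sum>s\<in>S. \<Sum>t\<in>S. \<Sum>i\<in>I. c i * (cnj (x s) * h s t * y i t))"
    by (simp add: sesq_def sum_distrib_left algebra_simps)
  also have "\<dots> = (\<Sum>s\<in>S. \<Sum>i\<in>I. \<Sum>t\<in>S. c i * (cnj (x s) * h s t * y i t))"
    by (intro sum.cong refl sum.swap)
  also have "\<dots> = (\<Sum>i\<in>I. \<Sum>s\<in>S. \<Sum>t\<in>S. c i * (cnj (x s) * h s t * y i t))"
    by (rule sum.swap)
  finally show ?thesis by (simp add: sesq_def sum_distrib_left)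
qed

text \<open>Polarization: reality at \<open>x + y\<close> relates the imaginary parts, reality at
  \<open>x + \<i> y\<close> the real parts. The assumption has this form because it is what
  positivity of a density matrix provides.\<close>

lemma sesq_hermitian:
  assumes "\<And>x. Im (sesq S h x x) = 0"
  shows "sesq S h y x = cnj (sesq S h x y)"
proof -
  have "Im (sesq S h (\<lambda>s. x s + 1 * y s) (\<lambda>s. x s + 1 * y s)) = 0" by (rule assms)
  hence 1: "Im (sesq S h x y) + Im (sesq S h y x) = 0"
    unfolding sesq_add_left sesq_add_right by (simp add: assms)
  have "Im (sesq S h (\<lambda>s. x s + \<i> * y s) (\<lambda>s. x s + \<i> * y s)) = 0" by (rule assms)
  hence 2: "Re (sesq S h x y) = Re (sesq S h y x)"
    unfolding sesq_add_left sesq_add_right by (simp add: assms)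
  show ?thesis using 1 2 by (simp add: complex_eq_iff)
qed

lemma sesq_sum_left:
  assumes "\<And>x. Im (sesq S h x x) = 0"
  shows "sesq S h (\<lambda>s. \<Sum>i\<in>I. c i * y i s) x = (\<Sum>i\<in>I. cnj (c i) * sesq S h (y i) x)"
proof -
  have "sesq S h (\<lambda>s. \<Sum>i\<in>I. c i * y i s) x = cnj (sesq S h x (\<lambda>s. \<Sum>i\<in>I. c i * y i s))"
    by (rule sesq_hermitian[OF assms])
  also have "\<dots> = (\<Sum>i\<in>I. cnj (c i) * cnj (sesq S h x (y i)))"
    unfolding sesq_sum_right by simp
  finally show ?thesis by (simp flip: sesq_hermitian[OF assms, of _ x])
qed

section \<open>Bessel's inequality and completeness of orthonormal systems\<close>

lemma bessel_defect:
  assumes "finite I" "orthonormal_on S I e"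
  defines "r \<equiv> \<lambda>x s. x s - (\<Sum>l\<in>I. cip S (e l) x * e l s)"
  shows "l \<in> I \<Longrightarrow> cip S (e l) (r x) = 0"
    and "nrm2 S (r x) = nrm2 S x - (\<Sum>l\<in>I. (cmod (cip S (e l) x))\<^sup>2)"
proof -
  have r: "r x = (\<lambda>s. x s + (-1) * (\<Sum>l\<in>I. cip S (e l) x * e l s))" for x
    by (simp add: r_def)
  have orth: "cip S (e l) (r x) = 0" if "l \<in> I" for l
  proof -
    have "(\<Sum>i\<in>I. cip S (e i) x * cip S (e l) (e i)) = (\<Sum>i\<in>I. if i = l then cip S (e i) x else 0)"
      using assms(2) that by (intro sum.cong refl) (auto simp: orthonormal_on_def)
    thus ?thesis unfolding r cip_add_right cip_sum_right using that assms(1) by simp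
  qed
  thus "l \<in> I \<Longrightarrow> cip S (e l) (r x) = 0" .
  have "cip S (r x) (r x) = cip S (r x) x - (\<Sum>l\<in>I. cip S (e l) x * cip S (r x) (e l))"
    by (subst (2) r, unfold cip_add_right cip_sum_right) simp
  also have "(\<Sum>l\<in>I. cip S (e l) x * cip S (r x) (e l)) = 0"
    using orth by (intro sum.neutral) (metis cip_commute complex_cnj_zero mult_zero_right)
  also have "cip S (r x) x = cnj (cip S x (r x))" by (rule cip_commute)
  also have "cip S x (r x) = cip S x x - (\<Sum>l\<in>I. cip S (e l) x * cip S x (e l))"
    unfolding r cip_add_right cip_sum_right by simp
  also have "(\<Sum>l\<in>I. cip S (e l) x * cip S x (e l)) = (\<Sum>l\<in>I. of_real ((cmod (cip S (e l) x))\<^sup>2))"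
    by (intro sum.cong refl) (simp add: cip_commute[of S x] complex_norm_square del: of_real_power)
  finally have "of_real (nrm2 S (r x)) = (of_real (nrm2 S x - (\<Sum>l\<in>I. (cmod (cip S (e l) x))\<^sup>2)) :: complex)"
    unfolding cip_self by simp
  thus "nrm2 S (r x) = nrm2 S x - (\<Sum>l\<in>I. (cmod (cip S (e l) x))\<^sup>2)"
    using of_real_eq_iff by blast
qed

lemma bessel:
  assumes "finite I" "orthonormal_on S I e"
  shows "(\<Sum>l\<in>I. (cmod (cip S (e l) x))\<^sup>2) \<le> nrm2 S x"
  using bessel_defect(2)[OF assms, of x] nrm2_nonneg[of S "\<lambda>s. x s - (\<Sum>l\<in>I. cip S (e l) x * e l s)"]
  by linarith

lemma cip_delta: "finite S \<Longrightarrow> t \<in> S \<Longrightarrow> cip S x (\<lambda>s. if s = t then 1 else 0) = cnj (x t)"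
  by (simp add: cip_def if_distrib[of "\<lambda>z. _ * z"] cong: if_cong)

lemma nrm2_delta: "finite S \<Longrightarrow> t \<in> S \<Longrightarrow> nrm2 S (\<lambda>s. if s = t then 1 else 0) = 1"
  by (simp add: nrm2_def if_distrib[of "\<lambda>z. (cmod z)\<^sup>2"] cong: if_cong)

lemma orthonormal_nrm2: "orthonormal_on S I e \<Longrightarrow> l \<in> I \<Longrightarrow> nrm2 S (e l) = 1"
  unfolding orthonormal_on_def using cip_self[of S "e l"] by simp

text \<open>A trace count in place of a dimension argument: it shows that \<open>card S\<close>
  orthonormal vectors are complete and that fewer of them leave a nonzero orthogonal
  complement.\<close>

lemma sum_orthonormal_delta:
  assumes "finite S" "finite I" "orthonormal_on S I e"
  shows "(\<Sum>t\<in>S. \<Sum>l\<in>I. (cmod (cip S (e l) (\<lambda>s. if s = t then 1 else 0)))\<^sup>2) = real (card I)"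
proof -
  have "(\<Sum>t\<in>S. \<Sum>l\<in>I. (cmod (cip S (e l) (\<lambda>s. if s = t then 1 else 0)))\<^sup>2)
      = (\<Sum>l\<in>I. nrm2 S (e l))"
    unfolding nrm2_def using assms(1) by (subst sum.swap) (simp add: cip_delta)
  also have "\<dots> = real (card I)" using orthonormal_nrm2[OF assms(3)] by simp
  finally show ?thesis .
qed

text \<open>The Bessel defects of the coordinate vectors are nonnegative and, by the trace count,
  sum to \<open>card S - card S = 0\<close>. So every coordinate vector equals its expansion, and
  pairing with it gives the expansion of \<open>x\<close>.\<close>

lemma orthonormal_basis_expand:
  assumes "finite S" "orthonormal_on S S e" "t \<in> S"
  shows "x t = (\<Sum>l\<in>S. cip S (e l) x * e l t)"
proof -
  define d where "d t = (\<lambda>s. if s = t then 1 else 0 :: complex)" for t :: 'a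
  have "(\<Sum>t\<in>S. 1 - (\<Sum>l\<in>S. (cmod (cip S (e l) (d t)))\<^sup>2)) = 0"
    using sum_orthonormal_delta[OF assms(1,1,2)] by (simp add: sum_subtractf d_def)
  moreover have "0 \<le> 1 - (\<Sum>l\<in>S. (cmod (cip S (e l) (d t)))\<^sup>2)" if "t \<in> S" for t
    using bessel[OF assms(1,2), of "d t"] nrm2_delta[OF assms(1) that] by (simp add: d_def)
  ultimately have full: "1 - (\<Sum>l\<in>S. (cmod (cip S (e l) (d t)))\<^sup>2) = 0" if "t \<in> S" for t
    using assms(1) that by (subst (asm) sum_nonneg_eq_0_iff) auto
  have dexp: "d t s = (\<Sum>l\<in>S. cip S (e l) (d t) * e l s)" if "s \<in> S" for s
  proof -
    have "nrm2 S (\<lambda>s. d t s - (\<Sum>l\<in>S. cip S (e l) (d t) * e l s)) = 0"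
      using bessel_defect(2)[OF assms(1,2), of "d t"] full[OF assms(3)]
        nrm2_delta[OF assms(1,3)] by (simp add: d_def)
    thus ?thesis unfolding nrm2_def using assms(1) that
      by (subst (asm) sum_nonneg_eq_0_iff) auto
  qed
  have "x t = cnj (cip S x (d t))" using cip_delta[OF assms(1,3), of x] by (simp add: d_def)
  also have "cip S x (d t) = cip S x (\<lambda>s. \<Sum>l\<in>S. cip S (e l) (d t) * e l s)"
    using dexp by (simp add: cip_def)
  also have "\<dots> = (\<Sum>l\<in>S. cip S (e l) (d t) * cip S x (e l))" by (rule cip_sum_right)
  also have "\<dots> = (\<Sum>l\<in>S. cnj (cip S (e l) x * e l t))"
    using cip_delta[OF assms(1,3)] by (intro sum.cong refl) (simp add: d_def cip_commute[of S x] mult.commute)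
  finally show ?thesis by simp
qed

lemma parseval:
  assumes "finite S" "orthonormal_on S S e"
  shows "(\<Sum>l\<in>S. (cmod (cip S (e l) x))\<^sup>2) = nrm2 S x"
proof -
  have "nrm2 S (\<lambda>s. x s - (\<Sum>l\<in>S. cip S (e l) x * e l s)) = 0"
    using orthonormal_basis_expand[OF assms] by (simp add: nrm2_def)
  thus ?thesis using bessel_defect(2)[OF assms(1,2), of x] by simp
qed

section \<open>Spectral theorem by maximizing the quadratic form\<close>

lemma compact_finite_support_ball:
  fixes S :: "'a set"
  shows "compact {x :: 'a \<Rightarrow> complex. \<forall>s. x s \<in> (if s \<in> S then cball 0 1 else {0})}"
proof -
  have "compactin (product_topology (\<lambda>_::'a. euclidean :: complex topology) UNIV)
      (PiE UNIV (\<lambda>s. if s \<in> S then cball 0 1 else {0}))"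
    by (subst compactin_PiE) simp
  moreover have "PiE UNIV (\<lambda>s. if s \<in> S then cball 0 1 else {0 :: complex})
      = {x. \<forall>s. x s \<in> (if s \<in> S then cball 0 1 else {0})}"
    by (auto simp: PiE_def Pi_def)
  ultimately show ?thesis
    by (simp add: euclidean_product_topology)
qed

text \<open>The new vector maximizes the quadratic form on the unit sphere of the orthogonal
  complement of the system, and its third property is the stationarity condition.
  \<open>T \<subset> S\<close> guarantees that this sphere is not empty.\<close>

lemma spectral_extend:
  assumes "finite S" and herm: "\<And>x. Im (sesq S h x x) = 0"
    and "T \<subset> S" "orthonormal_on S T e"
  obtains v where "nrm2 S v = 1" "\<And>l. l \<in> T \<Longrightarrow> cip S (e l) v = 0"
    "\<And>y. (\<And>l. l \<in> T \<Longrightarrow> cip S (e l) y = 0) \<Longrightarrow> cip S v y = 0 \<Longrightarrow> sesq S h v y = 0"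
proof -
  have fT: "finite T" using assms finite_subset by blast
  define q where "q x = Re (sesq S h x x)" for x
  \<comment> \<open>Vectors are functions on a type that may be larger than \<open>S\<close>; values
    outside \<open>S\<close> do not affect the norm and are set to zero to obtain
    compactness.\<close>
  define A where "A = {x. \<forall>s. x s \<in> (if s \<in> S then cball 0 1 else {0 :: complex})}"
  define K where "K = {x \<in> A. nrm2 S x = 1 \<and> (\<forall>l\<in>T. cip S (e l) x = 0)}"
  have coord: "continuous_on UNIV (\<lambda>x :: 'a \<Rightarrow> complex. x s)" for s
    by (rule continuous_on_product_coordinates)
  have "closed ({x. nrm2 S x = 1} \<inter> (\<Inter>l\<in>T. {x. cip S (e l) x = 0}))"
    unfolding nrm2_def cip_def
    by (intro closed_Int closed_INT ballI closed_Collect_eq continuous_intros coord)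
  moreover have "{x. nrm2 S x = 1} \<inter> (\<Inter>l\<in>T. {x. cip S (e l) x = 0})
      = {x. nrm2 S x = 1 \<and> (\<forall>l\<in>T. cip S (e l) x = 0)}" by auto
  ultimately have cl: "closed {x. nrm2 S x = 1 \<and> (\<forall>l\<in>T. cip S (e l) x = 0)}" by simp
  have "compact K"
  proof -
    have "K = A \<inter> {x. nrm2 S x = 1 \<and> (\<forall>l\<in>T. cip S (e l) x = 0)}" by (auto simp: K_def)
    thus ?thesis using compact_finite_support_ball[of S] cl
      by (simp add: A_def compact_Int_closed)
  qed
  have scale: "\<exists>w\<in>K. \<exists>c. c > 0 \<and> (\<forall>s\<in>S. w s = of_real (1 / sqrt c) * x s) \<and> c = nrm2 S x"
    if orth: "\<And>l. l \<in> T \<Longrightarrow> cip S (e l) x = 0" and "nrm2 S x > 0" for x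
  proof -
    define c where "c = nrm2 S x"
    define w where "w s = (if s \<in> S then of_real (1 / sqrt c) * x s else 0)" for s
    have c: "c > 0" using that by (simp add: c_def)
    have n1: "nrm2 S w = 1"
    proof -
      have "nrm2 S w = (\<Sum>s\<in>S. (1 / c) * (cmod (x s))\<^sup>2)"
        unfolding nrm2_def w_def using c
        by (intro sum.cong refl) (simp add: norm_divide power_divide)
      also have "\<dots> = 1" using c by (simp add: c_def nrm2_def flip: sum_distrib_left sum_divide_distrib)
      finally show ?thesis .
    qed
    have "cmod (w s) \<le> 1" if "s \<in> S" for s
    proof -
      have "(cmod (w s))\<^sup>2 \<le> nrm2 S w" unfolding nrm2_def using assms(1) that
        by (intro member_le_sum) auto
      thus ?thesis using n1 by (simp add: power2_le_iff_abs_le abs_square_le_1)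
    qed
    hence "w \<in> A" by (auto simp: A_def w_def)
    moreover have "cip S (e l) w = of_real (1 / sqrt c) * cip S (e l) x" for l
      unfolding cip_def w_def sum_distrib_left by (intro sum.cong) auto
    ultimately have "w \<in> K" using n1 orth by (simp add: K_def)
    thus ?thesis using c by (intro bexI[of _ w] exI[of _ c]) (auto simp: w_def c_def)
  qed
  \<comment> \<open>Otherwise every coordinate vector would have a projection of norm at least 1,
    and the trace count would give \<open>card S \<le> card T\<close>.\<close>
  have "\<exists>t\<in>S. (\<Sum>l\<in>T. (cmod (cip S (e l) (\<lambda>s. if s = t then 1 else 0)))\<^sup>2) < 1"
  proof (rule ccontr)
    assume "\<not> ?thesis"
    hence "(\<Sum>t\<in>S. 1) \<le> (\<Sum>t\<in>S. \<Sum>l\<in>T. (cmod (cip S (e l) (\<lambda>s. if s = t then 1 else 0)))\<^sup>2)"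
      by (intro sum_mono) (simp add: not_less)
    thus False
      using psubset_card_mono[OF assms(1,3)] sum_orthonormal_delta[OF assms(1) fT assms(4)] by simp
  qed
  then obtain t where t: "t \<in> S" "(\<Sum>l\<in>T. (cmod (cip S (e l) (\<lambda>s. if s = t then 1 else 0)))\<^sup>2) < 1"
    by blast
  define d where "d = (\<lambda>s. if s = t then 1 else 0 :: complex)"
  have "nrm2 S (\<lambda>s. d s - (\<Sum>l\<in>T. cip S (e l) d * e l s)) > 0"
    using bessel_defect(2)[OF fT assms(4), of d] nrm2_delta[OF assms(1) t(1)] t(2)
    by (simp add: d_def)
  from scale[OF bessel_defect(1)[OF fT assms(4)] this] have "K \<noteq> {}" by blast
  have "continuous_on K q"
    unfolding q_def sesq_def
    by (intro continuous_intros continuous_on_subset[OF coord]) auto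
  from continuous_attains_sup[OF \<open>compact K\<close> \<open>K \<noteq> {}\<close> this]
  obtain v where v: "v \<in> K" "\<And>w. w \<in> K \<Longrightarrow> q w \<le> q v" by blast
  have v1: "nrm2 S v = 1" and v2: "\<And>l. l \<in> T \<Longrightarrow> cip S (e l) v = 0" using v(1) by (auto simp: K_def)
  \<comment> \<open>The homogeneous form of maximality, free of the norm constraint.\<close>
  have maxi: "q x \<le> q v * nrm2 S x" if "\<And>l. l \<in> T \<Longrightarrow> cip S (e l) x = 0" "nrm2 S x > 0" for x
  proof -
    note x = that
    obtain w c where w: "w \<in> K" "c > 0" "\<And>s. s \<in> S \<Longrightarrow> w s = of_real (1 / sqrt c) * x s" "c = nrm2 S x"
      using scale[of x] x by blast
    have "sesq S h w w = of_real (1 / c) * sesq S h x x"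
    proof -
      have "sesq S h w w = (\<Sum>s\<in>S. \<Sum>t\<in>S. of_real (1 / sqrt c) * of_real (1 / sqrt c) * (cnj (x s) * h s t * x t))"
        unfolding sesq_def using w(3) by (intro sum.cong refl) simp
      also have "of_real (1 / sqrt c) * of_real (1 / sqrt c) = (of_real (1 / c) :: complex)"
        using w(2) by (simp flip: of_real_mult)
      finally show ?thesis by (simp add: sesq_def sum_distrib_left)
    qed
    hence "q w = q x / c" by (simp add: q_def)
    hence "q x = q w * nrm2 S x" using w(2,4) by simp
    also have "\<dots> \<le> q v * nrm2 S x" using v(2)[OF w(1)] by (intro mult_right_mono) simp_all
    finally show ?thesis .
  qed
  have "sesq S h v y = 0" if y: "\<And>l. l \<in> T \<Longrightarrow> cip S (e l) y = 0" "cip S v y = 0" for y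
  proof (rule ccontr)
    define c where "c = sesq S h v y"
    assume "sesq S h v y \<noteq> 0"
    hence c: "c \<noteq> 0" by (simp add: c_def)
    define D where "D = nrm2 S y * q v - q y"
    \<comment> \<open>The perturbation is \<open>v + r * cnj c * y\<close>. The phase
      \<open>cnj c\<close> makes the first order gain equal to \<open>2 * r * |c|^2\<close>, while
      the second order loss is \<open>r^2 * D * |c|^2\<close>; the choice of \<open>r\<close> makes
      \<open>r * |D| < 1\<close>, so the gain wins.\<close>
    define r where "r = 1 / (\<bar>D\<bar> + 1)"
    have r: "r > 0" by (simp add: r_def add_nonneg_pos)
    define z where "z = of_real r * cnj c"
    define x where "x = (\<lambda>s. v s + z * y s)"
    have cc: "c * cnj c = of_real ((cmod c)\<^sup>2)" by (rule complex_norm_square[symmetric])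
    have z2: "cnj z * z = of_real (r\<^sup>2 * (cmod c)\<^sup>2)"
    proof -
      have "cnj z * z = of_real (r\<^sup>2) * (c * cnj c)" by (simp add: z_def power2_eq_square)
      thus ?thesis unfolding cc by simp
    qed
    have yv: "cip S y v = 0" using y(2) by (simp add: cip_commute[of S y])
    have "cip S x x = 1 + (cnj z * z) * cip S y y"
      unfolding x_def cip_add_left cip_add_right using y(2) yv v1 by (simp add: cip_self)
    hence "of_real (nrm2 S x) = (of_real (1 + r\<^sup>2 * (cmod c)\<^sup>2 * nrm2 S y) :: complex)"
      unfolding z2 cip_self by simp
    hence nx: "nrm2 S x = 1 + r\<^sup>2 * (cmod c)\<^sup>2 * nrm2 S y" using of_real_eq_iff by blast
    have "sesq S h x x = sesq S h v v + (z * c + cnj z * cnj c) + (cnj z * z) * sesq S h y y"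
      unfolding x_def sesq_add_left sesq_add_right c_def using sesq_hermitian[OF herm, of y v]
      by (simp add: algebra_simps)
    moreover have "z * c + cnj z * cnj c = of_real (2 * r * (cmod c)\<^sup>2)"
    proof -
      have "z * c + cnj z * cnj c = of_real (2 * r) * (c * cnj c)" by (simp add: z_def)
      thus ?thesis unfolding cc by simp
    qed
    ultimately have qx: "q x = q v + 2 * r * (cmod c)\<^sup>2 + r\<^sup>2 * (cmod c)\<^sup>2 * q y"
      unfolding q_def z2 by simp
    have "cip S (e l) x = 0" if "l \<in> T" for l
      unfolding x_def cip_add_right using y(1)[OF that] v2[OF that] by simp
    moreover have "nrm2 S x > 0" unfolding nx by (intro add_pos_nonneg mult_nonneg_nonneg) auto
    ultimately have "q x \<le> q v * nrm2 S x" by (rule maxi)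
    hence "(2 * r) * (cmod c)\<^sup>2 \<le> (r\<^sup>2 * D) * (cmod c)\<^sup>2"
      unfolding qx nx D_def by (simp add: algebra_simps)
    hence "2 * r \<le> r\<^sup>2 * D" using c by simp
    hence "2 \<le> r * D" using r by (simp add: power2_eq_square)
    also have "r * D \<le> r * \<bar>D\<bar>" using r by simp
    also have "\<dots> < 1" by (simp add: r_def)
    finally show False by simp
  qed
  thus ?thesis using that v1 v2 by blast
qed

text \<open>The induction carries invariance of the complement: whatever is orthogonal to the system
  is also \<open>h\<close>-orthogonal to it. Hence each new maximizer is \<open>h\<close>-orthogonal
  to the earlier vectors without further work.\<close>

lemma spectral:
  assumes "finite S" and herm: "\<And>x. Im (sesq S h x x) = 0"
  obtains e where "orthonormal_on S S e"
    "\<And>l m. l \<in> S \<Longrightarrow> m \<in> S \<Longrightarrow> l \<noteq> m \<Longrightarrow> sesq S h (e l) (e m) = 0"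
proof -
  have "T \<subseteq> S \<Longrightarrow> \<exists>e. orthonormal_on S T e \<and>
     (\<forall>y. (\<forall>l\<in>T. cip S (e l) y = 0) \<longrightarrow> (\<forall>l\<in>T. sesq S h (e l) y = 0)) \<and>
     (\<forall>l\<in>T. \<forall>m\<in>T. l \<noteq> m \<longrightarrow> sesq S h (e l) (e m) = 0)" if "finite T" for T
    using that
  proof (induction T rule: finite_induct)
    case empty
    show ?case by (auto simp: orthonormal_on_def)
  next
    case (insert t T)
    then obtain e where e: "orthonormal_on S T e"
      "\<And>y l. (\<And>l. l \<in> T \<Longrightarrow> cip S (e l) y = 0) \<Longrightarrow> l \<in> T \<Longrightarrow> sesq S h (e l) y = 0"
      "\<And>l m. l \<in> T \<Longrightarrow> m \<in> T \<Longrightarrow> l \<noteq> m \<Longrightarrow> sesq S h (e l) (e m) = 0" by auto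
    have "T \<subset> S" using insert by auto
    from spectral_extend[OF assms(1) herm this e(1)]
    obtain v where v: "nrm2 S v = 1" "\<And>l. l \<in> T \<Longrightarrow> cip S (e l) v = 0"
      "\<And>y. (\<And>l. l \<in> T \<Longrightarrow> cip S (e l) y = 0) \<Longrightarrow> cip S v y = 0 \<Longrightarrow> sesq S h v y = 0" by metis
    have v': "cip S v (e l) = 0" if "l \<in> T" for l
      using v(2)[OF that] by (simp add: cip_commute[of S v])
    have ev: "sesq S h (e l) v = 0" "sesq S h v (e l) = 0" if "l \<in> T" for l
      using e(2)[OF v(2) that] sesq_hermitian[OF herm, of v "e l"] by auto
    define e' where "e' = e(t := v)"
    have e't: "e' t = v" "\<And>l. l \<in> T \<Longrightarrow> e' l = e l" using insert by (auto simp: e'_def)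
    have "orthonormal_on S (insert t T) e'"
      using e(1) v(1,2) v' insert.hyps(2) by (auto simp: orthonormal_on_def e't cip_self)
    moreover have "sesq S h (e' l) y = 0"
      if "\<forall>l\<in>insert t T. cip S (e' l) y = 0" "l \<in> insert t T" for y l
      using that e(2) v(3) by (auto simp: e't)
    moreover have "sesq S h (e' l) (e' m) = 0"
      if "l \<in> insert t T" "m \<in> insert t T" "l \<noteq> m" for l m
      using that e(3) ev by (auto simp: e't)
    ultimately show ?case by (intro exI[of _ e']) blast
  qed
  from this[OF assms(1) subset_refl] obtain e where
    e: "orthonormal_on S S e" "\<forall>l\<in>S. \<forall>m\<in>S. l \<noteq> m \<longrightarrow> sesq S h (e l) (e m) = 0"
    by (elim exE conjE)
  show ?thesis by (rule that[OF e(1)]) (simp add: e(2))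
qed

lemma spectral_decomposition:
  assumes "finite S" and herm: "\<And>x. Im (sesq S h x x) = 0"
  obtains e where "orthonormal_on S S e"
    "\<And>l m. l \<in> S \<Longrightarrow> m \<in> S \<Longrightarrow> l \<noteq> m \<Longrightarrow> sesq S h (e l) (e m) = 0"
    "\<And>x. Re (sesq S h x x) = (\<Sum>l\<in>S. Re (sesq S h (e l) (e l)) * (cmod (cip S (e l) x))\<^sup>2)"
proof -
  obtain e where e: "orthonormal_on S S e"
    "\<And>l m. l \<in> S \<Longrightarrow> m \<in> S \<Longrightarrow> l \<noteq> m \<Longrightarrow> sesq S h (e l) (e m) = 0"
    using spectral[OF assms(1) herm] by metis
  have "sesq S h x x = (\<Sum>l\<in>S. of_real ((cmod (cip S (e l) x))\<^sup>2) * sesq S h (e l) (e l))" for x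
  proof -
    define x' where "x' = (\<lambda>s. \<Sum>l\<in>S. cip S (e l) x * e l s)"
    have "sesq S h x x = sesq S h x' x'"
      unfolding sesq_def x'_def
      using orthonormal_basis_expand[OF assms(1) e(1), of _ x] by (intro sum.cong refl) simp
    also have "\<dots> = (\<Sum>l\<in>S. cnj (cip S (e l) x) * sesq S h (e l) x')"
      by (subst x'_def) (simp add: sesq_sum_left[OF herm])
    also have "\<dots> = (\<Sum>l\<in>S. cnj (cip S (e l) x) * (cip S (e l) x * sesq S h (e l) (e l)))"
    proof (intro sum.cong refl arg_cong2[of _ _ _ _ "(*)"])
      fix l assume l: "l \<in> S"
      have "sesq S h (e l) x' = (\<Sum>m\<in>S. if m = l then cip S (e l) x * sesq S h (e l) (e l) else 0)"
        unfolding x'_def sesq_sum_right using e(2) l by (intro sum.cong refl) auto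
      thus "sesq S h (e l) x' = cip S (e l) x * sesq S h (e l) (e l)" using l assms(1) by simp
    qed
    also have "\<dots> = (\<Sum>l\<in>S. of_real ((cmod (cip S (e l) x))\<^sup>2) * sesq S h (e l) (e l))"
      by (intro sum.cong refl) (simp add: complex_norm_square mult_ac del: of_real_power)
    finally show ?thesis .
  qed
  note exp = this
  have "Re (sesq S h x x) = (\<Sum>l\<in>S. Re (sesq S h (e l) (e l)) * (cmod (cip S (e l) x))\<^sup>2)" for x
    using arg_cong[OF exp[of x], of Re] by (simp add: mult.commute del: of_real_power)
  from that[OF e this] show ?thesis .
qed

section \<open>Adjoint and singular values\<close>

definition mapp :: "'a set \<Rightarrow> ('b \<Rightarrow> 'a \<Rightarrow> complex) \<Rightarrow> ('a \<Rightarrow> complex) \<Rightarrow> 'b \<Rightarrow> complex" where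
  "mapp S W x t = (\<Sum>s\<in>S. W t s * x s)"

definition madj :: "'b set \<Rightarrow> ('b \<Rightarrow> 'a \<Rightarrow> complex) \<Rightarrow> ('b \<Rightarrow> complex) \<Rightarrow> 'a \<Rightarrow> complex" where
  "madj T W y s = (\<Sum>t\<in>T. cnj (W t s) * y t)"

lemma cip_madj: "cip S x (madj T W y) = cip T (mapp S W x) y"
  unfolding cip_def madj_def mapp_def sum_distrib_left cnj_sum sum_distrib_right
  by (subst sum.swap) (simp add: algebra_simps)

text \<open>\<open>e\<close> diagonalizes \<open>W^* W\<close>, and \<open>f l\<close> is
  \<open>W (e l)\<close> divided by its norm. If that norm is zero, the convention
  \<open>1 / 0 = 0\<close> makes \<open>f l\<close> vanish; this is why the conclusions are a norm
  bound and Bessel's inequality rather than orthonormality of \<open>f\<close>.\<close>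

lemma singular_values:
  fixes W :: "'b \<Rightarrow> 'a \<Rightarrow> complex"
  assumes "finite S" "finite T"
  obtains e f where "orthonormal_on S S e"
    "\<And>x. nrm2 S (madj T W x) = (\<Sum>l\<in>S. nrm2 T (mapp S W (e l)) * (cmod (cip T (f l) x))\<^sup>2)"
    "\<And>l. l \<in> S \<Longrightarrow> nrm2 T (f l) \<le> 1"
    "\<And>x. (\<Sum>l\<in>S. (cmod (cip T (f l) x))\<^sup>2) \<le> nrm2 T x"
proof -
  define h where "h s s' = (\<Sum>t\<in>T. cnj (W t s) * W t s')" for s s'
  have h: "sesq S h x y = cip T (mapp S W x) (mapp S W y)" for x y
  proof -
    have "cip T (mapp S W x) (mapp S W y) = (\<Sum>s\<in>S. cnj (x s) * madj T W (mapp S W y) s)"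
      using cip_madj[of S x T W "mapp S W y"] by (simp add: cip_def)
    also have "\<dots> = (\<Sum>s\<in>S. cnj (x s) * (\<Sum>t\<in>S. h s t * y t))"
    proof (intro sum.cong refl arg_cong2[of _ _ _ _ "(*)"])
      fix s
      show "madj T W (mapp S W y) s = (\<Sum>t\<in>S. h s t * y t)"
        unfolding madj_def mapp_def h_def sum_distrib_left sum_distrib_right
        by (subst sum.swap) (simp add: mult.assoc)
    qed
    finally show ?thesis by (simp add: sesq_def sum_distrib_left mult.assoc)
  qed
  have herm: "Im (sesq S h x x) = 0" for x unfolding h cip_self by simp
  obtain e where e: "orthonormal_on S S e"
    "\<And>l m. l \<in> S \<Longrightarrow> m \<in> S \<Longrightarrow> l \<noteq> m \<Longrightarrow> sesq S h (e l) (e m) = 0"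
    using spectral[OF assms(1) herm] by metis
  define lam where "lam l = nrm2 T (mapp S W (e l))" for l
  define f where "f l = (\<lambda>t. of_real (1 / sqrt (lam l)) * mapp S W (e l) t)" for l
  have lam0: "lam l \<ge> 0" for l by (simp add: lam_def)
  have cf: "cip T (f l) x = of_real (1 / sqrt (lam l)) * cip T (mapp S W (e l)) x" for l x
    by (simp add: cip_def f_def sum_distrib_left mult.assoc)
  have cff: "cip T (f l) (f m) = of_real (1 / sqrt (lam l) * (1 / sqrt (lam m))) * cip T (mapp S W (e l)) (mapp S W (e m))" for l m
    unfolding cf by (simp add: f_def cip_def sum_distrib_left mult_ac)
  define I where "I = {l\<in>S. lam l \<noteq> 0}"
  have "orthonormal_on T I f"
    unfolding orthonormal_on_def
  proof (intro ballI)
    fix l m assume lm: "l \<in> I" "m \<in> I"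
    show "cip T (f l) (f m) = (if l = m then 1 else 0)"
    proof (cases "l = m")
      case True
      have "cip T (f l) (f l) = of_real (1 / sqrt (lam l) * (1 / sqrt (lam l)) * lam l)"
        unfolding cff by (simp add: cip_self lam_def)
      also have "1 / sqrt (lam l) * (1 / sqrt (lam l)) * lam l = 1"
        using lm lam0[of l] by (simp add: I_def)
      finally show ?thesis using True by simp
    next
      case False
      thus ?thesis using e(2)[of l m] lm unfolding cff by (simp add: h I_def)
    qed
  qed
  have f0: "f l t = 0" if "l \<notin> I" "l \<in> S" for l t using that by (simp add: f_def I_def)
  have fI: "finite I" using assms(1) by (simp add: I_def)
  have A: "nrm2 S (madj T W x) = (\<Sum>l\<in>S. lam l * (cmod (cip T (f l) x))\<^sup>2)" for x
  proof -
    have "nrm2 S (madj T W x) = (\<Sum>l\<in>S. (cmod (cip S (e l) (madj T W x)))\<^sup>2)"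
      using parseval[OF assms(1) e(1)] by simp
    also have "\<dots> = (\<Sum>l\<in>S. lam l * (cmod (cip T (f l) x))\<^sup>2)"
    proof (intro sum.cong refl)
      fix l assume "l \<in> S"
      show "(cmod (cip S (e l) (madj T W x)))\<^sup>2 = lam l * (cmod (cip T (f l) x))\<^sup>2"
      proof (cases "lam l = 0")
        case True
        hence "\<forall>t\<in>T. mapp S W (e l) t = 0"
          using assms(2) unfolding lam_def nrm2_def by (subst (asm) sum_nonneg_eq_0_iff) auto
        thus ?thesis using True unfolding cip_madj by (simp add: cip_def)
      next
        case False
        thus ?thesis using lam0[of l] unfolding cf cip_madj
          by (simp add: norm_mult norm_divide power_mult_distrib power_divide)
      qed
    qed
    finally show ?thesis .
  qed
  have B: "nrm2 T (f l) \<le> 1" if "l \<in> S" for l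
  proof (cases "l \<in> I")
    case True
    from orthonormal_nrm2[OF \<open>orthonormal_on T I f\<close> this] show ?thesis by linarith
  next
    case False thus ?thesis using that f0 by (simp add: nrm2_def)
  qed
  have C: "(\<Sum>l\<in>S. (cmod (cip T (f l) x))\<^sup>2) \<le> nrm2 T x" for x
  proof -
    have "(\<Sum>l\<in>S. (cmod (cip T (f l) x))\<^sup>2) = (\<Sum>l\<in>I. (cmod (cip T (f l) x))\<^sup>2)"
      using assms(1) f0 by (intro sum.mono_neutral_right) (auto simp: I_def cip_def)
    thus ?thesis using bessel[OF fI \<open>orthonormal_on T I f\<close>, of x] by simp
  qed
  show ?thesis by (rule that[OF e(1) A[unfolded lam_def] B C])
qed

section \<open>Multiplication of homogeneous polynomials\<close>

text \<open>The space \<open>H\<^sub>k\<close> is represented by homogeneous polynomials of degree \<open>k\<close>, i.e. by functions on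
  the multi-indices \<open>mi k\<close>: the value at \<open>n\<close> is the coefficient with respect to the unit vector
  \<open>z\<^sup>n / sqrt (n!)\<close> of Fock space. In these coordinates \<open>vmat g\<close> is the matrix of
  multiplication by \<open>g\<close>, its adjoint \<open>madj _ (vmat g)\<close> is the differential operator \<open>g(d/dz)\<close> with
  conjugated coefficients, and \<open>pdiff \<alpha> g\<close> is the partial derivative of \<open>g\<close> of order \<open>\<alpha>\<close> divided by \<open>sqrt (\<alpha>!)\<close>.\<close>

definition mi :: "nat \<Rightarrow> ('n::finite \<Rightarrow> nat) set" where
  "mi k = {n. sum n UNIV = k}"

definition mfact :: "('n::finite \<Rightarrow> nat) \<Rightarrow> real" where
  "mfact n = (\<Prod>i\<in>UNIV. fact (n i))"

definition bb :: "('n::finite \<Rightarrow> nat) \<Rightarrow> ('n \<Rightarrow> nat) \<Rightarrow> real" where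
  "bb m a = sqrt (mfact (m + a) / (mfact m * mfact a))"

definition vmat :: "(('n::finite \<Rightarrow> nat) \<Rightarrow> complex) \<Rightarrow> ('n \<Rightarrow> nat) \<Rightarrow> ('n \<Rightarrow> nat) \<Rightarrow> complex" where
  "vmat g n m = (if m \<le> n then of_real (bb m (n - m)) * g (n - m) else 0)"

definition pdiff :: "('n::finite \<Rightarrow> nat) \<Rightarrow> (('n \<Rightarrow> nat) \<Rightarrow> complex) \<Rightarrow> ('n \<Rightarrow> nat) \<Rightarrow> complex" where
  "pdiff \<alpha> g a = of_real (bb a \<alpha>) * g (a + \<alpha>)"

section \<open>Arithmetic of multi-indices\<close>

lemma mfact_pos [simp]: "mfact n > 0" unfolding mfact_def by (intro prod_pos) simp

lemma mfact_nz [simp]: "mfact n \<noteq> 0" using mfact_pos[of n] by linarith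

lemma finite_mi [simp, intro]: "finite (mi k :: ('n::finite \<Rightarrow> nat) set)"
proof (rule finite_subset)
  show "mi k \<subseteq> (PiE UNIV (\<lambda>_. {..k}) :: ('n \<Rightarrow> nat) set)"
    unfolding mi_def PiE_def Pi_def by (auto intro: member_le_sum)
qed (simp add: finite_PiE)

lemma sum_minus_fun: "m \<le> (n :: 'n::finite \<Rightarrow> nat) \<Longrightarrow> sum (n - m) UNIV = sum n UNIV - sum m UNIV"
  by (simp add: le_fun_def sum_subtractf_nat)

lemma sum_le_fun: "m \<le> (n :: 'n::finite \<Rightarrow> nat) \<Longrightarrow> sum m UNIV \<le> sum n UNIV"
  by (simp add: le_fun_def sum_mono)

lemma fun_add_diff: "m \<le> (n :: 'n \<Rightarrow> nat) \<Longrightarrow> m + (n - m) = n"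
  by (auto simp: le_fun_def fun_eq_iff)

lemma fun_add_diff': "(m + a) - m = (a :: 'n \<Rightarrow> nat)" "(m + a) - a = (m :: 'n \<Rightarrow> nat)"
  by (auto simp: fun_eq_iff)

lemma le_fun_add: "m \<le> m + (a :: 'n \<Rightarrow> nat)" "a \<le> m + a"
  by (auto simp: le_fun_def)

lemma mi_add: "m \<in> mi k \<Longrightarrow> a \<in> mi j \<Longrightarrow> m + a \<in> mi (k + j)"
  by (simp add: mi_def sum.distrib)

lemma mi_diff: "n \<in> mi (k + j) \<Longrightarrow> m \<in> mi k \<Longrightarrow> m \<le> n \<Longrightarrow> n - m \<in> mi j"
  by (simp add: mi_def sum_subtractf_nat le_fun_def)

lemma sum_mi_add:
  fixes m :: "'n::finite \<Rightarrow> nat"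
  assumes "m \<in> mi k"
  shows "(\<Sum>n\<in>mi (k + j). if m \<le> n then F n else 0) = (\<Sum>a\<in>mi j. F (m + a))"
proof -
  have "(\<Sum>n\<in>mi (k + j). if m \<le> n then F n else 0) = (\<Sum>n\<in>{n\<in>mi (k + j). m \<le> n}. F n)"
    by (rule sum.inter_filter[symmetric]) simp
  also have "\<dots> = (\<Sum>a\<in>mi j. F (m + a))"
    using assms
    by (intro sum.reindex_bij_witness[of _ "\<lambda>a. m + a" "\<lambda>n. n - m"])
      (auto simp: mi_add mi_diff[of _ k] fun_add_diff fun_add_diff' le_fun_add)
  finally show ?thesis .
qed

lemma madj_vmat:
  fixes m :: "'n::finite \<Rightarrow> nat"
  assumes "m \<in> mi k"
  shows "madj (mi (k + j)) (vmat g) y m = (\<Sum>a\<in>mi j. of_real (bb m a) * cnj (g a) * y (m + a))"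
proof -
  have "madj (mi (k + j)) (vmat g) y m
      = (\<Sum>n\<in>mi (k + j). if m \<le> n then of_real (bb m (n - m)) * cnj (g (n - m)) * y n else 0)"
    unfolding madj_def vmat_def by (intro sum.cong refl) simp
  also have "\<dots> = (\<Sum>a\<in>mi j. of_real (bb m a) * cnj (g a) * y (m + a))"
    by (subst sum_mi_add[OF assms]) (simp add: fun_add_diff')
  finally show ?thesis .
qed

text \<open>Compares the coefficients of \<open>x^l\<close> in \<open>(x + 1)^(sum n)\<close>,
  expanded at once and as a product over the coordinates.\<close>

lemma multi_vandermonde:
  fixes n :: "'n::finite \<Rightarrow> nat"
  shows "(\<Sum>\<alpha>\<in>{\<alpha>\<in>mi l. \<alpha> \<le> n}. \<Prod>i\<in>UNIV. real (n i choose \<alpha> i)) = real (sum n UNIV choose l)"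
proof -
  define N where "N = sum n UNIV"
  define P where "P = PiE UNIV (\<lambda>i. {..n i})"
  have P: "\<alpha> \<in> P \<longleftrightarrow> \<alpha> \<le> n" for \<alpha> by (auto simp: P_def PiE_def Pi_def le_fun_def)
  have fP: "finite P" unfolding P_def by (intro finite_PiE) auto
  define c where "c l = (\<Sum>\<alpha>\<in>{\<alpha>\<in>P. sum \<alpha> UNIV = l}. \<Prod>i\<in>UNIV. real (n i choose \<alpha> i))" for l
  have "(\<Sum>l\<le>N. real (N choose l) * x ^ l) = (\<Sum>l\<le>N. c l * x ^ l)" for x :: real
  proof -
    have "(\<Sum>l\<le>N. real (N choose l) * x ^ l) = (x + 1) ^ N"
      by (simp add: binomial_ring)
    also have "\<dots> = (\<Prod>i\<in>UNIV. (x + 1) ^ n i)" by (simp add: N_def power_sum)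
    also have "\<dots> = (\<Prod>i\<in>UNIV. \<Sum>a\<le>n i. real (n i choose a) * x ^ a)"
      by (simp add: binomial_ring)
    also have "\<dots> = (\<Sum>\<alpha>\<in>P. \<Prod>i\<in>UNIV. real (n i choose \<alpha> i) * x ^ \<alpha> i)"
      unfolding P_def by (subst prod_sum_PiE) auto
    also have "\<dots> = (\<Sum>\<alpha>\<in>P. (\<Prod>i\<in>UNIV. real (n i choose \<alpha> i)) * x ^ sum \<alpha> UNIV)"
      by (simp add: prod.distrib power_sum)
    also have "\<dots> = (\<Sum>l\<le>N. \<Sum>\<alpha>\<in>{\<alpha>\<in>P. sum \<alpha> UNIV = l}. (\<Prod>i\<in>UNIV. real (n i choose \<alpha> i)) * x ^ sum \<alpha> UNIV)"
      using fP P by (intro sum.group[symmetric]) (auto simp: N_def sum_le_fun)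
    also have "\<dots> = (\<Sum>l\<le>N. c l * x ^ l)"
      unfolding c_def sum_distrib_right by (intro sum.cong refl) auto
    finally show ?thesis .
  qed
  hence eq: "\<forall>l\<le>N. real (N choose l) = c l"
    using polyfun_eq_coeffs[of "\<lambda>l. real (N choose l)" N c] by simp
  have cl: "c l = (\<Sum>\<alpha>\<in>{\<alpha>\<in>mi l. \<alpha> \<le> n}. \<Prod>i\<in>UNIV. real (n i choose \<alpha> i))"
    unfolding c_def by (intro sum.cong) (auto simp: P mi_def)
  show ?thesis
  proof (cases "l \<le> N")
    case True thus ?thesis using eq cl by (simp add: N_def)
  next
    case False
    hence "{\<alpha>\<in>mi l. \<alpha> \<le> n} = {}" using sum_le_fun[of _ n] by (auto simp: mi_def N_def)
    hence "(\<Sum>\<alpha>\<in>{\<alpha>\<in>mi l. \<alpha> \<le> n}. \<Prod>i\<in>UNIV. real (n i choose \<alpha> i)) = 0" by (simp only: sum.empty)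
    thus ?thesis using False by (simp add: N_def)
  qed
qed

lemma bb_sq: "(bb m a)\<^sup>2 = mfact (m + a) / (mfact m * mfact a)"
  unfolding bb_def by (simp add: less_imp_le)

text \<open>The coefficient of \<open>g\<close> at \<open>n\<close> is counted with the sum over
  \<open>\<alpha>\<close> of the multi-index binomials of \<open>n\<close> over
  \<open>\<alpha>\<close>. That sum depends only on the degree of \<open>n\<close>, so the
  derivatives of a fixed order jointly see nothing of \<open>g\<close> but its norm.\<close>

lemma sum_nrm2_pdiff:
  fixes g :: "('n::finite \<Rightarrow> nat) \<Rightarrow> complex"
  assumes "i \<le> j"
  shows "(\<Sum>\<alpha>\<in>mi (j - i). nrm2 (mi i) (pdiff \<alpha> g)) = real (j choose i) * nrm2 (mi j) g"
proof -
  define w where "w \<alpha> n = (\<Prod>i\<in>UNIV. real (n i choose \<alpha> i)) * (cmod (g n))\<^sup>2" for \<alpha> n :: "'n \<Rightarrow> nat"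
  have "(\<Sum>\<alpha>\<in>mi (j - i). nrm2 (mi i) (pdiff \<alpha> g)) = (\<Sum>\<alpha>\<in>mi (j - i). \<Sum>c\<in>mi i. w \<alpha> (\<alpha> + c))"
  proof (intro sum.cong refl, unfold nrm2_def, intro sum.cong refl)
    fix \<alpha> c :: "'n \<Rightarrow> nat"
    have "mfact (c + \<alpha>) / (mfact c * mfact \<alpha>) = (\<Prod>i\<in>UNIV. real ((\<alpha> + c) i choose \<alpha> i))"
      unfolding mfact_def
      by (simp add: binomial_fact add.commute mult.commute flip: prod_dividef prod.distrib)
    thus "(cmod (pdiff \<alpha> g c))\<^sup>2 = w \<alpha> (\<alpha> + c)"
      by (simp add: pdiff_def w_def norm_mult power_mult_distrib bb_sq add.commute)
  qed
  also have "\<dots> = (\<Sum>\<alpha>\<in>mi (j - i). \<Sum>n\<in>mi j. if \<alpha> \<le> n then w \<alpha> n else 0)"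
  proof (rule sum.cong[OF refl])
    fix \<alpha> :: "'n \<Rightarrow> nat" assume "\<alpha> \<in> mi (j - i)"
    from sum_mi_add[OF this, where j = i and F = "w \<alpha>"] assms
    show "(\<Sum>c\<in>mi i. w \<alpha> (\<alpha> + c)) = (\<Sum>n\<in>mi j. if \<alpha> \<le> n then w \<alpha> n else 0)" by simp
  qed
  also have "\<dots> = (\<Sum>n\<in>mi j. \<Sum>\<alpha>\<in>mi (j - i). if \<alpha> \<le> n then w \<alpha> n else 0)"
    by (rule sum.swap)
  also have "\<dots> = (\<Sum>n\<in>mi j. real (j choose i) * (cmod (g n))\<^sup>2)"
  proof (intro sum.cong refl)
    fix n :: "'n \<Rightarrow> nat" assume n: "n \<in> mi j"
    have "(\<Sum>\<alpha>\<in>mi (j - i). if \<alpha> \<le> n then w \<alpha> n else 0) = (\<Sum>\<alpha>\<in>{\<alpha>\<in>mi (j - i). \<alpha> \<le> n}. w \<alpha> n)"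
      by (rule sum.inter_filter[symmetric]) simp
    also have "\<dots> = real (j choose (j - i)) * (cmod (g n))\<^sup>2"
      unfolding w_def sum_distrib_right[symmetric] multi_vandermonde using n by (simp add: mi_def)
    finally show "(\<Sum>\<alpha>\<in>mi (j - i). if \<alpha> \<le> n then w \<alpha> n else 0) = real (j choose i) * (cmod (g n))\<^sup>2"
      using assms by (simp add: binomial_symmetric[symmetric])
  qed
  finally show ?thesis by (simp add: nrm2_def sum_distrib_left)
qed

text \<open>After multiplication by \<open>fact a * fact m\<close> the summands are
  \<open>(a choose \<alpha>) * (m choose (a' - \<alpha>))\<close>. The index set is exactly the
  support of this product, so the whole Vandermonde sum is present.\<close>

lemma vandermonde_fact:
  fixes m a m' a' :: nat
  assumes "m + a = m' + a'"
  shows "(\<Sum>\<alpha>\<in>{\<alpha>. \<alpha> \<le> a \<and> \<alpha> \<le> a' \<and> a' \<le> m + \<alpha>}.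
            1 / (fact (m - (a' - \<alpha>)) * fact (a' - \<alpha>) * fact (a - \<alpha>) * fact \<alpha> :: real))
         = fact (m + a) / (fact a * fact m * fact a' * fact m')"
proof -
  have "(\<Sum>\<alpha>\<in>{\<alpha>. \<alpha> \<le> a \<and> \<alpha> \<le> a' \<and> a' \<le> m + \<alpha>}.
            1 / (fact (m - (a' - \<alpha>)) * fact (a' - \<alpha>) * fact (a - \<alpha>) * fact \<alpha> :: real))
      = (\<Sum>\<alpha>\<in>{\<alpha>. \<alpha> \<le> a \<and> \<alpha> \<le> a' \<and> a' \<le> m + \<alpha>}. real ((a choose \<alpha>) * (m choose (a' - \<alpha>))) / (fact a * fact m))"
    by (intro sum.cong refl) (auto simp: binomial_fact field_simps)
  also have "\<dots> = (\<Sum>\<alpha>\<le>a'. real ((a choose \<alpha>) * (m choose (a' - \<alpha>))) / (fact a * fact m))"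
    by (intro sum.mono_neutral_left) (auto simp: not_le)
  also have "\<dots> = real (\<Sum>\<alpha>\<le>a'. (a choose \<alpha>) * (m choose (a' - \<alpha>))) / (fact a * fact m)"
    by (simp add: sum_divide_distrib)
  also have "(\<Sum>\<alpha>\<le>a'. (a choose \<alpha>) * (m choose (a' - \<alpha>))) = (m + a) choose a'"
    by (subst vandermonde) (simp add: add.commute)
  also have "real ((m + a) choose a') = fact (m + a) / (fact a' * fact m')"
    using assms by (simp add: binomial_fact)
  finally show ?thesis by (simp add: field_simps)
qed

lemma multi_vandermonde_fact:
  fixes m a m' a' :: "'n::finite \<Rightarrow> nat"
  assumes "m + a = m' + a'"
  shows "(\<Sum>\<alpha>\<in>{\<alpha>. \<alpha> \<le> a \<and> \<alpha> \<le> a' \<and> a' \<le> m + \<alpha>}.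
            1 / (mfact (m - (a' - \<alpha>)) * mfact (a' - \<alpha>) * mfact (a - \<alpha>) * mfact \<alpha>))
         = mfact (m + a) / (mfact a * mfact m * mfact a' * mfact m')"
proof -
  define B where "B i = {\<alpha>. \<alpha> \<le> a i \<and> \<alpha> \<le> a' i \<and> a' i \<le> m i + \<alpha>}" for i
  have fB: "finite (B i)" for i by (rule finite_subset[of _ "{..a i}"]) (auto simp: B_def)
  define F :: "'n \<Rightarrow> nat \<Rightarrow> real" where
    "F i \<alpha> = 1 / (fact (m i - (a' i - \<alpha>)) * fact (a' i - \<alpha>) * fact (a i - \<alpha>) * fact \<alpha>)" for i \<alpha>
  have eq: "m i + a i = m' i + a' i" for i using assms by (metis plus_fun_apply)
  have "{\<alpha>. \<alpha> \<le> a \<and> \<alpha> \<le> a' \<and> a' \<le> m + \<alpha>} = PiE UNIV B"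
    by (auto simp: B_def PiE_def Pi_def le_fun_def)
  hence "(\<Sum>\<alpha>\<in>{\<alpha>. \<alpha> \<le> a \<and> \<alpha> \<le> a' \<and> a' \<le> m + \<alpha>}.
            1 / (mfact (m - (a' - \<alpha>)) * mfact (a' - \<alpha>) * mfact (a - \<alpha>) * mfact \<alpha>))
      = (\<Sum>\<alpha>\<in>PiE UNIV B. \<Prod>i\<in>UNIV. F i (\<alpha> i))"
    by (intro sum.cong) (simp_all add: mfact_def F_def prod_dividef flip: prod.distrib)
  also have "\<dots> = (\<Prod>i\<in>UNIV. \<Sum>\<alpha>\<in>B i. F i \<alpha>)"
    using fB by (intro prod_sum_PiE[symmetric]) auto
  also have "\<dots> = (\<Prod>i\<in>UNIV. fact (m i + a i) / (fact (a i) * fact (m i) * fact (a' i) * fact (m' i)))"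
    using vandermonde_fact[OF eq] by (simp add: B_def F_def)
  also have "\<dots> = mfact (m + a) / (mfact a * mfact m * mfact a' * mfact m')"
    by (simp add: mfact_def prod_dividef prod.distrib)
  finally show ?thesis .
qed

text \<open>Normal ordering (Bombieri's identity): multiplication on \<open>H\<^sub>k\<close> by a polynomial of degree \<open>j\<close> is expressed through
  the adjoints of multiplications by its derivatives, whose degrees are \<open>\<le> j\<close> and which act on the
  same \<open>H\<^sub>k\<close>. Comparing coefficients reduces it to Vandermonde's identity in each variable.\<close>

lemma nrm2_vmat:
  fixes g \<psi> :: "('n::finite \<Rightarrow> nat) \<Rightarrow> complex"
  shows "nrm2 (mi (k + j)) (mapp (mi k) (vmat g) \<psi>)
    = (\<Sum>i\<in>{i. i \<le> j \<and> i \<le> k}. \<Sum>\<alpha>\<in>mi (j - i). nrm2 (mi (k - i)) (madj (mi k) (vmat (pdiff \<alpha> g)) \<psi>))"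
proof -
  define fs :: "('n \<Rightarrow> nat) \<Rightarrow> complex" where "fs n = of_real (sqrt (mfact n))" for n
  define mf :: "('n \<Rightarrow> nat) \<Rightarrow> complex" where "mf n = of_real (mfact n)" for n
  have fs0: "fs n \<noteq> 0" for n by (simp add: fs_def)
  have fsf: "fs n * fs n = mf n" for n
    by (simp add: fs_def mf_def less_imp_le flip: of_real_mult)
  have cfs: "cnj (fs n) = fs n" for n by (simp add: fs_def)
  have bbfs: "of_real (bb m a) = fs (m + a) / (fs m * fs a)" for m a
    by (simp add: bb_def fs_def real_sqrt_divide real_sqrt_mult)
  define G :: "('n \<Rightarrow> nat) \<times> ('n \<Rightarrow> nat) \<times> ('n \<Rightarrow> nat) \<times> ('n \<Rightarrow> nat) \<Rightarrow> complex" where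
    "G = (\<lambda>(a, m, a', m'). g a * \<psi> m * cnj (g a') * cnj (\<psi> m'))"
  define D :: "('n \<Rightarrow> nat) \<times> ('n \<Rightarrow> nat) \<times> ('n \<Rightarrow> nat) \<times> ('n \<Rightarrow> nat) \<Rightarrow> complex" where
    "D = (\<lambda>(a, m, a', m'). fs a * fs m * fs a' * fs m')"
  \<comment> \<open>The coefficient monomials that occur on either side:
    \<open>g a * \<psi> m\<close> meets the conjugate of \<open>g a' * \<psi> m'\<close> precisely
    when both contribute to the same multi-index \<open>m + a = m' + a'\<close>.\<close>
  define X where "X = {(a, m, a', m'). a \<in> mi j \<and> m \<in> mi k \<and> a' \<in> mi j \<and> m' \<in> mi k \<and> m + a = m' + (a' :: 'n \<Rightarrow> nat)}"
  have fX: "finite X"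
    by (rule finite_subset[of _ "mi j \<times> mi k \<times> mi j \<times> mi k"]) (auto simp: X_def)

  have lhs: "of_real (nrm2 (mi (k + j)) (mapp (mi k) (vmat g) \<psi>))
     = (\<Sum>x\<in>X. mf (fst (snd x) + fst x) / D x * G x)"
  proof -
    define M where "M n = {m\<in>mi k. m \<le> (n :: 'n \<Rightarrow> nat)}" for n
    have fM: "finite (M n)" for n by (simp add: M_def)
    define v where "v n m = fs n / (fs m * fs (n - m)) * (g (n - m) * \<psi> m)" for n m
    have mapp: "mapp (mi k) (vmat g) \<psi> n = (\<Sum>m\<in>M n. v n m)" for n
    proof -
      have "mapp (mi k) (vmat g) \<psi> n = (\<Sum>m\<in>mi k. if m \<le> n then v n m else 0)"
        unfolding mapp_def vmat_def v_def by (intro sum.cong refl) (simp add: bbfs fun_add_diff)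
      thus ?thesis by (simp add: M_def sum.inter_filter)
    qed
    have "of_real (nrm2 (mi (k + j)) (mapp (mi k) (vmat g) \<psi>))
       = (\<Sum>n\<in>mi (k + j). (\<Sum>m\<in>M n. v n m) * cnj (\<Sum>m'\<in>M n. v n m'))"
      unfolding nrm2_def of_real_sum complex_norm_square mapp ..
    also have "\<dots> = (\<Sum>n\<in>mi (k + j). \<Sum>(m, m')\<in>M n \<times> M n. v n m * cnj (v n m'))"
      by (simp add: sum_product sum.cartesian_product)
    also have "\<dots> = (\<Sum>(n, m, m')\<in>(SIGMA n:mi (k + j). M n \<times> M n). v n m * cnj (v n m'))"
      using fM by (subst sum.Sigma) (auto intro!: sum.cong)
    also have "\<dots> = (\<Sum>x\<in>X. mf (fst (snd x) + fst x) / D x * G x)"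
    proof (rule sum.reindex_bij_witness[of _ "\<lambda>(a, m, a', m'). (m + a, m, m')" "\<lambda>(n, m, m'). (n - m, m, n - m', m')"])
      fix t assume t: "t \<in> (SIGMA n:mi (k + j). M n \<times> M n)"
      obtain n m m' where [simp]: "t = (n, m, m')" by (cases t)
      have le: "n \<in> mi (k + j)" "m \<in> mi k" "m' \<in> mi k" "m \<le> n" "m' \<le> n" using t by (auto simp: M_def)
      show "(\<lambda>(a, m, a', m'). (m + a, m, m')) ((\<lambda>(n, m, m'). (n - m, m, n - m', m')) t) = t"
        using le by (simp add: fun_add_diff)
      show "(\<lambda>(n, m, m'). (n - m, m, n - m', m')) t \<in> X"
        using le mi_diff[OF le(1,2,4)] mi_diff[OF le(1,3,5)] by (simp add: X_def fun_add_diff)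
      show "mf (fst (snd ((\<lambda>(n, m, m'). (n - m, m, n - m', m')) t)) + fst ((\<lambda>(n, m, m'). (n - m, m, n - m', m')) t))
          / D ((\<lambda>(n, m, m'). (n - m, m, n - m', m')) t) * G ((\<lambda>(n, m, m'). (n - m, m, n - m', m')) t)
          = (case t of (n, m, m') \<Rightarrow> v n m * cnj (v n m'))"
        using le by (simp add: fun_add_diff v_def D_def G_def cfs field_simps flip: fsf)
    next
      fix t assume t: "t \<in> X"
      obtain a m a' m' where [simp]: "t = (a, m, a', m')" by (cases t)
      have le: "a \<in> mi j" "m \<in> mi k" "a' \<in> mi j" "m' \<in> mi k" "m + a = m' + a'" using t by (auto simp: X_def)
      show "(\<lambda>(n, m, m'). (n - m, m, n - m', m')) ((\<lambda>(a, m, a', m'). (m + a, m, m')) t) = t"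
        using fun_add_diff'(1)[of m a] fun_add_diff'(1)[of m' a'] le(5) by simp
      show "(\<lambda>(a, m, a', m'). (m + a, m, m')) t \<in> (SIGMA n:mi (k + j). M n \<times> M n)"
        using le mi_add[OF le(2,1)] le_fun_add(1)[of m a] le_fun_add(1)[of m' a'] by (simp add: M_def)
    qed
    finally show ?thesis .
  qed

  define I where "I = {i. i \<le> j \<and> i \<le> k}"
  have fI: "finite I" by (rule finite_subset[of _ "{..j}"]) (auto simp: I_def)
  define T :: "(nat \<times> ('n \<Rightarrow> nat) \<times> ('n \<Rightarrow> nat) \<times> ('n \<Rightarrow> nat) \<times> ('n \<Rightarrow> nat)) set" where
    "T = (SIGMA i:I. mi (j - i) \<times> mi (k - i) \<times> mi i \<times> mi i)"
  have fT: "finite T" unfolding T_def using fI by (intro finite_SigmaI) auto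
  \<comment> \<open>The monomial produced by the derivative \<open>\<alpha>\<close>, the output
    index \<open>p\<close> and the summation indices \<open>c\<close>, \<open>c'\<close> of the two
    factors. The indices cross because the adjoint conjugates \<open>g\<close>: the unconjugated
    \<open>g\<close> comes from the conjugated factor, hence \<open>c' + \<alpha>\<close> in the
    first place.\<close>
  define \<phi> :: "(nat \<times> ('n \<Rightarrow> nat) \<times> ('n \<Rightarrow> nat) \<times> ('n \<Rightarrow> nat) \<times> ('n \<Rightarrow> nat)) \<Rightarrow> _" where
    "\<phi> = (\<lambda>(i, \<alpha>, p, c, c'). (c' + \<alpha>, p + c, c + \<alpha>, p + c'))"
  define w where "w \<alpha> p c c' = 1 / (mfact p * mfact c * mfact c' * mfact \<alpha>)" for \<alpha> p c c' :: "'n \<Rightarrow> nat"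
  define u :: "(nat \<times> ('n \<Rightarrow> nat) \<times> ('n \<Rightarrow> nat) \<times> ('n \<Rightarrow> nat) \<times> ('n \<Rightarrow> nat)) \<Rightarrow> real" where
    "u = (\<lambda>(i, \<alpha>, p, c, c'). w \<alpha> p c c')"

  have sq: "of_real (nrm2 (mi (k - i)) (madj (mi k) (vmat (pdiff \<alpha> g)) \<psi>))
      = (\<Sum>(p, c, c')\<in>mi (k - i) \<times> mi i \<times> mi i. of_real (w \<alpha> p c c') * D (\<phi> (i, \<alpha>, p, c, c')) * G (\<phi> (i, \<alpha>, p, c, c')))"
    if i: "i \<in> I" for i \<alpha>
  proof -
    define z where "z p c = fs (p + c) / (fs p * fs c) * (fs (c + \<alpha>) / (fs c * fs \<alpha>)) * (cnj (g (c + \<alpha>)) * \<psi> (p + c))" for p c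
    have "madj (mi k) (vmat (pdiff \<alpha> g)) \<psi> p = (\<Sum>c\<in>mi i. z p c)" if "p \<in> mi (k - i)" for p
      using madj_vmat[OF that, of i "pdiff \<alpha> g" \<psi>] i
      by (simp add: I_def pdiff_def bbfs cfs z_def mult_ac)
    hence "of_real (nrm2 (mi (k - i)) (madj (mi k) (vmat (pdiff \<alpha> g)) \<psi>))
        = (\<Sum>p\<in>mi (k - i). (\<Sum>c\<in>mi i. z p c) * cnj (\<Sum>c\<in>mi i. z p c))"
      unfolding nrm2_def of_real_sum complex_norm_square by (intro sum.cong refl) simp
    also have "\<dots> = (\<Sum>p\<in>mi (k - i). \<Sum>(c, c')\<in>mi i \<times> mi i. z p c * cnj (z p c'))"
      by (simp add: sum_product sum.cartesian_product)
    also have "\<dots> = (\<Sum>(p, c, c')\<in>mi (k - i) \<times> mi i \<times> mi i. z p c * cnj (z p c'))"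
      by (simp add: sum.cartesian_product)
    also have "\<dots> = (\<Sum>(p, c, c')\<in>mi (k - i) \<times> mi i \<times> mi i. of_real (w \<alpha> p c c') * D (\<phi> (i, \<alpha>, p, c, c')) * G (\<phi> (i, \<alpha>, p, c, c')))"
    proof (rule sum.cong[OF refl], clarify)
      fix p c c'
      have "of_real (w \<alpha> p c c') = 1 / (mf p * mf c * mf c' * mf \<alpha>)" by (simp add: w_def mf_def)
      thus "z p c * cnj (z p c') = of_real (w \<alpha> p c c') * D (\<phi> (i, \<alpha>, p, c, c')) * G (\<phi> (i, \<alpha>, p, c, c'))"
        by (simp add: z_def D_def G_def \<phi>_def cfs field_simps flip: fsf)
    qed
    finally show ?thesis .
  qed

  have "of_real (\<Sum>i\<in>I. \<Sum>\<alpha>\<in>mi (j - i). nrm2 (mi (k - i)) (madj (mi k) (vmat (pdiff \<alpha> g)) \<psi>))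
     = (\<Sum>i\<in>I. \<Sum>\<alpha>\<in>mi (j - i). \<Sum>(p, c, c')\<in>mi (k - i) \<times> mi i \<times> mi i.
          of_real (w \<alpha> p c c') * D (\<phi> (i, \<alpha>, p, c, c')) * G (\<phi> (i, \<alpha>, p, c, c')))"
    unfolding of_real_sum using sq by (intro sum.cong[OF refl]) simp
  also have "\<dots> = (\<Sum>i\<in>I. \<Sum>(\<alpha>, p, c, c')\<in>mi (j - i) \<times> mi (k - i) \<times> mi i \<times> mi i.
          of_real (w \<alpha> p c c') * D (\<phi> (i, \<alpha>, p, c, c')) * G (\<phi> (i, \<alpha>, p, c, c')))"
    by (simp add: sum.cartesian_product)
  also have "\<dots> = (\<Sum>t\<in>T. of_real (u t) * D (\<phi> t) * G (\<phi> t))"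
    unfolding T_def using fI by (subst sum.Sigma) (auto simp: u_def intro!: sum.cong)
  also have "\<dots> = (\<Sum>x\<in>X. \<Sum>t\<in>{t\<in>T. \<phi> t = x}. of_real (u t) * D (\<phi> t) * G (\<phi> t))"
  proof (rule sum.group[OF fT fX, symmetric])
    show "\<phi> ` T \<subseteq> X"
    proof
      fix x assume "x \<in> \<phi> ` T"
      then obtain i \<alpha> p c c' where t: "(i, \<alpha>, p, c, c') \<in> T" and x: "x = \<phi> (i, \<alpha>, p, c, c')"
        by auto
      have "i \<le> j" "i \<le> k" "\<alpha> \<in> mi (j - i)" "p \<in> mi (k - i)" "c \<in> mi i" "c' \<in> mi i"
        using t by (auto simp: T_def I_def)
      moreover from this have "c' + \<alpha> \<in> mi j" "c + \<alpha> \<in> mi j" "p + c \<in> mi k" "p + c' \<in> mi k"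
        using mi_add[of c' i \<alpha> "j - i"] mi_add[of c i \<alpha> "j - i"] mi_add[of p "k - i" c i] mi_add[of p "k - i" c' i]
        by auto
      ultimately show "x \<in> X" unfolding x \<phi>_def X_def by (simp add: add_ac)
    qed
  qed
  also have "\<dots> = (\<Sum>x\<in>X. mf (fst (snd x) + fst x) / D x * G x)"
  proof (rule sum.cong[OF refl])
    fix x assume x: "x \<in> X"
    obtain a m a' m' where xe: "x = (a, m, a', m')" by (cases x)
    have le: "a \<in> mi j" "m \<in> mi k" "a' \<in> mi j" "m' \<in> mi k" "m + a = m' + a'" using x xe by (auto simp: X_def)
    have le5: "m i + a i = m' i + a' i" for i using le(5) by (metis plus_fun_apply)
    define B where "B = {\<alpha>. \<alpha> \<le> a \<and> \<alpha> \<le> a' \<and> a' \<le> m + \<alpha>}"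
    \<comment> \<open>On a fibre of \<open>\<phi>\<close> the order \<open>\<alpha>\<close> of the
      derivative determines everything: \<open>c = a' - \<alpha>\<close>,
      \<open>c' = a - \<alpha>\<close>, \<open>p = m - c\<close>, and \<open>i\<close> is the degree
      of \<open>c\<close>.\<close>
    have "(\<Sum>t\<in>{t\<in>T. \<phi> t = x}. u t) = (\<Sum>\<alpha>\<in>B. 1 / (mfact (m - (a' - \<alpha>)) * mfact (a' - \<alpha>) * mfact (a - \<alpha>) * mfact \<alpha>))"
    proof (rule sum.reindex_bij_witness[of _ "\<lambda>\<alpha>. (j - sum \<alpha> UNIV, \<alpha>, m - (a' - \<alpha>), a' - \<alpha>, a - \<alpha>)" "\<lambda>(i, \<alpha>, p, c, c'). \<alpha>"])
      fix t assume t: "t \<in> {t\<in>T. \<phi> t = x}"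
      obtain i \<alpha> p c c' where te: "t = (i, \<alpha>, p, c, c')" by (cases t)
      have ii: "i \<le> j" "\<alpha> \<in> mi (j - i)" and e: "a = c' + \<alpha>" "m = p + c" "a' = c + \<alpha>" "m' = p + c'"
        using t unfolding te xe by (auto simp: T_def I_def \<phi>_def)
      have e2: "a - \<alpha> = c'" "a' - \<alpha> = c" "m - c = p"
        unfolding e by (simp_all add: fun_eq_iff)
      show "(\<lambda>\<alpha>. (j - sum \<alpha> UNIV, \<alpha>, m - (a' - \<alpha>), a' - \<alpha>, a - \<alpha>)) ((\<lambda>(i, \<alpha>, p, c, c'). \<alpha>) t) = t"
        using ii by (simp add: te e2 mi_def)
      show "(\<lambda>(i, \<alpha>, p, c, c'). \<alpha>) t \<in> B"
        by (simp add: te B_def e le_fun_def)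
      show "1 / (mfact (m - (a' - (\<lambda>(i, \<alpha>, p, c, c'). \<alpha>) t)) * mfact (a' - (\<lambda>(i, \<alpha>, p, c, c'). \<alpha>) t) *
              mfact (a - (\<lambda>(i, \<alpha>, p, c, c'). \<alpha>) t) * mfact ((\<lambda>(i, \<alpha>, p, c, c'). \<alpha>) t)) = u t"
        by (simp add: te e2 u_def w_def)
    next
      fix \<alpha> assume "\<alpha> \<in> B"
      hence b: "\<alpha> \<le> a" "\<alpha> \<le> a'" "a' - \<alpha> \<le> m" and b': "\<And>i. \<alpha> i \<le> a i" "\<And>i. \<alpha> i \<le> a' i" "\<And>i. a' i \<le> m i + \<alpha> i"
        by (auto simp: B_def le_fun_def le_diff_conv)
      show "(\<lambda>(i, \<alpha>, p, c, c'). \<alpha>) (j - sum \<alpha> UNIV, \<alpha>, m - (a' - \<alpha>), a' - \<alpha>, a - \<alpha>) = \<alpha>" by simp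
      have s: "sum \<alpha> UNIV \<le> j" "sum (a' - \<alpha>) UNIV = j - sum \<alpha> UNIV" "sum (a - \<alpha>) UNIV = j - sum \<alpha> UNIV"
        "sum (a' - \<alpha>) UNIV \<le> k" "sum (m - (a' - \<alpha>)) UNIV = k - sum (a' - \<alpha>) UNIV"
        using sum_le_fun[OF b(1)] sum_minus_fun[OF b(1)] sum_minus_fun[OF b(2)] sum_le_fun[OF b(3)] sum_minus_fun[OF b(3)] le(1-4)
        by (auto simp only: mi_def mem_Collect_eq)
      have "a - \<alpha> + \<alpha> = a" "m - (a' - \<alpha>) + (a' - \<alpha>) = m" "a' - \<alpha> + \<alpha> = a'"
        using b' by (auto simp: fun_eq_iff le_diff_conv)
      moreover have "m - (a' - \<alpha>) + (a - \<alpha>) = m'"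
      proof
        fix i show "(m - (a' - \<alpha>) + (a - \<alpha>)) i = m' i"
          using b'[of i] le5[of i] by simp
      qed
      ultimately show "(j - sum \<alpha> UNIV, \<alpha>, m - (a' - \<alpha>), a' - \<alpha>, a - \<alpha>) \<in> {t\<in>T. \<phi> t = x}"
        using s unfolding T_def \<phi>_def I_def xe by (simp only: mem_Collect_eq mem_Sigma_iff mi_def prod.case) auto
    qed
    also have "\<dots> = mfact (m + a) / (mfact a * mfact m * mfact a' * mfact m')"
      unfolding B_def by (rule multi_vandermonde_fact[OF le(5)])
    finally have us: "of_real (\<Sum>t\<in>{t\<in>T. \<phi> t = x}. u t) = mf (m + a) / (mf a * mf m * mf a' * mf m')"
      by (simp add: mf_def)
    have "(\<Sum>t\<in>{t\<in>T. \<phi> t = x}. of_real (u t) * D (\<phi> t) * G (\<phi> t))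
        = of_real (\<Sum>t\<in>{t\<in>T. \<phi> t = x}. u t) * D x * G x"
      unfolding of_real_sum sum_distrib_right by (intro sum.cong refl) simp
    also have "\<dots> = mf (m + a) / D x * G x"
      unfolding us using fs0 by (simp add: xe D_def field_simps flip: fsf)
    finally show "(\<Sum>t\<in>{t\<in>T. \<phi> t = x}. of_real (u t) * D (\<phi> t) * G (\<phi> t))
        = mf (fst (snd x) + fst x) / D x * G x" by (simp add: xe)
  qed
  finally have "of_real (\<Sum>i\<in>I. \<Sum>\<alpha>\<in>mi (j - i). nrm2 (mi (k - i)) (madj (mi k) (vmat (pdiff \<alpha> g)) \<psi>))
      = (of_real (nrm2 (mi (k + j)) (mapp (mi k) (vmat g) \<psi>)) :: complex)"
    by (simp only: lhs)
  thus ?thesis unfolding I_def of_real_eq_iff by (rule sym)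
qed

section \<open>Majorization\<close>

text \<open>Raising the coordinate \<open>i0\<close> by \<open>j\<close> embeds \<open>mi k\<close>
  into \<open>mi (k + j)\<close> and misses only indices with \<open>n i0 < j\<close>. For the power
  of one variable those span the kernel of \<open>V V^*\<close>, so this is the passage from the
  spectrum of \<open>V^* V\<close> to that of \<open>V V^*\<close>.\<close>

lemma sum_mi_shift:
  fixes i0 :: "'n::finite"
  assumes "\<And>n. h n \<ge> (0 :: real)"
  shows "(\<Sum>n\<in>mi k. h (n i0 + j)) \<le> (\<Sum>n\<in>(mi (k + j) :: ('n \<Rightarrow> nat) set). h (n i0))"
proof -
  define s :: "('n \<Rightarrow> nat) \<Rightarrow> 'n \<Rightarrow> nat" where "s n = n(i0 := n i0 + j)" for n
  have inj: "inj s"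
  proof (rule injI)
    fix x y assume "s x = s y"
    hence "s x i = s y i" for i by simp
    hence "x i = y i" for i by (cases "i = i0") (auto simp: s_def dest: spec split: if_splits, (metis add_right_cancel fun_upd_same fun_upd_other)+)
    thus "x = y" by blast
  qed
  have sums: "sum (s n) UNIV = sum n UNIV + j" for n
  proof -
    have "sum (s n) UNIV = s n i0 + sum (s n) (UNIV - {i0})" by (intro sum.remove) auto
    also have "sum (s n) (UNIV - {i0}) = sum n (UNIV - {i0})" by (intro sum.cong) (auto simp: s_def)
    also have "s n i0 + sum n (UNIV - {i0}) = sum n UNIV + j"
      by (subst (2) sum.remove[of _ i0]) (auto simp: s_def)
    finally show ?thesis .
  qed
  have "(\<Sum>n\<in>mi k. h (n i0 + j)) = (\<Sum>n\<in>s ` mi k. h (n i0))"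
    using inj by (subst sum.reindex) (auto simp: inj_on_def s_def)
  also have "\<dots> \<le> (\<Sum>n\<in>mi (k + j). h (n i0))"
  proof (rule sum_mono2)
    show "s ` mi k \<subseteq> mi (k + j)" using sums by (auto simp: mi_def)
  qed (use assms in auto)
  finally show ?thesis .
qed

text \<open>Vandermonde's identity, read as normal ordering for a power of one variable:
  \<open>(m + j) choose j\<close> is the eigenvalue of \<open>V^* V\<close> at occupation number
  \<open>m\<close>, and the summands are the contributions of the derivatives.\<close>

lemma sum_choose_mult: "(\<Sum>i\<le>j. real (j choose i) * real (m choose i)) = real ((m + j) choose j)"
proof -
  have "(m + j) choose j = (\<Sum>i\<le>j. (m choose i) * (j choose (j - i)))" by (rule vandermonde[symmetric])
  also have "\<dots> = (\<Sum>i\<le>j. (j choose i) * (m choose i))"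
    by (intro sum.cong refl) (simp add: binomial_symmetric[symmetric])
  finally show ?thesis by simp
qed

text \<open>For \<open>m \<le> n\<close> all differences \<open>(n choose i) - (m choose i)\<close>
  are nonnegative and otherwise none is positive. So the positive part commutes with the sum; this
  is the exact additivity that dictates the choice of thresholds.\<close>

lemma sum_choose_mult_pos_part:
  "(\<Sum>i\<le>j. real (j choose i) * max 0 (real (n choose i) - real (m choose i)))
     = max 0 (real ((n + j) choose j) - real ((m + j) choose j))"
proof (cases "m \<le> n")
  case True
  have "max 0 (real (n choose i) - real (m choose i)) = real (n choose i) - real (m choose i)" for i
    using binomial_right_mono[OF True, of i] by simp
  moreover have "max 0 (real ((n + j) choose j) - real ((m + j) choose j)) = real ((n + j) choose j) - real ((m + j) choose j)"
    using binomial_right_mono[of "m + j" "n + j" j] True by simp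
  ultimately show ?thesis
    by (simp only: right_diff_distrib sum_subtractf sum_choose_mult)
next
  case False
  have "max 0 (real (n choose i) - real (m choose i)) = 0" for i
    using binomial_right_mono[of n m i] False by simp
  moreover have "max 0 (real ((n + j) choose j) - real ((m + j) choose j)) = 0"
    using binomial_right_mono[of "n + j" "m + j" j] False by simp
  ultimately show ?thesis by simp
qed

text \<open>The trace of the positive part of \<open>V V^* - (m choose j)\<close> on
  \<open>H_k\<close> when \<open>V\<close> is multiplication by the normalised \<open>j\<close>-th
  power of the variable \<open>i0\<close>.\<close>

definition coherent_sum :: "'n::finite \<Rightarrow> nat \<Rightarrow> nat \<Rightarrow> nat \<Rightarrow> real" where
  "coherent_sum i0 k j m = (\<Sum>n\<in>(mi k :: ('n \<Rightarrow> nat) set). max 0 (real (n i0 choose j) - real (m choose j)))"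

lemma coherent_sum_nonneg [simp]: "coherent_sum i0 k j m \<ge> 0"
  by (simp add: coherent_sum_def sum_nonneg)

text \<open>Weak majorization of the spectrum of \<open>V V\<^sup>*\<close>, where \<open>V\<close> is multiplication by \<open>g\<close> with values in \<open>H\<^sub>k\<close>: for \<open>g\<close> the
  normalised \<open>j\<close>-th power of the variable \<open>i0\<close>, the eigenvalues are \<open>n i0 choose j\<close> for \<open>n \<in> mi k\<close>. The
  thresholds are restricted to the binomials \<open>m choose j\<close> with \<open>m\<close> independent of \<open>j\<close>, so that the bounds for the
  various \<open>j\<close> have a common optimal projection and can be added.\<close>

definition majorized_at :: "'n::finite \<Rightarrow> nat \<Rightarrow> bool" where
  "majorized_at i0 k \<longleftrightarrow> (\<forall>j m g (I :: ('n \<Rightarrow> nat) set) (x :: _ \<Rightarrow> ('n \<Rightarrow> nat) \<Rightarrow> complex) \<gamma>. j \<le> k \<longrightarrow> finite I \<longrightarrow> orthonormal_on (mi k) I x \<longrightarrow>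
     (\<forall>i\<in>I. 0 \<le> \<gamma> i \<and> \<gamma> i \<le> 1) \<longrightarrow>
     (\<Sum>i\<in>I. \<gamma> i * nrm2 (mi (k - j)) (madj (mi k) (vmat g) (x i)))
       \<le> nrm2 (mi j) g * (real (m choose j) * (\<Sum>i\<in>I. \<gamma> i) + coherent_sum i0 k j m))"

text \<open>Normal ordering turns \<open>V^* V\<close> on \<open>H_k\<close> into operators
  \<open>W W^*\<close> on the same space, to which the hypothesis applies with the same
  \<open>e\<close>, \<open>\<gamma>\<close> and \<open>m\<close>. The norms of the derivatives
  supply the weights \<open>j choose i\<close>, and these raise the thresholds from
  \<open>m choose i\<close> to \<open>(m + j) choose j\<close>.\<close>

lemma majorized_mapp:
  fixes i0 :: "'n::finite" and e :: "('n \<Rightarrow> nat) \<Rightarrow> ('n \<Rightarrow> nat) \<Rightarrow> complex"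
  assumes P: "majorized_at i0 k" and e: "orthonormal_on (mi k) (mi k) e"
    and \<gamma>: "\<And>l. l \<in> mi k \<Longrightarrow> 0 \<le> \<gamma> l \<and> \<gamma> l \<le> 1"
  shows "(\<Sum>l\<in>mi k. \<gamma> l * nrm2 (mi (k + j)) (mapp (mi k) (vmat g) (e l)))
    \<le> nrm2 (mi j) g * (real ((m + j) choose j) * (\<Sum>l\<in>mi k. \<gamma> l)
        + (\<Sum>n\<in>(mi k :: ('n \<Rightarrow> nat) set). max 0 (real ((n i0 + j) choose j) - real ((m + j) choose j))))"
proof -
  define I where "I = {i. i \<le> j \<and> i \<le> k}"
  have I: "I \<subseteq> {..j}" by (auto simp: I_def)
  define \<Gamma> where "\<Gamma> = (\<Sum>l\<in>mi k. \<gamma> l)"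
  have \<Gamma>: "\<Gamma> \<ge> 0" unfolding \<Gamma>_def using \<gamma> by (intro sum_nonneg) blast
  have "(\<Sum>l\<in>mi k. \<gamma> l * nrm2 (mi (k + j)) (mapp (mi k) (vmat g) (e l)))
     = (\<Sum>l\<in>mi k. \<Sum>i\<in>I. \<Sum>\<alpha>\<in>mi (j - i). \<gamma> l * nrm2 (mi (k - i)) (madj (mi k) (vmat (pdiff \<alpha> g)) (e l)))"
    unfolding nrm2_vmat I_def sum_distrib_left ..
  also have "\<dots> = (\<Sum>i\<in>I. \<Sum>l\<in>mi k. \<Sum>\<alpha>\<in>mi (j - i). \<gamma> l * nrm2 (mi (k - i)) (madj (mi k) (vmat (pdiff \<alpha> g)) (e l)))"
    by (rule sum.swap)
  also have "\<dots> = (\<Sum>i\<in>I. \<Sum>\<alpha>\<in>mi (j - i). \<Sum>l\<in>mi k. \<gamma> l * nrm2 (mi (k - i)) (madj (mi k) (vmat (pdiff \<alpha> g)) (e l)))"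
    by (rule sum.cong[OF refl], rule sum.swap)
  also have "\<dots> \<le> (\<Sum>i\<in>I. \<Sum>\<alpha>\<in>mi (j - i). nrm2 (mi i) (pdiff \<alpha> g) * (real (m choose i) * \<Gamma> + coherent_sum i0 k i m))"
  proof (rule sum_mono, rule sum_mono)
    fix i and \<alpha> :: "'n \<Rightarrow> nat" assume "i \<in> I"
    hence "i \<le> k" by (simp add: I_def)
    thus "(\<Sum>l\<in>mi k. \<gamma> l * nrm2 (mi (k - i)) (madj (mi k) (vmat (pdiff \<alpha> g)) (e l)))
       \<le> nrm2 (mi i) (pdiff \<alpha> g) * (real (m choose i) * \<Gamma> + coherent_sum i0 k i m)"
      using P[unfolded majorized_at_def, rule_format, of i "mi k" e \<gamma>] e \<gamma> by (simp add: \<Gamma>_def)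
  qed
  also have "\<dots> = (\<Sum>i\<in>I. real (j choose i) * nrm2 (mi j) g * (real (m choose i) * \<Gamma> + coherent_sum i0 k i m))"
    using sum_nrm2_pdiff[of _ j g] by (intro sum.cong[OF refl]) (simp add: I_def flip: sum_distrib_right)
  \<comment> \<open>Nonnegative terms with \<open>i > k\<close> are added to complete the
    Vandermonde sums.\<close>
  also have "\<dots> \<le> (\<Sum>i\<le>j. real (j choose i) * nrm2 (mi j) g * (real (m choose i) * \<Gamma> + coherent_sum i0 k i m))"
    using I \<Gamma> by (intro sum_mono2) (auto intro!: mult_nonneg_nonneg add_nonneg_nonneg)
  also have "\<dots> = nrm2 (mi j) g * ((\<Sum>i\<le>j. real (j choose i) * real (m choose i)) * \<Gamma>
        + (\<Sum>i\<le>j. real (j choose i) * coherent_sum i0 k i m))"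
    by (simp add: sum_distrib_left sum_distrib_right sum.distrib algebra_simps)
  also have "(\<Sum>i\<le>j. real (j choose i) * coherent_sum i0 k i m)
      = (\<Sum>n\<in>(mi k :: ('n \<Rightarrow> nat) set). max 0 (real ((n i0 + j) choose j) - real ((m + j) choose j)))"
    unfolding coherent_sum_def sum_distrib_left sum_choose_mult_pos_part[symmetric] by (rule sum.swap)
  finally show ?thesis by (simp add: sum_choose_mult \<Gamma>_def)
qed

text \<open>For \<open>j > 0\<close> the source \<open>H_(k - j)\<close> of \<open>V\<close> is
  covered by the induction hypothesis, and singular values carry the bound for \<open>V^* V\<close>
  there over to \<open>V V^*\<close> on \<open>H_k\<close>. For \<open>j = 0\<close> the operator is
  a scalar and the bound is immediate.\<close>

lemma majorized_at: "majorized_at (i0 :: 'n::finite) k"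
proof (induction k rule: less_induct)
  case (less k)
  show ?case
    unfolding majorized_at_def
  proof (intro allI impI)
    fix j m :: nat and g :: "('n \<Rightarrow> nat) \<Rightarrow> complex" and I :: "('n \<Rightarrow> nat) set"
      and x :: "('n \<Rightarrow> nat) \<Rightarrow> ('n \<Rightarrow> nat) \<Rightarrow> complex" and \<gamma> :: "('n \<Rightarrow> nat) \<Rightarrow> real"
    assume jk: "j \<le> k" and I: "finite I" and x: "orthonormal_on (mi k) I x" and \<gamma>: "\<forall>i\<in>I. 0 \<le> \<gamma> i \<and> \<gamma> i \<le> 1"
    show "(\<Sum>i\<in>I. \<gamma> i * nrm2 (mi (k - j)) (madj (mi k) (vmat g) (x i)))
       \<le> nrm2 (mi j) g * (real (m choose j) * (\<Sum>i\<in>I. \<gamma> i) + coherent_sum i0 k j m)"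
    proof (cases "j = 0")
      case True
      have mi0: "(mi 0 :: ('n \<Rightarrow> nat) set) = {0}" by (auto simp: mi_def fun_eq_iff)
      have b0: "bb n 0 = 1" for n :: "'n \<Rightarrow> nat" by (simp add: bb_def mfact_def[of 0])
      have "nrm2 (mi k) (madj (mi k) (vmat g) (x i)) = (cmod (g 0))\<^sup>2 * nrm2 (mi k) (x i)" for i
        unfolding nrm2_def sum_distrib_left
        using madj_vmat[of _ k 0 g "x i"] by (intro sum.cong refl) (simp add: mi0 b0 norm_mult power_mult_distrib)
      hence "(\<Sum>i\<in>I. \<gamma> i * nrm2 (mi (k - j)) (madj (mi k) (vmat g) (x i))) = (cmod (g 0))\<^sup>2 * (\<Sum>i\<in>I. \<gamma> i)"
        using True orthonormal_nrm2[OF x] by (simp add: mult.commute sum_distrib_right)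
      thus ?thesis using True by (simp add: nrm2_def mi0 coherent_sum_def)
    next
      case False
      define k' where "k' = k - j"
      have k: "k = k' + j" and "k' < k" using jk False by (auto simp: k'_def)
      have P: "majorized_at i0 k'" by (rule less.IH) fact
      obtain e f :: "('n \<Rightarrow> nat) \<Rightarrow> ('n \<Rightarrow> nat) \<Rightarrow> complex" where e: "orthonormal_on (mi k') (mi k') e"
        and sv: "\<And>y. nrm2 (mi k') (madj (mi k) (vmat g) y)
           = (\<Sum>l\<in>mi k'. nrm2 (mi k) (mapp (mi k') (vmat g) (e l)) * (cmod (cip (mi k) (f l) y))\<^sup>2)"
        and f1: "\<And>l. l \<in> mi k' \<Longrightarrow> nrm2 (mi k) (f l) \<le> 1"
        and f2: "\<And>y. (\<Sum>l\<in>mi k'. (cmod (cip (mi k) (f l) y))\<^sup>2) \<le> nrm2 (mi k) y"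
        by (rule singular_values[OF finite_mi finite_mi, of k' k "vmat g"]) (rule that, assumption+)
      \<comment> \<open>The weights that the system \<open>x\<close> induces on the singular
        vectors. Bessel's inequality for \<open>x\<close> bounds each of them by 1, Bessel's
        inequality for \<open>f\<close> bounds their total.\<close>
      define \<delta> where "\<delta> l = (\<Sum>i\<in>I. \<gamma> i * (cmod (cip (mi k) (f l) (x i)))\<^sup>2)" for l
      have \<delta>: "0 \<le> \<delta> l \<and> \<delta> l \<le> 1" if "l \<in> mi k'" for l
      proof
        show "0 \<le> \<delta> l" unfolding \<delta>_def using \<gamma> by (intro sum_nonneg) auto
        have "\<delta> l \<le> (\<Sum>i\<in>I. (cmod (cip (mi k) (x i) (f l)))\<^sup>2)"
          unfolding \<delta>_def
        proof (rule sum_mono)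
          fix i assume "i \<in> I"
          hence "\<gamma> i * (cmod (cip (mi k) (f l) (x i)))\<^sup>2 \<le> 1 * (cmod (cip (mi k) (f l) (x i)))\<^sup>2"
            using \<gamma> by (intro mult_right_mono) auto
          thus "\<gamma> i * (cmod (cip (mi k) (f l) (x i)))\<^sup>2 \<le> (cmod (cip (mi k) (x i) (f l)))\<^sup>2"
            by (simp add: cip_commute[of _ "x i"])
        qed
        also have "\<dots> \<le> nrm2 (mi k) (f l)" by (rule bessel[OF I x])
        also have "\<dots> \<le> 1" by (rule f1[OF that])
        finally show "\<delta> l \<le> 1" .
      qed
      have \<delta>\<gamma>: "(\<Sum>l\<in>mi k'. \<delta> l) \<le> (\<Sum>i\<in>I. \<gamma> i)"
      proof -
        have "(\<Sum>l\<in>mi k'. \<delta> l) = (\<Sum>i\<in>I. \<gamma> i * (\<Sum>l\<in>mi k'. (cmod (cip (mi k) (f l) (x i)))\<^sup>2))"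
          unfolding \<delta>_def sum_distrib_left by (rule sum.swap)
        also have "\<dots> \<le> (\<Sum>i\<in>I. \<gamma> i * 1)"
        proof (rule sum_mono)
          fix i assume i: "i \<in> I"
          show "\<gamma> i * (\<Sum>l\<in>mi k'. (cmod (cip (mi k) (f l) (x i)))\<^sup>2) \<le> \<gamma> i * 1"
            using f2[of "x i"] orthonormal_nrm2[OF x i] \<gamma> i by (intro mult_left_mono) auto
        qed
        finally show ?thesis by simp
      qed
      have "(\<Sum>i\<in>I. \<gamma> i * nrm2 (mi (k - j)) (madj (mi k) (vmat g) (x i)))
         = (\<Sum>i\<in>I. \<Sum>l\<in>mi k'. nrm2 (mi k) (mapp (mi k') (vmat g) (e l)) * (\<gamma> i * (cmod (cip (mi k) (f l) (x i)))\<^sup>2))"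
        by (simp add: k'_def[symmetric] sv sum_distrib_left mult_ac)
      also have "\<dots> = (\<Sum>l\<in>mi k'. \<delta> l * nrm2 (mi (k' + j)) (mapp (mi k') (vmat g) (e l)))"
        unfolding \<delta>_def k[symmetric] by (subst sum.swap) (simp add: sum_distrib_left mult_ac)
      also have "\<dots> \<le> nrm2 (mi j) g * (real (m choose j) * (\<Sum>i\<in>I. \<gamma> i) + coherent_sum i0 k j m)"
      proof (cases "j \<le> m")
        case True
        have "(\<Sum>l\<in>mi k'. \<delta> l * nrm2 (mi (k' + j)) (mapp (mi k') (vmat g) (e l)))
          \<le> nrm2 (mi j) g * (real (m choose j) * (\<Sum>l\<in>mi k'. \<delta> l)
            + (\<Sum>n\<in>(mi k' :: ('n \<Rightarrow> nat) set). max 0 (real ((n i0 + j) choose j) - real (m choose j))))"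
          using majorized_mapp[OF P e, where \<gamma> = \<delta> and j = j and g = g and m = "m - j"] True \<delta> by simp
        also have "\<dots> \<le> nrm2 (mi j) g * (real (m choose j) * (\<Sum>i\<in>I. \<gamma> i) + coherent_sum i0 k j m)"
          unfolding coherent_sum_def k
          by (intro mult_left_mono add_mono \<delta>\<gamma> nrm2_nonneg
              sum_mi_shift[where h = "\<lambda>n. max 0 (real (n choose j) - real (m choose j))"]) auto
        finally show ?thesis .
      next
        case False
        \<comment> \<open>Now the threshold \<open>m choose j\<close> is 0 and no index
          \<open>m - j\<close> exists. The threshold \<open>j choose j = 1\<close>, the smallest
          coherent eigenvalue of \<open>V^* V\<close>, is used instead; since
          \<open>\<delta> \<le> 1\<close>, the resulting bound is at most the full trace, which is
          what threshold 0 asks for.\<close>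
        have pos: "1 \<le> (n + j) choose j" for n
          by (simp add: Suc_le_eq)
        have "(\<Sum>l\<in>mi k'. \<delta> l) \<le> real (card (mi k' :: ('n \<Rightarrow> nat) set))"
          using sum_mono[of "mi k'" \<delta> "\<lambda>_. 1"] \<delta> by simp
        moreover have "(\<Sum>n\<in>(mi k' :: ('n \<Rightarrow> nat) set). max 0 (real ((n i0 + j) choose j) - 1))
             = (\<Sum>n\<in>(mi k' :: ('n \<Rightarrow> nat) set). real ((n i0 + j) choose j)) - real (card (mi k' :: ('n \<Rightarrow> nat) set))"
          using pos by (simp add: max_def sum_subtractf)
        moreover have "(\<Sum>n\<in>(mi k' :: ('n \<Rightarrow> nat) set). real ((n i0 + j) choose j)) \<le> coherent_sum i0 k j m"
          unfolding coherent_sum_def k using False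
            sum_mi_shift[where h = "\<lambda>n. max 0 (real (n choose j))" and k = k' and j = j and ?i0.0 = i0]
          by (simp add: not_le binomial_eq_0)
        ultimately have "(\<Sum>l\<in>mi k'. \<delta> l) + (\<Sum>n\<in>(mi k' :: ('n \<Rightarrow> nat) set). max 0 (real ((n i0 + j) choose j) - 1))
            \<le> coherent_sum i0 k j m" by linarith
        hence "nrm2 (mi j) g * ((\<Sum>l\<in>mi k'. \<delta> l) + (\<Sum>n\<in>(mi k' :: ('n \<Rightarrow> nat) set). max 0 (real ((n i0 + j) choose j) - 1)))
            \<le> nrm2 (mi j) g * coherent_sum i0 k j m" by (intro mult_left_mono) auto
        thus ?thesis using majorized_mapp[OF P e, where \<gamma> = \<delta> and j = j and g = g and m = 0] False \<delta> by (simp add: binomial_eq_0)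
      qed
      finally show ?thesis .
    qed
  qed
qed

section \<open>Coherent states\<close>

text \<open>\<open>xv K v\<close> are the coordinates of the tensor power \<open>\<otimes>\<^sup>K v\<close> in \<open>mi K\<close>; a word \<open>w\<close> contributes to the multi-index \<open>wtype w\<close>.\<close>

definition wtype :: "'n::finite list \<Rightarrow> 'n \<Rightarrow> nat" where
  "wtype w = count (mset w)"

definition vpow :: "complex^'n::finite \<Rightarrow> ('n \<Rightarrow> nat) \<Rightarrow> complex" where
  "vpow v n = (\<Prod>i\<in>UNIV. (v $ i) ^ n i)"

definition xv :: "nat \<Rightarrow> complex^'n::finite \<Rightarrow> ('n \<Rightarrow> nat) \<Rightarrow> complex" where
  "xv K v n = of_real (sqrt (fact K / mfact n)) * vpow v n"

definition hip :: "complex^'n::finite \<Rightarrow> complex^'n \<Rightarrow> complex" where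
  "hip v w = (\<Sum>i\<in>UNIV. cnj (v $ i) * w $ i)"

section \<open>Words and occupation numbers\<close>

lemma finite_words [simp, intro]: "finite (words K :: 'n::finite list set)"
  using finite_lists_length_eq[of "UNIV :: 'n set" K] by (simp add: words_def)

lemma sum_words_Suc:
  "(\<Sum>w\<in>words (Suc K). F w) = (\<Sum>i\<in>(UNIV :: 'n::finite set). \<Sum>w\<in>words K. F (i # w))"
proof -
  have "(\<Sum>w\<in>words (Suc K). F w) = (\<Sum>(i, w)\<in>UNIV \<times> words K. F (i # w))"
    by (rule sum.reindex_bij_witness[of _ "\<lambda>(i, w). i # w" "\<lambda>w. (hd w, tl w)"])
       (auto simp: words_def length_Suc_conv)
  thus ?thesis by (simp add: sum.cartesian_product)
qed

lemma words_0: "words 0 = {[]}" by (auto simp: words_def)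

lemma sum_words_prod:
  fixes p :: "'n::finite \<Rightarrow> 'a::comm_semiring_1"
  shows "(\<Sum>w\<in>words K. prod_list (map p w)) = (\<Sum>i\<in>UNIV. p i) ^ K"
  by (induction K) (simp_all add: words_0 sum_words_Suc sum_distrib_left[symmetric] sum_distrib_right[symmetric])

lemma wtype_Cons: "wtype (i # w) = (wtype w)(i := Suc (wtype w i))"
  by (auto simp: wtype_def)

lemma prod_list_wtype:
  fixes p :: "'n::finite \<Rightarrow> 'a::comm_semiring_1"
  shows "prod_list (map p w) = (\<Prod>i\<in>UNIV. p i ^ wtype w i)"
proof (induction w)
  case Nil show ?case by (simp add: wtype_def)
next
  case (Cons j w)
  have "(\<Prod>i\<in>UNIV. p i ^ wtype (j # w) i) = (\<Prod>i\<in>UNIV. (if i = j then p i else 1) * p i ^ wtype w i)"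
    by (intro prod.cong) (auto simp: wtype_Cons)
  also have "\<dots> = p j * (\<Prod>i\<in>UNIV. p i ^ wtype w i)" by (simp add: prod.distrib)
  finally show ?case using Cons by simp
qed

lemma wtype_mi: "w \<in> words K \<Longrightarrow> wtype w \<in> mi K"
proof -
  assume "w \<in> words K"
  have "sum (count (mset w)) UNIV = size (mset w)"
    unfolding size_multiset_overloaded_eq
    by (rule sum.mono_neutral_right) (auto simp: not_in_iff)
  thus ?thesis using \<open>w \<in> words K\<close> by (simp add: wtype_def mi_def words_def)
qed

text \<open>The multinomial coefficient, as the number of arrangements of a multiset.\<close>

lemma card_wtype:
  fixes n :: "'n::finite \<Rightarrow> nat"
  assumes "n \<in> mi K"
  shows "real (card {w\<in>words K. wtype w = n}) = fact K / mfact n"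
proof -
  define A where "A = Abs_multiset n"
  have cA: "count A = n" unfolding A_def by (rule count_Abs_multiset) simp
  have szA: "size A = K"
  proof -
    have "size A = sum (count A) UNIV"
      unfolding size_multiset_overloaded_eq
      by (rule sum.mono_neutral_left) (auto simp: not_in_iff)
    thus ?thesis using assms by (simp add: cA mi_def)
  qed
  have "{w\<in>words K. wtype w = n} = permutations_of_multiset A"
  proof (intro equalityI subsetI)
    fix w assume "w \<in> {w\<in>words K. wtype w = n}"
    hence "count (mset w) = count A" by (simp add: wtype_def cA)
    thus "w \<in> permutations_of_multiset A" by (simp add: count_inject permutations_of_multiset_def)
  next
    fix w assume "w \<in> permutations_of_multiset A"
    hence "mset w = A" by (simp add: permutations_of_multiset_def)
    moreover from this have "length w = K" using szA by (metis size_mset)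
    ultimately show "w \<in> {w\<in>words K. wtype w = n}" using cA by (simp add: wtype_def words_def)
  qed
  moreover have "real (card (permutations_of_multiset A) * (\<Prod>x\<in>set_mset A. fact (count A x))) = real (fact K)"
    unfolding card_permutations_of_multiset_aux szA ..
  moreover have "(\<Prod>x\<in>set_mset A. fact (count A x)) = (\<Prod>x\<in>UNIV. fact (n x) :: real)"
    unfolding cA[symmetric] by (rule prod.mono_neutral_left) (auto simp: not_in_iff)
  ultimately show ?thesis by (simp add: mfact_def field_simps)
qed

lemma sum_words_wtype:
  fixes F :: "('n::finite \<Rightarrow> nat) \<Rightarrow> 'a::real_algebra_1"
  shows "(\<Sum>w\<in>words K. F (wtype w)) = (\<Sum>n\<in>mi K. of_real (fact K / mfact n) * F n)"
proof -
  have "(\<Sum>w\<in>words K. F (wtype w)) = (\<Sum>n\<in>mi K. \<Sum>w\<in>{w\<in>words K. wtype w = n}. F (wtype w))"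
    by (rule sum.group[symmetric]) (auto simp: wtype_mi)
  also have "\<dots> = (\<Sum>n\<in>mi K. of_real (fact K / mfact n) * F n)"
  proof (rule sum.cong[OF refl])
    fix n :: "'n \<Rightarrow> nat" assume "n \<in> mi K"
    have "(\<Sum>w\<in>{w\<in>words K. wtype w = n}. F (wtype w)) = of_real (real (card {w\<in>words K. wtype w = n})) * F n"
      by simp
    thus "(\<Sum>w\<in>{w\<in>words K. wtype w = n}. F (wtype w)) = of_real (fact K / mfact n) * F n"
      by (simp only: card_wtype[OF \<open>n \<in> mi K\<close>])
  qed
  finally show ?thesis .
qed

lemma tensor_pow_wtype: "tensor_pow M v w = vpow v (wtype w)"
  unfolding tensor_pow_def vpow_def by (rule prod_list_wtype)

text \<open>Expanding the power over words and grouping them by type gives multinomial weights,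
  which the square root in \<open>xv\<close> splits evenly between the two vectors.\<close>

lemma cip_xv: "cip (mi K) (xv K v) (xv K w) = hip v w ^ K"
proof -
  have "hip v w ^ K = (\<Sum>x\<in>words K. prod_list (map (\<lambda>i. cnj (v $ i) * w $ i) x))"
    unfolding hip_def by (rule sum_words_prod[symmetric])
  also have "\<dots> = (\<Sum>x\<in>words K. cnj (vpow v (wtype x)) * vpow w (wtype x))"
    by (simp add: prod_list_wtype vpow_def power_mult_distrib prod.distrib)
  also have "\<dots> = (\<Sum>n\<in>mi K. of_real (fact K / mfact n) * (cnj (vpow v n) * vpow w n))"
    by (rule sum_words_wtype)
  also have "\<dots> = cip (mi K) (xv K v) (xv K w)"
    unfolding cip_def
  proof (rule sum.cong[OF refl])
    fix n :: "'a \<Rightarrow> nat"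
    have "fact K / mfact n = sqrt (fact K / mfact n) * sqrt (fact K / mfact n)"
      by (simp add: less_imp_le)
    thus "of_real (fact K / mfact n) * (cnj (vpow v n) * vpow w n) = cnj (xv K v n) * xv K w n"
      unfolding xv_def by (simp add: mult_ac flip: of_real_mult)
  qed
  finally show ?thesis ..
qed

lemma hip_self: "hip v v = of_real ((norm v)\<^sup>2)"
proof -
  have "(norm v)\<^sup>2 = (\<Sum>i\<in>UNIV. (cmod (v $ i))\<^sup>2)"
    by (simp add: norm_vec_def L2_set_def sum_nonneg)
  thus ?thesis unfolding hip_def by (simp add: complex_norm_square mult.commute del: of_real_power)
qed

lemma nrm2_xv: "nrm2 (mi K) (xv K v) = (norm v) ^ (2 * K)"
proof -
  have "of_real (nrm2 (mi K) (xv K v)) = (of_real ((norm v) ^ (2 * K)) :: complex)"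
    unfolding cip_self[symmetric] cip_xv hip_self by (simp add: power_mult)
  thus ?thesis by (simp only: of_real_eq_iff)
qed

lemma tinner_tensor_pow: "tinner M (tensor_pow M v) (tensor_pow M w) = hip v w ^ M"
  unfolding tinner_def tensor_pow_def hip_def sum_words_prod[symmetric]
  by (intro sum.cong refl) (simp add: prod_list_wtype power_mult_distrib prod.distrib)

lemma vpow_add: "vpow v (m + a) = vpow v m * vpow v a"
  by (simp add: vpow_def power_add prod.distrib)

text \<open>A homogeneous differential operator maps a power of a linear form to a multiple of a
  lower power of the same form; the multiple is the pairing of \<open>g\<close> with the
  \<open>j\<close>-th power.\<close>

lemma madj_xv:
  fixes v :: "complex^'n::finite"
  assumes "m \<in> mi k"
  shows "madj (mi (k + j)) (vmat g) (xv (k + j) v) m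
    = of_real (sqrt (real ((k + j) choose j))) * cip (mi j) g (xv j v) * xv k v m"
proof -
  have "of_real (bb m a) * cnj (g a) * xv (k + j) v (m + a)
      = of_real (sqrt (real ((k + j) choose j))) * (cnj (g a) * xv j v a) * xv k v m" for a :: "'n \<Rightarrow> nat"
  proof -
    have "bb m a * sqrt (fact (k + j) / mfact (m + a)) = sqrt (fact (k + j) / (mfact m * mfact a))"
      unfolding bb_def by (simp flip: real_sqrt_mult)
    also have "\<dots> = sqrt (real ((k + j) choose j)) * sqrt (fact j / mfact a) * sqrt (fact k / mfact m)"
      by (simp add: binomial_fact flip: real_sqrt_mult)
    finally have "complex_of_real (bb m a * sqrt (fact (k + j) / mfact (m + a)))
        = of_real (sqrt (real ((k + j) choose j)) * sqrt (fact j / mfact a) * sqrt (fact k / mfact m))"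
      by (rule arg_cong)
    hence "complex_of_real (bb m a) * of_real (sqrt (fact (k + j) / mfact (m + a)))
        = of_real (sqrt (real ((k + j) choose j))) * of_real (sqrt (fact j / mfact a)) * of_real (sqrt (fact k / mfact m))"
      unfolding of_real_mult .
    hence "complex_of_real (bb m a) * of_real (sqrt (fact (k + j) / mfact (m + a))) * (cnj (g a) * vpow v m * vpow v a)
        = of_real (sqrt (real ((k + j) choose j))) * of_real (sqrt (fact j / mfact a)) * of_real (sqrt (fact k / mfact m))
          * (cnj (g a) * vpow v m * vpow v a)" by (rule arg_cong)
    thus ?thesis unfolding xv_def vpow_add by (simp only: mult_ac)
  qed
  thus ?thesis
    unfolding madj_vmat[OF assms] cip_def sum_distrib_left sum_distrib_right by (intro sum.cong refl)
qed

text \<open>The reason for enlarging the space: the expectation of \<open>V V^*\<close> in a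
  coherent state of degree \<open>k + j\<close> is, for every \<open>k\<close> and without error
  term, proportional to the Husimi function of \<open>g\<close>.\<close>

lemma nrm2_madj_xv:
  "nrm2 (mi k) (madj (mi (k + j)) (vmat g) (xv (k + j) v))
     = real ((k + j) choose j) * (cmod (cip (mi j) g (xv j v)))\<^sup>2 * (norm v) ^ (2 * k)"
proof -
  have "nrm2 (mi k) (madj (mi (k + j)) (vmat g) (xv (k + j) v))
      = (\<Sum>m\<in>mi k. real ((k + j) choose j) * (cmod (cip (mi j) g (xv j v)))\<^sup>2 * (cmod (xv k v m))\<^sup>2)"
    unfolding nrm2_def by (intro sum.cong refl) (simp add: madj_xv norm_mult power_mult_distrib)
  thus ?thesis by (simp add: nrm2_def nrm2_xv[symmetric] sum_distrib_left)
qed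

section \<open>Bernstein polynomials as averages over words\<close>

lemma Bernstein_Suc:
  "(\<Sum>k\<le>Suc K. F k * Bernstein (Suc K) k x)
     = x * (\<Sum>k\<le>K. F (Suc k) * Bernstein K k x) + (1 - x) * (\<Sum>k\<le>K. F k * Bernstein K k x)"
proof -
  have "(\<Sum>k\<le>Suc K. F k * Bernstein (Suc K) k x)
     = F 0 * Bernstein (Suc K) 0 x + (\<Sum>k\<le>K. F (Suc k) * Bernstein (Suc K) (Suc k) x)"
    by (rule sum.atMost_Suc_shift)
  also have "(\<Sum>k\<le>K. F (Suc k) * Bernstein (Suc K) (Suc k) x)
     = (\<Sum>k\<le>K. x * (F (Suc k) * Bernstein K k x)) + (\<Sum>k\<le>K. F (Suc k) * real (K choose Suc k) * x ^ Suc k * (1 - x) ^ (K - k))"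
    by (simp add: Bernstein_def algebra_simps flip: sum.distrib)
  also have "(\<Sum>k\<le>K. F (Suc k) * real (K choose Suc k) * x ^ Suc k * (1 - x) ^ (K - k))
      = (\<Sum>k\<le>Suc K. F k * real (K choose k) * x ^ k * (1 - x) ^ (Suc K - k)) - F 0 * Bernstein (Suc K) 0 x"
    by (subst sum.atMost_Suc_shift) (simp add: Bernstein_def)
  also have "(\<Sum>k\<le>Suc K. F k * real (K choose k) * x ^ k * (1 - x) ^ (Suc K - k))
      = (\<Sum>k\<le>K. (1 - x) * (F k * Bernstein K k x))"
    by (simp add: Bernstein_def Suc_diff_le algebra_simps binomial_eq_0)
  finally show ?thesis by (simp add: sum_distrib_left)
qed

text \<open>Under independent letters with law \<open>p\<close> the count of \<open>i0\<close> is
  binomial. The induction conditions on the first letter, which reproduces the recursion of the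
  Bernstein sums.\<close>

lemma sum_words_Bernstein:
  fixes p :: "'n::finite \<Rightarrow> real"
  assumes "(\<Sum>i\<in>UNIV. p i) = 1"
  shows "(\<Sum>w\<in>words K. F (wtype w i0) * prod_list (map p w)) = (\<Sum>k\<le>K. F k * Bernstein K k (p i0))"
proof (induction K arbitrary: F)
  case 0 show ?case by (simp add: words_0 wtype_def Bernstein_def)
next
  case (Suc K)
  have s: "sum p (UNIV - {i0}) = 1 - p i0" using assms sum.remove[of UNIV i0 p] by simp
  have "(\<Sum>w\<in>words (Suc K). F (wtype w i0) * prod_list (map p w))
     = (\<Sum>i\<in>UNIV. p i * (\<Sum>w\<in>words K. (if i = i0 then F (Suc (wtype w i0)) else F (wtype w i0)) * prod_list (map p w)))"
    unfolding sum_words_Suc sum_distrib_left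
    by (intro sum.cong refl) (auto simp: wtype_Cons)
  also have "\<dots> = p i0 * (\<Sum>w\<in>words K. F (Suc (wtype w i0)) * prod_list (map p w))
      + (\<Sum>i\<in>UNIV - {i0}. p i * (\<Sum>w\<in>words K. F (wtype w i0) * prod_list (map p w)))"
    by (subst sum.remove[of _ i0]) (auto intro!: sum.cong)
  also have "\<dots> = p i0 * (\<Sum>w\<in>words K. (F \<circ> Suc) (wtype w i0) * prod_list (map p w))
      + (1 - p i0) * (\<Sum>w\<in>words K. F (wtype w i0) * prod_list (map p w))"
    unfolding sum_distrib_right[symmetric] s by simp
  also have "\<dots> = (\<Sum>k\<le>Suc K. F k * Bernstein (Suc K) k (p i0))"
    unfolding Suc.IH Bernstein_Suc by simp
  finally show ?case .
qed

text \<open>The squared moduli of the coordinates of a coherent vector are the multinomial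
  distribution with probabilities \<open>(cmod (v $ i))^2\<close>; only its marginal at
  \<open>i0\<close> enters.\<close>

lemma sum_xv_Bernstein:
  fixes v :: "complex^'n::finite"
  assumes "norm v = 1"
  shows "(\<Sum>n\<in>mi K. F (n i0) * (cmod (xv K v n))\<^sup>2) = (\<Sum>k\<le>K. F k * Bernstein K k ((cmod (v $ i0))\<^sup>2))"
proof -
  define p where "p i = (cmod (v $ i))\<^sup>2" for i
  have "(norm v)\<^sup>2 = (\<Sum>i\<in>UNIV. p i)"
    by (simp add: norm_vec_def L2_set_def sum_nonneg p_def)
  hence p: "(\<Sum>i\<in>UNIV. p i) = 1" using assms by simp
  have "(\<Sum>w\<in>words K. F (wtype w i0) * prod_list (map p w))
      = (\<Sum>w\<in>words K. F (wtype w i0) * (\<Prod>i\<in>UNIV. p i ^ wtype w i))"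
    by (simp add: prod_list_wtype)
  also have "\<dots> = (\<Sum>n\<in>mi K. of_real (fact K / mfact n) * (F (n i0) * (\<Prod>i\<in>UNIV. p i ^ n i)))"
    by (rule sum_words_wtype[where F = "\<lambda>n. F (n i0) * (\<Prod>i\<in>UNIV. p i ^ n i)"])
  also have "\<dots> = (\<Sum>n\<in>mi K. F (n i0) * (cmod (xv K v n))\<^sup>2)"
  proof (rule sum.cong[OF refl])
    fix n :: "'n \<Rightarrow> nat"
    have "(cmod (vpow v n))\<^sup>2 = (\<Prod>i\<in>UNIV. p i ^ n i)"
      unfolding vpow_def p_def
      by (simp add: prod_norm[symmetric] norm_power prod_power_distrib mult.commute flip: power_mult)
    moreover have "(sqrt (fact K / mfact n))\<^sup>2 = fact K / mfact n" by (simp add: less_imp_le)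
    ultimately show "of_real (fact K / mfact n) * (F (n i0) * (\<Prod>i\<in>UNIV. p i ^ n i)) = F (n i0) * (cmod (xv K v n))\<^sup>2"
      unfolding xv_def norm_mult power_mult_distrib by (simp only: norm_of_real power2_abs) simp
  qed
  finally show ?thesis using sum_words_Bernstein[OF p, of F i0 K] by (simp add: p_def)
qed

section \<open>Symmetric density matrices\<close>

lemma permute_list_eq_iff:
  assumes "length a = M" "length b = M" "\<sigma> permutes {..<M}"
  shows "(\<forall>i<M. a ! i = b ! (\<sigma> i)) \<longleftrightarrow> permute_list \<sigma> b = a"
  using assms by (auto simp: list_eq_iff_nth_eq permute_list_nth)

text \<open>All rearrangements of \<open>b\<close> are produced by equally many permutations, since
  composition with a permutation carrying \<open>a\<close> to \<open>a'\<close> is injective. There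
  are M! permutations and, for the type n of \<open>b\<close>, M!/n! rearrangements, which leaves n!
  for each.\<close>

lemma sym_proj_eq:
  fixes a b :: "'n::finite list"
  assumes a: "a \<in> words M" and b: "b \<in> words M"
  shows "sym_proj M a b = (if wtype a = wtype b then of_real (mfact (wtype b) / fact M) else 0)"
proof -
  define P where "P = {\<sigma>. \<sigma> permutes {..<M}}"
  have fP: "finite P" and cP: "card P = fact M"
    by (auto simp: P_def finite_permutations card_permutations)
  define C where "C a = {\<sigma>\<in>P. permute_list \<sigma> b = a}" for a
  have lb: "length b = M" using b by (simp add: words_def)
  have C: "{\<sigma>. \<sigma> permutes {..<M} \<and> (\<forall>i<M. a ! i = b ! (\<sigma> i))} = C a" if "a \<in> words M" for a
    using permute_list_eq_iff[of a M b] that lb by (auto simp: C_def P_def words_def)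
  show ?thesis
  proof (cases "wtype a = wtype b")
    case False
    have "C a = {}"
      using False lb mset_permute_list[of _ b] by (auto simp: C_def P_def wtype_def)
    thus ?thesis using False unfolding sym_proj_def C[OF a] by simp
  next
    case True
    define W where "W = {w\<in>words M. wtype w = wtype b}"
    have fW: "finite W" by (simp add: W_def)
    have le: "card (C a) \<le> card (C a')" if "a \<in> W" "a' \<in> W" for a a'
    proof -
      have la: "length a = M" "length a' = M" using that by (auto simp: W_def words_def)
      have "mset a' = mset a" using that by (simp add: W_def wtype_def count_inject)
      then obtain p where p: "p permutes {..<length a}" "permute_list p a = a'"
        by (rule mset_eq_permutation)
      have pM: "p permutes {..<M}" using p(1) la by simp
      show ?thesis
      proof (rule card_inj_on_le[of "\<lambda>\<sigma>. \<sigma> \<circ> p"])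
        show "inj_on (\<lambda>\<sigma>. \<sigma> \<circ> p) (C a)"
        proof (rule inj_onI)
          fix s t assume "s \<circ> p = t \<circ> p"
          hence "s (p i) = t (p i)" for i by (simp add: fun_eq_iff)
          moreover have "surj p" using permutes_surj[OF p(1)] .
          ultimately show "s = t" by (metis surjD ext)
        qed
        show "(\<lambda>\<sigma>. \<sigma> \<circ> p) ` C a \<subseteq> C a'"
          using p(2) pM lb permute_list_compose[of p b] permutes_compose[OF pM] by (auto simp: C_def P_def)
        show "finite (C a')" using fP by (simp add: C_def)
      qed
    qed
    have aW: "a \<in> W" using a True by (simp add: W_def)
    have eq: "card (C a') = card (C a)" if "a' \<in> W" for a'
      using le[OF that aW] le[OF aW that] by simp
    have "card P = (\<Sum>a'\<in>W. card (C a'))"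
    proof -
      have "(\<Sum>a'\<in>W. sum (\<lambda>_. 1) {\<sigma>\<in>P. permute_list \<sigma> b = a'}) = sum (\<lambda>_. 1 :: nat) P"
        using lb b by (intro sum.group fP fW) (auto simp: P_def W_def words_def wtype_def)
      thus ?thesis by (simp add: C_def)
    qed
    also have "\<dots> = card W * card (C a)" using eq by simp
    finally have "real (fact M) = real (card W) * real (card (C a))"
      unfolding cP of_nat_mult[symmetric] of_nat_eq_iff .
    moreover have "real (card W) = fact M / mfact (wtype b)"
      unfolding W_def by (rule card_wtype[OF wtype_mi[OF b]])
    ultimately have "real (card (C a)) = mfact (wtype b)" by (simp add: field_simps)
    hence "complex_of_real (real (card (C a))) = of_real (mfact (wtype b))" by (rule arg_cong)
    thus ?thesis using True unfolding sym_proj_def C[OF a] by simp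
  qed
qed

lemma sum_words_group:
  fixes F :: "'n::finite list \<Rightarrow> 'b::comm_monoid_add"
  shows "(\<Sum>w\<in>words M. F w) = (\<Sum>n\<in>mi M. \<Sum>w\<in>{w\<in>words M. wtype w = n}. F w)"
  by (rule sum.group[symmetric]) (auto simp: wtype_mi)

text \<open>The state is compressed to the occupation number basis and diagonalized there.
  Positivity passes to the compression directly; that no trace is lost uses the support of
  \<open>\<rho>\<close> on the symmetric subspace.\<close>

lemma density_decomposition:
  fixes \<rho> :: "'n::finite list \<Rightarrow> 'n list \<Rightarrow> complex"
  assumes "density_sym M \<rho>"
  obtains e :: "('n \<Rightarrow> nat) \<Rightarrow> ('n \<Rightarrow> nat) \<Rightarrow> complex" and p where "orthonormal_on (mi M) (mi M) e"
    "\<And>l. l \<in> mi M \<Longrightarrow> (0 :: real) \<le> p l" "(\<Sum>l\<in>mi M. p l) = 1"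
    "\<And>v. Re (qform M \<rho> (tensor_pow M v)) = (\<Sum>l\<in>mi M. p l * (cmod (cip (mi M) (e l) (xv M v)))\<^sup>2)"
proof -
  have pos: "Im (qform M \<rho> x) = 0" "0 \<le> Re (qform M \<rho> x)" and tr: "(\<Sum>a\<in>words M. \<rho> a a) = 1"
    and sup: "\<And>a b. a \<in> words M \<Longrightarrow> b \<in> words M \<Longrightarrow> (\<Sum>c\<in>words M. \<rho> a c * sym_proj M c b) = \<rho> a b" for x
    using assms by (auto simp: density_sym_def)
  define W where "W n = {w\<in>words M. wtype w = n}" for n :: "'n \<Rightarrow> nat"
  \<comment> \<open>There are M!/n! words of type n, so the vector with the constant value
    \<open>s n\<close> on them is a unit vector.\<close>
  define s where "s n = sqrt (mfact n / fact M)" for n :: "'n \<Rightarrow> nat"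
  have ss: "s n * s n = mfact n / fact M" for n :: "'n \<Rightarrow> nat" by (simp add: s_def less_imp_le)
  define r where "r n n' = (\<Sum>a\<in>W n. \<Sum>b\<in>W n'. of_real (s n) * \<rho> a b * of_real (s n'))" for n n'
  have form: "sesq (mi M) r c c = qform M \<rho> (\<lambda>w. c (wtype w) * of_real (s (wtype w)))" for c
  proof -
    define t where "t = (\<lambda>w :: 'n list. c (wtype w) * of_real (s (wtype w)))"
    have "qform M \<rho> t = (\<Sum>n\<in>mi M. \<Sum>a\<in>W n. \<Sum>n'\<in>mi M. \<Sum>b\<in>W n'. cnj (t a) * \<rho> a b * t b)"
      unfolding qform_def W_def sum_words_group[symmetric] ..
    also have "\<dots> = (\<Sum>n\<in>mi M. \<Sum>n'\<in>mi M. \<Sum>a\<in>W n. \<Sum>b\<in>W n'. cnj (t a) * \<rho> a b * t b)"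
      by (intro sum.cong[OF refl] sum.swap)
    also have "\<dots> = (\<Sum>n\<in>mi M. \<Sum>n'\<in>mi M. \<Sum>a\<in>W n. \<Sum>b\<in>W n'. cnj (c n) * (of_real (s n) * \<rho> a b * of_real (s n')) * c n')"
      by (intro sum.cong[OF refl]) (simp add: W_def t_def)
    also have "\<dots> = sesq (mi M) r c c"
      unfolding sesq_def r_def sum_distrib_left sum_distrib_right ..
    finally show ?thesis by (simp add: t_def)
  qed
  have herm: "Im (sesq (mi M) r c c) = 0" for c unfolding form by (rule pos)
  obtain e :: "('n \<Rightarrow> nat) \<Rightarrow> ('n \<Rightarrow> nat) \<Rightarrow> complex" where e: "orthonormal_on (mi M) (mi M) e"
    and dec: "\<And>x. Re (sesq (mi M) r x x) = (\<Sum>l\<in>mi M. Re (sesq (mi M) r (e l) (e l)) * (cmod (cip (mi M) (e l) x))\<^sup>2)"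
    by (rule spectral_decomposition[OF finite_mi herm]) (rule that, assumption+)
  define p where "p l = Re (sesq (mi M) r (e l) (e l))" for l
  have p0: "0 \<le> p l" for l unfolding p_def form by (rule pos)
  have coh: "Re (qform M \<rho> (tensor_pow M v)) = (\<Sum>l\<in>mi M. p l * (cmod (cip (mi M) (e l) (xv M v)))\<^sup>2)" for v
  proof -
    have "xv M v n * of_real (s n) = vpow v n" for n
    proof -
      have "sqrt (fact M / mfact n) * s n = 1" by (simp add: s_def flip: real_sqrt_mult)
      hence "complex_of_real (sqrt (fact M / mfact n)) * of_real (s n) = 1"
        by (simp only: of_real_mult[symmetric] of_real_1)
      hence "complex_of_real (sqrt (fact M / mfact n)) * of_real (s n) * vpow v n = vpow v n"
        by simp
      thus ?thesis unfolding xv_def by (simp only: mult_ac)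
    qed
    hence "tensor_pow M v = (\<lambda>w. xv M v (wtype w) * of_real (s (wtype w)))"
      by (simp add: tensor_pow_wtype fun_eq_iff)
    thus ?thesis using dec[of "xv M v"] unfolding form p_def by simp
  qed
  have sum1: "(\<Sum>l\<in>mi M. p l) = 1"
  proof -
    \<comment> \<open>Inserting the symmetrizer on the right confines the sums to words of equal
      type and gives the trace of \<open>r\<close>.\<close>
    have "(\<Sum>a\<in>words M. \<rho> a a) = (\<Sum>a\<in>words M. \<Sum>c\<in>words M. \<rho> a c * sym_proj M c a)"
      using sup by (intro sum.cong[OF refl]) simp
    also have "\<dots> = (\<Sum>n\<in>mi M. \<Sum>a\<in>W n. \<Sum>c\<in>words M. \<rho> a c * sym_proj M c a)"
      unfolding W_def by (rule sum_words_group)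
    also have "\<dots> = (\<Sum>n\<in>mi M. \<Sum>a\<in>W n. \<Sum>c\<in>W n. of_real (s n) * \<rho> a c * of_real (s n))"
    proof (intro sum.cong[OF refl])
      fix n :: "'n \<Rightarrow> nat" and a assume a: "a \<in> W n"
      have "(\<Sum>c\<in>words M. \<rho> a c * sym_proj M c a)
          = (\<Sum>c\<in>words M. if wtype c = n then of_real (s n) * \<rho> a c * of_real (s n) else 0)"
      proof (rule sum.cong[OF refl])
        fix c :: "'n list" assume c: "c \<in> words M"
        have "of_real (s n) * \<rho> a c * of_real (s n) = \<rho> a c * of_real (s n * s n)" by simp
        hence "of_real (s n) * \<rho> a c * of_real (s n) = \<rho> a c * of_real (mfact n / fact M)"
          unfolding ss .
        thus "\<rho> a c * sym_proj M c a = (if wtype c = n then of_real (s n) * \<rho> a c * of_real (s n) else 0)"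
          using sym_proj_eq[OF c, of a] a by (simp add: W_def)
      qed
      also have "\<dots> = (\<Sum>c\<in>W n. of_real (s n) * \<rho> a c * of_real (s n))"
        unfolding W_def by (rule sum.inter_filter[symmetric]) simp
      finally show "(\<Sum>c\<in>words M. \<rho> a c * sym_proj M c a) = (\<Sum>c\<in>W n. of_real (s n) * \<rho> a c * of_real (s n))" .
    qed
    also have "\<dots> = (\<Sum>n\<in>mi M. r n n)" by (simp add: r_def)
    finally have "(\<Sum>n\<in>mi M. r n n) = 1" using tr by simp
    hence "1 = (\<Sum>n\<in>mi M. Re (r n n))" by (simp flip: Re_sum)
    also have "\<dots> = (\<Sum>n\<in>mi M. \<Sum>l\<in>mi M. p l * (cmod (e l n))\<^sup>2)"
    proof (rule sum.cong[OF refl])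
      fix n :: "'n \<Rightarrow> nat" assume n: "n \<in> mi M"
      define d where "d = (\<lambda>m. if m = n then 1 else 0 :: complex)"
      have "sesq (mi M) r d d = (\<Sum>m\<in>mi M. \<Sum>m'\<in>mi M. if m = n \<and> m' = n then r n n else 0)"
        unfolding sesq_def d_def by (intro sum.cong[OF refl]) auto
      also have "\<dots> = (\<Sum>m\<in>mi M. if m = n then r n n else 0)"
        using n by (intro sum.cong[OF refl]) auto
      also have "\<dots> = r n n" using n by simp
      finally have "Re (r n n) = Re (sesq (mi M) r d d)" by simp
      also have "\<dots> = (\<Sum>l\<in>mi M. p l * (cmod (e l n))\<^sup>2)"
        unfolding dec[of d] using cip_delta[OF finite_mi n] by (simp add: p_def d_def)
      finally show "Re (r n n) = (\<Sum>l\<in>mi M. p l * (cmod (e l n))\<^sup>2)" .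
    qed
    also have "\<dots> = (\<Sum>l\<in>mi M. p l * nrm2 (mi M) (e l))"
      unfolding nrm2_def sum_distrib_left by (rule sum.swap)
    also have "\<dots> = (\<Sum>l\<in>mi M. p l)" using orthonormal_nrm2[OF e] by simp
    finally show ?thesis by simp
  qed
  show ?thesis by (rule that[OF e p0 sum1 coh])
qed

section \<open>Unitary matrices\<close>

definition unitary :: "complex^'n^'n::finite \<Rightarrow> bool" where
  "unitary S \<longleftrightarrow> S ** cadj S = mat 1"

lemma cadj_mult: "cadj (A ** B) = cadj B ** cadj A"
  by (simp add: cadj_def matrix_matrix_mult_def vec_eq_iff mult.commute)

lemma unitary_mult: "unitary A \<Longrightarrow> unitary B \<Longrightarrow> unitary (A ** B)"
  unfolding unitary_def cadj_mult by (metis matrix_mul_assoc matrix_mul_rid)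

lemma SU_iff: "R \<in> SU \<longleftrightarrow> unitary R \<and> det R = 1"
  by (simp add: SU_def unitary_def)

lemma SU_mult: "A \<in> SU \<Longrightarrow> B \<in> SU \<Longrightarrow> A ** B \<in> SU"
  by (simp add: SU_iff unitary_mult det_mul)

lemma hip_mult_right: "hip v (A *v w) = hip (cadj A *v v) w"
proof -
  have "hip v (A *v w) = (\<Sum>i\<in>UNIV. \<Sum>j\<in>UNIV. cnj (v $ i) * (A $ i $ j * w $ j))"
    by (simp add: hip_def matrix_vector_mult_def sum_distrib_left)
  also have "\<dots> = (\<Sum>j\<in>UNIV. \<Sum>i\<in>UNIV. cnj (v $ i) * (A $ i $ j * w $ j))" by (rule sum.swap)
  also have "\<dots> = hip (cadj A *v v) w"
    by (simp add: hip_def matrix_vector_mult_def cadj_def sum_distrib_left sum_distrib_right mult_ac)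
  finally show ?thesis .
qed

lemma hip_unitary:
  assumes "unitary S" shows "hip (S *v v) (S *v w) = hip v w"
proof -
  have "cadj S ** S = mat 1"
    using assms matrix_left_right_inverse[of S "cadj S"] by (simp add: unitary_def)
  thus ?thesis by (simp add: hip_mult_right matrix_vector_mul_assoc)
qed

lemma norm_unitary:
  assumes "unitary S" shows "norm (S *v v) = norm v"
proof -
  have "complex_of_real ((norm (S *v v))\<^sup>2) = of_real ((norm v)\<^sup>2)"
    using hip_unitary[OF assms, of v v] unfolding hip_self .
  thus ?thesis by (simp only: of_real_eq_iff) simp
qed

lemma hip_commute: "hip w v = cnj (hip v w)"
  by (simp add: hip_def mult.commute)

lemma hip_diff: "hip (a - b) c = hip a c - hip b c" "hip c (a - b) = hip c a - hip c b"
  by (simp_all add: hip_def algebra_simps sum_subtractf)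

text \<open>With \<open>x = v - w\<close>, the matrix \<open>1 - x x\<^sup>* / (x\<^sup>* v)\<close> is unitary and maps \<open>v\<close> to \<open>w\<close>; for \<open>v = w\<close> the
  convention \<open>0 / 0 = 0\<close> gives the identity.\<close>

lemma unitary_transitive:
  assumes v: "norm v = 1" and w: "norm w = 1"
  obtains S where "unitary S" "S *v v = w"
proof -
  define x where "x = v - w"
  define c where "c = hip x v"
  define S :: "complex^'a^'a" where "S = (\<chi> i j. (if i = j then 1 else 0) - x $ i * cnj (x $ j) / c)"
  have c1: "c = 1 - hip w v"
    unfolding c_def x_def hip_diff by (simp add: hip_self v)
  have c2: "cnj c = 1 - hip v w"
    unfolding c1 by (simp add: hip_commute[of v w])
  have xx: "hip x x = c + cnj c"
    unfolding c2 unfolding c1 x_def hip_diff by (simp add: hip_self v w)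
  have x0: "x = 0" if "c = 0"
  proof -
    have "hip x x = 0" using xx that by simp
    thus ?thesis unfolding hip_self by simp
  qed
  have "S *v v = w"
  proof (cases "c = 0")
    case True
    have "S = mat 1" using True by (simp add: S_def mat_def)
    thus ?thesis using x0[OF True] by (simp add: x_def)
  next
    case False
    have "(S *v v) $ i = w $ i" for i
    proof -
      have "(S *v v) $ i = (\<Sum>j\<in>UNIV. (if i = j then v $ j else 0) - x $ i / c * (cnj (x $ j) * v $ j))"
        unfolding S_def matrix_vector_mult_def by (auto intro!: sum.cong simp: algebra_simps)
      also have "\<dots> = v $ i - x $ i / c * hip x v"
        unfolding hip_def sum_distrib_left by (simp add: sum_subtractf)
      also have "\<dots> = w $ i" using False unfolding c_def by (simp add: x_def)
      finally show ?thesis .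
    qed
    thus ?thesis by (simp add: vec_eq_iff)
  qed
  moreover have "unitary S"
  proof (cases "c = 0")
    case True
    have "S = mat 1" using True by (simp add: S_def mat_def)
    moreover have "cadj (mat 1) = (mat 1 :: complex^'a^'a)" by (auto simp: cadj_def mat_def vec_eq_iff)
    ultimately show ?thesis by (simp add: unitary_def)
  next
    case False
    have "(S ** cadj S) $ i $ k = (if i = k then 1 else 0)" for i k
    proof -
      have "(S ** cadj S) $ i $ k = (\<Sum>j\<in>UNIV. ((if i = j then 1 else 0) - x $ i * cnj (x $ j) / c) * ((if k = j then 1 else 0) - cnj (x $ k) * x $ j / cnj c))"
        unfolding S_def matrix_matrix_mult_def cadj_def by (auto intro!: sum.cong)
      also have "\<dots> = (\<Sum>j\<in>UNIV. (if i = j then if k = j then 1 else 0 else 0)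
           - (if i = j then cnj (x $ k) * x $ j / cnj c else 0) - (if k = j then x $ i * cnj (x $ j) / c else 0)
           + x $ i * cnj (x $ k) / (c * cnj c) * (cnj (x $ j) * x $ j))"
        using False by (intro sum.cong refl) (auto simp: field_simps)
      also have "\<dots> = (if k = i then 1 else 0) - cnj (x $ k) * x $ i / cnj c - x $ i * cnj (x $ k) / c
           + x $ i * cnj (x $ k) / (c * cnj c) * hip x x"
        unfolding hip_def by (simp add: sum.distrib sum_subtractf sum_distrib_left)
      also have "\<dots> = (if i = k then 1 else 0)"
        unfolding xx using False by (auto simp: field_simps)
      finally show ?thesis .
    qed
    thus ?thesis by (simp add: unitary_def vec_eq_iff mat_def)
  qed
  ultimately show ?thesis by (rule that[rotated])
qed

lemma det_cadj: "det (cadj S) = cnj (det S)"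
proof -
  have "det (cadj S) = det (\<chi> i j. cnj (S $ i $ j))"
    using det_transpose[of "cadj S"] by (simp add: transpose_def cadj_def)
  also have "\<dots> = cnj (det S)" by (simp add: det_def)
  finally show ?thesis .
qed

text \<open>A root of order N of the inverse determinant is a phase that corrects the determinant to
  1. For phase-invariant integrands this extends the SU(N) invariance of the measure to all
  unitaries.\<close>

lemma unitary_phase_SU:
  assumes "unitary (S :: complex^'n^'n::finite)"
  obtains z T where "cmod z = 1" "T \<in> SU" "\<And>v. T *v v = z *s (S *v v)"
proof -
  have "det (S ** cadj S) = 1" using assms by (simp add: unitary_def)
  hence "det S * cnj (det S) = 1" by (simp add: det_mul det_cadj)
  hence "complex_of_real ((cmod (det S))\<^sup>2) = of_real 1"
    using complex_norm_square[of "det S"] by simp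
  hence "(cmod (det S))\<^sup>2 = 1" by (simp only: of_real_eq_iff)
  hence d: "cmod (det S) = 1"
    using norm_ge_zero[of "det S"] by (auto simp: power2_eq_1_iff)
  have "CARD('n) \<noteq> 0" by simp
  then obtain z where z: "inverse (det S) = z ^ CARD('n)"
    by (rule exists_complex_root)
  have "cmod z ^ CARD('n) = 1" using arg_cong[OF z, of cmod] d by (simp add: norm_power norm_inverse)
  hence z1: "cmod z = 1" using power_eq_imp_eq_base[of "cmod z" "CARD('n)" 1] by simp
  define T :: "complex^'n^'n" where "T = (\<chi> i. z *s (S $ i))"
  have "T $ i $ j = z * S $ i $ j" for i j by (simp add: T_def)
  hence "(T ** cadj T) $ i $ j = z * cnj z * (S ** cadj S) $ i $ j" for i j
    by (simp add: matrix_matrix_mult_def cadj_def sum_distrib_left mult_ac)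
  moreover have "z * cnj z = 1" using z1 by (simp add: complex_norm_square[symmetric])
  ultimately have "unitary T" using assms by (simp add: unitary_def vec_eq_iff)
  moreover have "det T = 1"
  proof -
    have "det T = (\<Prod>i\<in>(UNIV :: 'n set). z) * det (\<chi> i. S $ i)" unfolding T_def by (rule det_rows_mul)
    hence "det T = z ^ CARD('n) * det S" by simp
    moreover have "det S \<noteq> 0" using d by auto
    ultimately show ?thesis unfolding z[symmetric] by simp
  qed
  ultimately have "T \<in> SU" by (simp add: SU_iff)
  moreover have "T *v v = z *s (S *v v)" for v
    by (simp add: T_def matrix_vector_mult_def vec_eq_iff sum_distrib_left mult_ac)
  ultimately show ?thesis by (rule that[OF z1])
qed

text \<open>Coordinates are eliminated one at a time: with the others fixed, the sum is a polynomial
  in one variable with infinitely many positive roots. The induction therefore tracks the sums of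
  \<open>c\<close> over the exponents that agree with \<open>n0\<close> on the coordinates
  treated.\<close>

lemma positive_poly_zero:
  fixes c :: "('n::finite \<Rightarrow> nat) \<Rightarrow> real"
  assumes "finite F" and "\<And>s. (\<And>i. s i > 0) \<Longrightarrow> (\<Sum>n\<in>F. c n * (\<Prod>i\<in>UNIV. s i ^ n i)) = (0 :: real)"
    and "n \<in> F"
  shows "c n = 0"
proof -
  have main: "finite F \<Longrightarrow> (\<And>s. (\<And>i. s i > 0) \<Longrightarrow> (\<Sum>n\<in>F. c n * (\<Prod>i\<in>I. s i ^ n i)) = (0 :: real))
     \<Longrightarrow> (\<Sum>n\<in>{n\<in>F. \<forall>i\<in>I. n i = n0 i}. c n) = 0" if "finite I" for I F and n0 :: "'n \<Rightarrow> nat"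
    using that
  proof (induction I arbitrary: F rule: finite_induct)
    case empty
    from empty(2)[of "\<lambda>_. 1"] show ?case by simp
  next
    case (insert j I)
    note fF = insert.prems(1)
    define N where "N = (\<Sum>n\<in>F. n j)"
    have N: "n j \<le> N" if "n \<in> F" for n unfolding N_def using fF that by (intro member_le_sum) auto
    define F' where "F' = {n\<in>F. n j = n0 j}"
    have "(\<Sum>n\<in>F'. c n * (\<Prod>i\<in>I. s i ^ n i)) = 0" if s: "\<And>i. s i > 0" for s :: "'n \<Rightarrow> real"
    proof -
      define g where "g k = (\<Sum>n\<in>{n\<in>F. n j = k}. c n * (\<Prod>i\<in>I. s i ^ n i))" for k
      have "(\<Sum>k\<le>N. g k * x ^ k) = 0" if x: "x > 0" for x
      proof -
        have "0 = (\<Sum>n\<in>F. c n * (\<Prod>i\<in>insert j I. (s(j := x)) i ^ n i))"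
          using insert.prems(2)[of "s(j := x)"] s x by simp
        also have "\<dots> = (\<Sum>n\<in>F. c n * (\<Prod>i\<in>I. s i ^ n i) * x ^ n j)"
        proof (rule sum.cong[OF refl])
          fix n
          have "(\<Prod>i\<in>I. (s(j := x)) i ^ n i) = (\<Prod>i\<in>I. s i ^ n i)"
            using insert.hyps by (intro prod.cong) auto
          thus "c n * (\<Prod>i\<in>insert j I. (s(j := x)) i ^ n i) = c n * (\<Prod>i\<in>I. s i ^ n i) * x ^ n j"
            using insert.hyps by simp
        qed
        also have "\<dots> = (\<Sum>k\<le>N. \<Sum>n\<in>{n\<in>F. n j = k}. c n * (\<Prod>i\<in>I. s i ^ n i) * x ^ n j)"
          using fF N by (intro sum.group[symmetric]) auto
        also have "\<dots> = (\<Sum>k\<le>N. g k * x ^ k)"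
          unfolding g_def sum_distrib_right by (intro sum.cong refl) auto
        finally show ?thesis by simp
      qed
      hence "{0<..} \<subseteq> {x. (\<Sum>k\<le>N. g k * x ^ k) = 0}" by auto
      hence "infinite {x. (\<Sum>k\<le>N. g k * x ^ k) = 0}" using infinite_Ioi finite_subset by blast
      hence g0: "g k = 0" if "k \<le> N" for k using polyfun_finite_roots[of g N] that by blast
      have "g (n0 j) = 0"
      proof (cases "n0 j \<le> N")
        case False
        have "n j \<noteq> n0 j" if "n \<in> F" for n using N[OF that] False by auto
        hence e: "{n\<in>F. n j = n0 j} = {}" by auto
        show ?thesis unfolding g_def e by simp
      qed (rule g0)
      thus ?thesis by (simp add: g_def F'_def)
    qed
    hence "(\<Sum>n\<in>{n\<in>F'. \<forall>i\<in>I. n i = n0 i}. c n) = 0"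
      using fF by (intro insert.IH) (auto simp: F'_def)
    moreover have "{n\<in>F'. \<forall>i\<in>I. n i = n0 i} = {n\<in>F. \<forall>i\<in>insert j I. n i = n0 i}"
      by (auto simp: F'_def)
    ultimately show ?case by simp
  qed
  have "{m\<in>F. \<forall>i\<in>UNIV. m i = n i} = {n}" using assms(3) by auto
  thus ?thesis using main[OF finite_class.finite_UNIV assms(1,2), of n] by simp
qed

section \<open>Resolution of the identity\<close>

lemma continuous_on_matrix_vector:
  "continuous_on UNIV (\<lambda>R :: complex^'n^'n::finite. R *v u)"
  unfolding matrix_vector_mult_def by (intro continuous_intros)

lemma continuous_on_matrix_mult:
  "continuous_on UNIV (\<lambda>R :: complex^'n^'n::finite. S ** R)"
  unfolding matrix_matrix_mult_def by (intro continuous_intros)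

lemma xv_measurable [measurable]: "(\<lambda>v. xv K v n) \<in> borel_measurable borel"
  unfolding xv_def vpow_def
  by (intro borel_measurable_continuous_onI continuous_intros)

lemma hip_measurable [measurable]: "(\<lambda>v. hip w v) \<in> borel_measurable borel"
  unfolding hip_def
  by (intro borel_measurable_continuous_onI continuous_intros)

lemma cnj_measurable [measurable]: "cnj \<in> borel_measurable borel"
  by (intro borel_measurable_continuous_onI continuous_intros)

lemma xv_phase:
  assumes "n \<in> mi K" shows "xv K (z *s v) n = z ^ K * xv K v n"
proof -
  have "vpow (z *s v) n = z ^ sum n UNIV * vpow v n"
    by (simp add: vpow_def power_mult_distrib prod.distrib power_sum)
  thus ?thesis using assms by (simp add: xv_def mi_def)
qed

lemma mult_cnj_phase: "cmod z = 1 \<Longrightarrow> z * cnj z = 1"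
  by (simp add: complex_norm_square[symmetric])

text \<open>Integrands depend on \<open>R\<close> only through the orbit point
  \<open>R *v u\<close>. They are kept as functions of a vector, so that left translation becomes
  the action of a matrix on that vector.\<close>

locale haar_orbit =
  fixes \<mu> :: "(complex^'n::finite^'n) measure" and u :: "complex^'n"
  assumes haar: "haar_SU \<mu>" and norm_u: "norm u = 1"
begin

sublocale prob_space \<mu>
  using haar by (simp add: haar_SU_def)

lemma sets_haar: "sets \<mu> = sets (restrict_space borel SU)"
  using haar by (simp add: haar_SU_def)

lemma space_haar: "space \<mu> = SU"
  using sets_eq_imp_space_eq[OF sets_haar] by (simp add: space_restrict_space)

lemma measurable_orbit [measurable]: "(\<lambda>R. R *v u) \<in> borel_measurable \<mu>"
  unfolding measurable_cong_sets[OF sets_haar refl]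
  by (intro measurable_restrict_space1 borel_measurable_continuous_onI continuous_on_matrix_vector)

lemma measurable_translation:
  assumes "S \<in> SU" shows "(\<lambda>R. S ** R) \<in> measurable \<mu> \<mu>"
  unfolding measurable_cong_sets[OF sets_haar sets_haar]
  using assms
  by (intro measurable_restrict_space2 measurable_restrict_space1 borel_measurable_continuous_onI continuous_on_matrix_mult)
     (auto simp: space_restrict_space SU_mult)

lemma norm_orbit: "R \<in> space \<mu> \<Longrightarrow> norm (R *v u) = 1"
  by (simp add: space_haar SU_iff norm_unitary norm_u)

lemma integral_SU_invariant:
  fixes h :: "complex^'n \<Rightarrow> 'b::{banach,second_countable_topology}"
  assumes [measurable]: "h \<in> borel_measurable borel" and S: "S \<in> SU"
  shows "(LINT R|\<mu>. h (S *v (R *v u))) = (LINT R|\<mu>. h (R *v u))"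
proof -
  have "distr \<mu> \<mu> (\<lambda>R. S ** R) = \<mu>" using haar S by (simp add: haar_SU_def)
  hence "(LINT R|\<mu>. h (R *v u)) = (LINT R|distr \<mu> \<mu> (\<lambda>R. S ** R). h (R *v u))" by simp
  also have "\<dots> = (LINT R|\<mu>. h ((S ** R) *v u))"
    by (rule integral_distr[OF measurable_translation[OF S]]) measurable
  finally show ?thesis by (simp add: matrix_vector_mul_assoc)
qed

lemma integral_unitary_invariant:
  fixes h :: "complex^'n \<Rightarrow> 'b::{banach,second_countable_topology}"
  assumes h: "h \<in> borel_measurable borel" and S: "unitary S"
    and phase: "\<And>z v. cmod z = 1 \<Longrightarrow> h (z *s v) = h v"
  shows "(LINT R|\<mu>. h (S *v (R *v u))) = (LINT R|\<mu>. h (R *v u))"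
proof -
  obtain z T where T: "cmod z = 1" "T \<in> SU" "\<And>v. T *v v = z *s (S *v v)"
    using unitary_phase_SU[OF S] by metis
  have "h (S *v v) = h (T *v v)" for v using T(3)[of v] phase[OF T(1)] by simp
  thus ?thesis using integral_SU_invariant[OF h T(2)] by simp
qed

lemma xv_orbit_le_1:
  assumes "R \<in> space \<mu>" "n \<in> mi K" shows "(cmod (xv K (R *v u) n))\<^sup>2 \<le> 1"
proof -
  have "(cmod (xv K (R *v u) n))\<^sup>2 \<le> nrm2 (mi K) (xv K (R *v u))"
    unfolding nrm2_def using assms by (intro member_le_sum) auto
  thus ?thesis by (simp add: nrm2_xv norm_orbit[OF assms(1)])
qed

lemma integrable_xv_xv:
  assumes "n \<in> mi K" "n' \<in> mi K"
  shows "integrable \<mu> (\<lambda>R. xv K (R *v u) n * cnj (xv K (R *v u) n'))"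
proof (rule integrable_const_bound[where B = 1])
  show "AE R in \<mu>. norm (xv K (R *v u) n * cnj (xv K (R *v u) n')) \<le> 1"
  proof (rule AE_I2)
    fix R assume R: "R \<in> space \<mu>"
    have "cmod (xv K (R *v u) n) \<le> 1" "cmod (xv K (R *v u) n') \<le> 1"
      using xv_orbit_le_1[OF R assms(1)] xv_orbit_le_1[OF R assms(2)] by (simp_all add: abs_square_le_1)
    thus "norm (xv K (R *v u) n * cnj (xv K (R *v u) n')) \<le> 1"
      by (simp add: norm_mult mult_le_one)
  qed
qed measurable

text \<open>A diagonal unitary changes the sign of the integrand, so the integral equals its own
  negative. Both factors have degree \<open>K\<close>, which makes the integrand invariant under
  global phases and admits a matrix whose determinant is not 1.\<close>

lemma integral_xv_offdiag:
  assumes n: "n \<in> mi K" "n' \<in> mi K" and "n \<noteq> n'"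
  shows "(LINT R|\<mu>. xv K (R *v u) n * cnj (xv K (R *v u) n')) = 0"
proof -
  obtain i where i: "n i \<noteq> n' i" using assms(3) by (auto simp: fun_eq_iff)
  \<comment> \<open>The angle is chosen so that the difference of the exponents at \<open>i\<close>
    turns it into \<open>pi\<close>.\<close>
  define \<zeta> where "\<zeta> = cis (pi / (real (n i) - real (n' i)))"
  have \<zeta>1: "cmod \<zeta> = 1" by (simp add: \<zeta>_def)
  have \<zeta>: "\<zeta> ^ n i * cnj (\<zeta> ^ n' i) = -1"
  proof -
    define t where "t = pi / (real (n i) - real (n' i))"
    have "\<zeta> ^ k = cis (real k * t)" for k unfolding \<zeta>_def t_def by (rule Complex.DeMoivre)
    hence "\<zeta> ^ n i * cnj (\<zeta> ^ n' i) = cis (real (n i) * t - real (n' i) * t)"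
      by (simp only: cis_cnj cis_mult) simp
    also have "real (n i) * t - real (n' i) * t = (real (n i) - real (n' i)) * t"
      by (simp only: left_diff_distrib)
    also have "\<dots> = pi" using i by (simp add: t_def)
    finally show ?thesis by simp
  qed
  define D :: "complex^'n^'n" where "D = (\<chi> j k. if j = k then (if j = i then \<zeta> else 1) else 0)"
  have D: "unitary D"
  proof -
    have "(D ** cadj D) $ j $ k = (\<Sum>l\<in>UNIV. D $ j $ l * cnj (D $ k $ l))" for j k
      by (simp add: matrix_matrix_mult_def cadj_def)
    also have "(\<Sum>l\<in>UNIV. D $ j $ l * cnj (D $ k $ l))
        = (\<Sum>l\<in>UNIV. if l = j then (if j = k then (if j = i then \<zeta> * cnj \<zeta> else 1) else 0) else 0)" for j k
      by (intro sum.cong refl) (auto simp: D_def)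
    finally have "(D ** cadj D) $ j $ k = (if j = k then (if j = i then \<zeta> * cnj \<zeta> else 1) else 0)" for j k
      by simp
    thus ?thesis using mult_cnj_phase[OF \<zeta>1] by (auto simp: unitary_def vec_eq_iff mat_def)
  qed
  have xD: "xv K (D *v v) m = \<zeta> ^ m i * xv K v m" for v m
  proof -
    have "(D *v v) $ j = (\<Sum>k\<in>UNIV. D $ j $ k * v $ k)" for j
      by (simp add: matrix_vector_mult_def)
    also have "(\<Sum>k\<in>UNIV. D $ j $ k * v $ k) = (\<Sum>k\<in>UNIV. if k = j then (if j = i then \<zeta> else 1) * v $ j else 0)" for j
      by (intro sum.cong refl) (auto simp: D_def)
    finally have "(D *v v) $ j = (\<Sum>k\<in>UNIV. if k = j then (if j = i then \<zeta> else 1) * v $ j else 0)" for j .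
    hence "(D *v v) $ j = (if j = i then \<zeta> else 1) * v $ j" for j by simp
    hence "vpow (D *v v) m = (\<Prod>j\<in>UNIV. (if j = i then \<zeta> ^ m j else 1) * v $ j ^ m j)"
      unfolding vpow_def by (intro prod.cong refl) (simp add: power_mult_distrib)
    also have "\<dots> = \<zeta> ^ m i * vpow v m" unfolding vpow_def prod.distrib by simp
    finally show ?thesis by (simp add: xv_def)
  qed
  define h where "h v = xv K v n * cnj (xv K v n')" for v
  have "(LINT R|\<mu>. h (D *v (R *v u))) = (LINT R|\<mu>. h (R *v u))"
  proof (rule integral_unitary_invariant[OF _ D])
    show "h \<in> borel_measurable borel" unfolding h_def by measurable
    fix z v assume "cmod (z :: complex) = 1"
    hence "z ^ K * cnj (z ^ K) = 1" by (intro mult_cnj_phase) (simp add: norm_power)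
    moreover have "h (z *s v) = (z ^ K * cnj (z ^ K)) * h v" by (simp add: h_def xv_phase n)
    ultimately show "h (z *s v) = h v" by simp
  qed
  moreover have "h (D *v v) = - h v" for v
  proof -
    have "h (D *v v) = (\<zeta> ^ n i * cnj (\<zeta> ^ n' i)) * h v" by (simp add: h_def xD)
    thus ?thesis unfolding \<zeta> by simp
  qed
  ultimately have "- (LINT R|\<mu>. h (R *v u)) = (LINT R|\<mu>. h (R *v u))" by simp
  thus ?thesis by (simp add: h_def complex_eq_iff)
qed

lemma integral_hip_indep:
  assumes [measurable]: "G \<in> borel_measurable borel" and "norm w = 1" "norm w' = 1"
  shows "(LINT R|\<mu>. G (cmod (hip w (R *v u)))) = (LINT R|\<mu>. (G (cmod (hip w' (R *v u))) :: real))"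
proof -
  obtain S where S: "unitary S" "S *v w = w'" by (rule unitary_transitive[OF assms(2,3)])
  define h where "h v = G (cmod (hip w' v))" for v
  have "(LINT R|\<mu>. h (S *v (R *v u))) = (LINT R|\<mu>. h (R *v u))"
  proof (rule integral_unitary_invariant[OF _ S(1)])
    show "h \<in> borel_measurable borel" unfolding h_def by measurable
    fix z v assume "cmod (z :: complex) = 1"
    moreover have "hip w' (z *s v) = z * hip w' v" by (simp add: hip_def sum_distrib_left mult_ac)
    ultimately show "h (z *s v) = h v" by (simp add: h_def norm_mult)
  qed
  moreover have "h (S *v v) = G (cmod (hip w v))" for v
    unfolding h_def S(2)[symmetric] hip_unitary[OF S(1)] ..
  ultimately show ?thesis by (simp add: h_def)
qed

lemma integral_cip_xv_expand:
  "of_real (LINT R|\<mu>. (cmod (cip (mi K) y (xv K (R *v u))))\<^sup>2)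
     = (\<Sum>n\<in>mi K. of_real ((cmod (y n))\<^sup>2) * (LINT R|\<mu>. xv K (R *v u) n * cnj (xv K (R *v u) n)))"
proof -
  have "complex_of_real (LINT R|\<mu>. (cmod (cip (mi K) y (xv K (R *v u))))\<^sup>2)
     = (LINT R|\<mu>. of_real ((cmod (cip (mi K) y (xv K (R *v u))))\<^sup>2))"
    by (rule integral_complex_of_real[symmetric])
  also have "\<dots> = (LINT R|\<mu>. (\<Sum>n\<in>mi K. \<Sum>n'\<in>mi K. cnj (y n) * y n' * (xv K (R *v u) n * cnj (xv K (R *v u) n'))))"
    unfolding complex_norm_square cip_def cnj_sum sum_product by (simp add: mult_ac)
  also have "\<dots> = (\<Sum>n\<in>mi K. \<Sum>n'\<in>mi K. cnj (y n) * y n' * (LINT R|\<mu>. xv K (R *v u) n * cnj (xv K (R *v u) n')))"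
    by (subst Bochner_Integration.integral_sum, (intro Bochner_Integration.integrable_sum integrable_mult_right integrable_xv_xv; assumption),
        intro sum.cong refl, subst Bochner_Integration.integral_sum)
       (auto intro!: integrable_mult_right integrable_xv_xv)
  also have "\<dots> = (\<Sum>n\<in>mi K. \<Sum>n'\<in>mi K. if n' = n then cnj (y n) * y n * (LINT R|\<mu>. xv K (R *v u) n * cnj (xv K (R *v u) n)) else 0)"
    by (intro sum.cong refl) (auto simp: integral_xv_offdiag)
  also have "\<dots> = (\<Sum>n\<in>mi K. cnj (y n) * y n * (LINT R|\<mu>. xv K (R *v u) n * cnj (xv K (R *v u) n)))"
    by simp
  finally show ?thesis by (simp add: complex_norm_square mult.commute del: of_real_power)
qed

text \<open>This takes the place of Schur's lemma. The averaged coherent projection is already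
  diagonal with entries \<open>b n\<close>, and its expectation in every coherent state is the same
  constant \<open>C\<close>. As a polynomial identity this forces \<open>b n = C\<close>, and the
  total mass 1 determines \<open>C\<close>.\<close>

lemma integral_xv_diag:
  assumes "n \<in> mi K"
  shows "(LINT R|\<mu>. xv K (R *v u) n * cnj (xv K (R *v u) n)) = of_real (1 / real (card (mi K :: ('n \<Rightarrow> nat) set)))"
proof -
  define b where "b n = (LINT R|\<mu>. (cmod (xv K (R *v u) n))\<^sup>2)" for n
  have b: "(LINT R|\<mu>. xv K (R *v u) n * cnj (xv K (R *v u) n)) = of_real (b n)" for n
    unfolding b_def integral_complex_of_real[symmetric] complex_norm_square ..
  define C where "C = (LINT R|\<mu>. (cmod (hip u (R *v u) ^ K))\<^sup>2)"
  have unit: "(\<Sum>n\<in>mi K. (cmod (xv K w n))\<^sup>2 * b n) = C" if "norm w = 1" for w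
  proof -
    have "(LINT R|\<mu>. (cmod (hip w (R *v u) ^ K))\<^sup>2) = C"
      unfolding C_def norm_power
      by (rule integral_hip_indep[where G = "\<lambda>x. (x ^ K)\<^sup>2", OF _ that norm_u]) measurable
    hence "complex_of_real (LINT R|\<mu>. (cmod (cip (mi K) (xv K w) (xv K (R *v u))))\<^sup>2) = of_real C"
      unfolding cip_xv by (rule arg_cong)
    hence "complex_of_real (\<Sum>n\<in>mi K. (cmod (xv K w n))\<^sup>2 * b n) = of_real C"
      unfolding integral_cip_xv_expand b by simp
    thus ?thesis by (simp only: of_real_eq_iff)
  qed
  have bC: "b n = C" if "n \<in> mi K" for n
  proof -
    have "(b n - C) * (fact K / mfact n) = 0"
    proof (rule positive_poly_zero[of "mi K" "\<lambda>n. (b n - C) * (fact K / mfact n)"])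
      fix s :: "'n \<Rightarrow> real" assume s: "\<And>i. s i > 0"
      \<comment> \<open>Square roots as components make the squared coordinates of
        \<open>xv K v\<close> monomials in the free positive variables \<open>s\<close>; rescaling
        to norm 1 multiplies all of them by a common factor.\<close>
      define v :: "complex^'n" where "v = (\<chi> i. of_real (sqrt (s i)))"
      have xs: "(cmod (xv K v n))\<^sup>2 = fact K / mfact n * (\<Prod>i\<in>UNIV. s i ^ n i)" for n
      proof -
        have "vpow v n = of_real (\<Prod>i\<in>UNIV. sqrt (s i) ^ n i)" by (simp add: vpow_def v_def)
        hence "(cmod (vpow v n))\<^sup>2 = (\<Prod>i\<in>UNIV. sqrt (s i) ^ n i)\<^sup>2" by (simp only: norm_of_real power2_abs)
        also have "\<dots> = (\<Prod>i\<in>UNIV. (sqrt (s i))\<^sup>2 ^ n i)"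
          by (simp only: prod_power_distrib power_mult[symmetric] mult.commute)
        also have "\<dots> = (\<Prod>i\<in>UNIV. s i ^ n i)" using s by (simp add: less_imp_le)
        finally show ?thesis
          unfolding xv_def norm_mult power_mult_distrib by (simp add: less_imp_le)
      qed
      obtain i0 :: 'n where "True" by blast
      have "v $ i0 \<noteq> 0" using s[of i0] by (simp add: v_def)
      hence "v \<noteq> 0" by auto
      define r where "r = norm v"
      have r: "r > 0" using \<open>v \<noteq> 0\<close> by (simp add: r_def)
      define w where "w = of_real (1 / r) *s v"
      have vw: "v = of_real r *s w" using r by (simp add: w_def vec_eq_iff)
      have "norm w = 1"
      proof -
        have "complex_of_real ((norm w)\<^sup>2) = of_real ((1 / r)\<^sup>2) * hip v v"
          unfolding hip_self[symmetric]
          by (simp add: w_def hip_def sum_distrib_left power2_eq_square mult_ac)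
        also have "\<dots> = of_real ((1 / r)\<^sup>2 * r\<^sup>2)" unfolding hip_self r_def by simp
        also have "(1 / r)\<^sup>2 * r\<^sup>2 = 1" using r by (simp add: power_divide)
        finally have "(norm w)\<^sup>2 = 1" by (simp only: of_real_eq_iff)
        thus ?thesis using norm_ge_zero[of w] by (auto simp: power2_eq_1_iff)
      qed
      have xw: "(cmod (xv K v n))\<^sup>2 = (r ^ K)\<^sup>2 * (cmod (xv K w n))\<^sup>2" if "n \<in> mi K" for n
        unfolding vw xv_phase[OF that] using r by (simp add: norm_mult norm_power power_mult_distrib)
      have "(\<Sum>n\<in>mi K. (b n - C) * (fact K / mfact n) * (\<Prod>i\<in>UNIV. s i ^ n i))
          = (\<Sum>n\<in>mi K. (b n - C) * (cmod (xv K v n))\<^sup>2)"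
        unfolding xs by (simp only: mult.assoc)
      also have "\<dots> = (r ^ K)\<^sup>2 * ((\<Sum>n\<in>mi K. (cmod (xv K w n))\<^sup>2 * b n) - C * nrm2 (mi K) (xv K w))"
        by (simp add: xw nrm2_def sum_distrib_left sum_subtractf algebra_simps)
      also have "\<dots> = 0" unfolding unit[OF \<open>norm w = 1\<close>] nrm2_xv using \<open>norm w = 1\<close> by simp
      finally show "(\<Sum>n\<in>mi K. (b n - C) * (fact K / mfact n) * (\<Prod>i\<in>UNIV. s i ^ n i)) = 0" .
    qed (use that in auto)
    thus ?thesis by simp
  qed
  have "(\<Sum>n\<in>(mi K :: ('n \<Rightarrow> nat) set). b n) = 1"
  proof -
    have "(\<Sum>n\<in>mi K. complex_of_real (b n)) = (LINT R|\<mu>. (\<Sum>n\<in>mi K. xv K (R *v u) n * cnj (xv K (R *v u) n)))"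
      unfolding b[symmetric] by (rule Bochner_Integration.integral_sum[symmetric]) (rule integrable_xv_xv)
    also have "\<dots> = (LINT R|\<mu>. of_real 1)"
    proof (rule Bochner_Integration.integral_cong[OF refl])
      fix R assume "R \<in> space \<mu>"
      hence "nrm2 (mi K) (xv K (R *v u)) = 1" by (simp add: nrm2_xv norm_orbit)
      thus "(\<Sum>n\<in>mi K. xv K (R *v u) n * cnj (xv K (R *v u) n)) = of_real 1"
        unfolding nrm2_def complex_norm_square[symmetric] of_real_sum[symmetric] by simp
    qed
    also have "\<dots> = of_real 1" by (simp add: prob_space)
    finally show ?thesis unfolding of_real_sum[symmetric] of_real_eq_iff .
  qed
  hence "C * real (card (mi K :: ('n \<Rightarrow> nat) set)) = 1" using bC by (simp add: mult.commute)
  hence "C = 1 / real (card (mi K :: ('n \<Rightarrow> nat) set))"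
    by (metis mult_zero_right nonzero_eq_divide_eq zero_neq_one)
  thus ?thesis unfolding b bC[OF assms] by simp
qed

lemma resolution_of_identity:
  "(LINT R|\<mu>. (cmod (cip (mi K) y (xv K (R *v u))))\<^sup>2) = nrm2 (mi K) y / real (card (mi K :: ('n \<Rightarrow> nat) set))"
proof -
  have "complex_of_real (LINT R|\<mu>. (cmod (cip (mi K) y (xv K (R *v u))))\<^sup>2)
      = of_real (\<Sum>n\<in>mi K. (cmod (y n))\<^sup>2 * (1 / real (card (mi K :: ('n \<Rightarrow> nat) set))))"
    unfolding integral_cip_xv_expand of_real_sum
    by (intro sum.cong refl) (simp add: integral_xv_diag)
  thus ?thesis unfolding of_real_eq_iff by (simp add: nrm2_def sum_divide_distrib)
qed

end

section \<open>Piecewise linear approximation of concave functions\<close>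

text \<open>The piecewise linear interpolant of \<open>f\<close> at the nodes \<open>i / n\<close>, written with the second differences
  of \<open>f\<close>. It reproduces \<open>f 0\<close> and \<open>f 1\<close>, hence converges to \<open>f\<close> even where \<open>f\<close> jumps at an end point.\<close>

definition interpolant :: "(real \<Rightarrow> real) \<Rightarrow> nat \<Rightarrow> real \<Rightarrow> real" where
  "interpolant f n x = f 0 + real n * (f (1 / real n) - f 0) * x
     + (\<Sum>i=1..<n. real n * (f ((real i + 1) / real n) - 2 * f (real i / real n) + f ((real i - 1) / real n)) * max 0 (x - real i / real n))"

lemma interpolant_eq:
  assumes n: "n \<ge> 1" and x: "0 \<le> x" "x \<le> 1"
  obtains k where "k < n" "0 \<le> real n * x - real k" "real n * x - real k \<le> 1"
    "interpolant f n x = (1 - (real n * x - real k)) * f (real k / real n) + (real n * x - real k) * f ((real k + 1) / real n)"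
proof -
  \<comment> \<open>At \<open>x = 1\<close> the floor would be \<open>n\<close>, beyond the last
    cell, so the cell \<open>n - 1\<close> is used.\<close>
  define k where "k = (if x = 1 then n - 1 else nat \<lfloor>real n * x\<rfloor>)"
  have k: "k < n \<and> real k \<le> real n * x \<and> real n * x \<le> real k + 1"
  proof (cases "x = 1")
    case True thus ?thesis using n by (simp add: k_def of_nat_diff)
  next
    case False
    have "real n * x < real n" using n x False by simp
    hence "\<lfloor>real n * x\<rfloor> < int n" by (simp add: floor_less_iff)
    moreover have "0 \<le> \<lfloor>real n * x\<rfloor>" using x by simp
    ultimately show ?thesis using False by (simp add: k_def) linarith
  qed
  \<comment> \<open>Summation by parts: the second differences up to \<open>j\<close> add up to the
    affine function of cell \<open>j\<close>. Hinges to the left of \<open>x\<close> are linear, so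
    no positive parts appear.\<close>
  have s: "(\<Sum>i=1..<Suc j. real n * (f ((real i + 1) / real n) - 2 * f (real i / real n) + f ((real i - 1) / real n)) * (x - real i / real n))
      = f (real j / real n) + real n * (f ((real j + 1) / real n) - f (real j / real n)) * (x - real j / real n)
        - f 0 - real n * (f (1 / real n) - f 0) * x" for j
  proof (induction j)
    case 0 show ?case by simp
  next
    case (Suc j)
    define T where "T i = real n * (f ((real i + 1) / real n) - 2 * f (real i / real n) + f ((real i - 1) / real n)) * (x - real i / real n)" for i
    have "(\<Sum>i=1..<Suc (Suc j). T i) = (\<Sum>i=1..<Suc j. T i) + T (Suc j)"
      by (rule sum.atLeastLessThan_Suc) simp
    moreover have "T (Suc j) = real n * (f ((real j + 2) / real n) - 2 * f ((real j + 1) / real n) + f (real j / real n)) * (x - (real j + 1) / real n)"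
      by (simp add: T_def add.commute)
    moreover have "(\<Sum>i=1..<Suc j. T i) = f (real j / real n) + real n * (f ((real j + 1) / real n) - f (real j / real n)) * (x - real j / real n)
        - f 0 - real n * (f (1 / real n) - f 0) * x" unfolding T_def by (rule Suc)
    moreover have "real (Suc j) = real j + 1" "real j + 1 + 1 = real j + 2" by simp_all
    moreover have "real n \<noteq> 0" using n by simp
    ultimately show ?case
      unfolding T_def[symmetric] by (simp only:) (simp add: field_simps)
  qed
  have "(\<Sum>i=1..<n. real n * (f ((real i + 1) / real n) - 2 * f (real i / real n) + f ((real i - 1) / real n)) * max 0 (x - real i / real n))
     = (\<Sum>i=1..<Suc k. real n * (f ((real i + 1) / real n) - 2 * f (real i / real n) + f ((real i - 1) / real n)) * max 0 (x - real i / real n))"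
  proof (rule sum.mono_neutral_right)
    show "\<forall>i\<in>{1..<n} - {1..<Suc k}. real n * (f ((real i + 1) / real n) - 2 * f (real i / real n) + f ((real i - 1) / real n)) * max 0 (x - real i / real n) = 0"
    proof
      fix i assume "i \<in> {1..<n} - {1..<Suc k}"
      hence "real k + 1 \<le> real i" by auto
      hence "real n * x \<le> real i" using k by linarith
      hence "x \<le> real i / real n" using n by (simp add: field_simps)
      thus "real n * (f ((real i + 1) / real n) - 2 * f (real i / real n) + f ((real i - 1) / real n)) * max 0 (x - real i / real n) = 0"
        by simp
    qed
  qed (use k in auto)
  also have "\<dots> = (\<Sum>i=1..<Suc k. real n * (f ((real i + 1) / real n) - 2 * f (real i / real n) + f ((real i - 1) / real n)) * (x - real i / real n))"
  proof (rule sum.cong[OF refl])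
    fix i assume "i \<in> {1..<Suc k}"
    hence "real i \<le> real k" by auto
    hence "real i \<le> real n * x" using k by linarith
    hence "real i / real n \<le> x" using n by (simp add: field_simps)
    thus "real n * (f ((real i + 1) / real n) - 2 * f (real i / real n) + f ((real i - 1) / real n)) * max 0 (x - real i / real n)
       = real n * (f ((real i + 1) / real n) - 2 * f (real i / real n) + f ((real i - 1) / real n)) * (x - real i / real n)"
      by simp
  qed
  finally have "interpolant f n x = f (real k / real n) + real n * (f ((real k + 1) / real n) - f (real k / real n)) * (x - real k / real n)"
    unfolding interpolant_def s by simp
  also have "\<dots> = (1 - (real n * x - real k)) * f (real k / real n) + (real n * x - real k) * f ((real k + 1) / real n)"
    using n by (simp add: field_simps)
  finally show ?thesis using that[of k] k by simp
qed

text \<open>Below, \<open>f\<close> dominates its chord. Above, the midpoint of \<open>x\<close> and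
  \<open>1 - x\<close> is always \<open>1/2\<close>, so the lower bound at \<open>1 - x\<close>
  limits \<open>f x\<close>.\<close>

lemma concave_on_bounded:
  fixes f :: "real \<Rightarrow> real"
  assumes "concave_on {0..1} f"
  obtains B where "\<And>x. 0 \<le> x \<Longrightarrow> x \<le> 1 \<Longrightarrow> \<bar>f x\<bar> \<le> B"
proof -
  define L where "L = min (f 0) (f 1)"
  have conc: "f ((1 - t) * x + t * y) \<ge> (1 - t) * f x + t * f y"
    if "0 \<le> t" "t \<le> 1" "x \<in> {0..1}" "y \<in> {0..1}" for t x y
    using concave_onD[OF assms that] by simp
  have lo: "L \<le> f x" if "0 \<le> x" "x \<le> 1" for x
  proof -
    have "L = (1 - x) * L + x * L" by (simp add: algebra_simps)
    also have "\<dots> \<le> (1 - x) * f 0 + x * f 1" using that by (intro add_mono mult_left_mono) (auto simp: L_def)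
    also have "\<dots> \<le> f x" using conc[of x 0 1] that by simp
    finally show ?thesis .
  qed
  have hi: "f x \<le> 2 * f (1/2) - L" if "0 \<le> x" "x \<le> 1" for x
  proof -
    have e: "(1 - 1/2) * x + 1/2 * (1 - x) = (1/2 :: real)" by (simp add: field_simps)
    have "(1 - 1/2) * f x + 1/2 * f (1 - x) \<le> f ((1 - 1/2) * x + 1/2 * (1 - x))"
      using that by (intro conc) auto
    hence "f x / 2 + f (1 - x) / 2 \<le> f (1/2)" unfolding e by simp
    moreover have "L \<le> f (1 - x)" using that by (intro lo) auto
    ultimately show ?thesis by linarith
  qed
  show ?thesis
  proof (rule that[of "\<bar>L\<bar> + \<bar>2 * f (1/2) - L\<bar>"])
    fix x :: real assume "0 \<le> x" "x \<le> 1"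
    from lo[OF this] hi[OF this] show "\<bar>f x\<bar> \<le> \<bar>L\<bar> + \<bar>2 * f (1/2) - L\<bar>" by linarith
  qed
qed

lemma interpolant_LIMSEQ:
  assumes f: "concave_on {0..1} f" and x: "0 \<le> x" "x \<le> 1"
  shows "(\<lambda>n. interpolant f (Suc n) x) \<longlonglongrightarrow> f x"
proof -
  consider "x = 0" | "x = 1" | "0 < x" "x < 1" using x by linarith
  thus ?thesis
  proof cases
    case 1
    have "interpolant f (Suc n) x = f x" for n
      unfolding interpolant_def 1 by (simp add: sum.neutral)
    thus ?thesis by simp
  next
    case 2
    have "interpolant f (Suc n) x = f x" for n
    proof -
      obtain k where k: "k < Suc n" "real (Suc n) * x - real k \<le> 1"
        "interpolant f (Suc n) x = (1 - (real (Suc n) * x - real k)) * f (real k / real (Suc n)) + (real (Suc n) * x - real k) * f ((real k + 1) / real (Suc n))"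
        using interpolant_eq[of "Suc n" x f] x by auto
      have "k = n" using k(1,2) 2 by simp
      thus ?thesis unfolding k(3) by (simp add: 2 add.commute)
    qed
    thus ?thesis by simp
  next
    case 3
    have "convex_on {0<..<1} (\<lambda>x. - f x)"
      using f by (auto simp: concave_on_def intro: convex_on_subset)
    hence "continuous_on {0<..<1} (\<lambda>x. - (- f x))"
      by (intro continuous_on_minus convex_on_continuous) auto
    hence "isCont f x" using 3 by (simp add: continuous_on_eq_continuous_at)
    show ?thesis
    proof (rule LIMSEQ_I)
      fix r :: real assume "r > 0"
      then obtain d where d: "d > 0" "\<And>y. \<bar>y - x\<bar> < d \<Longrightarrow> \<bar>f y - f x\<bar> < r"
        using \<open>isCont f x\<close> unfolding continuous_at_eps_delta by (auto simp: dist_real_def)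
      obtain N where N: "inverse (real (Suc N)) < d" using reals_Archimedean[OF d(1)] by auto
      show "\<exists>no. \<forall>n\<ge>no. norm (interpolant f (Suc n) x - f x) < r"
      proof (intro exI allI impI)
        fix n assume "N \<le> n"
        hence "1 / real (Suc n) \<le> inverse (real (Suc N))" by (simp add: field_simps)
        hence nd: "1 / real (Suc n) < d" using N by linarith
        obtain k where k: "0 \<le> real (Suc n) * x - real k" "real (Suc n) * x - real k \<le> 1"
          "interpolant f (Suc n) x = (1 - (real (Suc n) * x - real k)) * f (real k / real (Suc n)) + (real (Suc n) * x - real k) * f ((real k + 1) / real (Suc n))"
          using interpolant_eq[of "Suc n" x f] x by auto
        define l where "l = real (Suc n) * x - real k"
        have l: "0 \<le> l" "l \<le> 1" using k by (auto simp: l_def)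
        have xe: "x = (real k + l) / real (Suc n)" by (simp add: l_def)
        have "real k / real (Suc n) - x = - (l * (1 / real (Suc n)))" "(real k + 1) / real (Suc n) - x = (1 - l) * (1 / real (Suc n))"
          unfolding xe by (simp_all add: add_divide_distrib left_diff_distrib diff_divide_distrib del: of_nat_Suc)
        moreover have "l * (1 / real (Suc n)) \<le> 1 / real (Suc n)" "(1 - l) * (1 / real (Suc n)) \<le> 1 / real (Suc n)"
          using l by (auto simp: divide_right_mono)
        moreover have "0 \<le> l * (1 / real (Suc n))" "0 \<le> (1 - l) * (1 / real (Suc n))" using l by auto
        ultimately have "\<bar>real k / real (Suc n) - x\<bar> < d" "\<bar>(real k + 1) / real (Suc n) - x\<bar> < d"
          using nd by linarith+
        hence a: "\<bar>f (real k / real (Suc n)) - f x\<bar> < r" "\<bar>f ((real k + 1) / real (Suc n)) - f x\<bar> < r"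
          using d(2) by blast+
        have "interpolant f (Suc n) x - f x = (1 - l) * (f (real k / real (Suc n)) - f x) + l * (f ((real k + 1) / real (Suc n)) - f x)"
          unfolding k(3) l_def[symmetric] by (simp add: algebra_simps)
        also have "\<bar>\<dots>\<bar> \<le> (1 - l) * \<bar>f (real k / real (Suc n)) - f x\<bar> + l * \<bar>f ((real k + 1) / real (Suc n)) - f x\<bar>"
          using l by (intro order_trans[OF abs_triangle_ineq]) (simp add: abs_mult)
        also have "\<dots> < r"
          using convex_bound_lt[of "\<bar>f (real k / real (Suc n)) - f x\<bar>" r "\<bar>f ((real k + 1) / real (Suc n)) - f x\<bar>" "1 - l" l] a l
          by simp
        finally show "norm (interpolant f (Suc n) x - f x) < r" by simp
      qed
    qed
  qed
qed

lemma interpolant_measurable [measurable]: "interpolant f n \<in> borel_measurable borel"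
  unfolding interpolant_def[abs_def] by measurable

text \<open>For the interpolants the affine part is settled by the equal means and the hinge part by
  the hinge inequalities, reversed by nonpositive second differences. Dominated convergence then
  passes to \<open>f\<close>.\<close>

lemma (in prob_space) concave_order:
  fixes Q Y :: "'a \<Rightarrow> real" and f :: "real \<Rightarrow> real"
  assumes [measurable]: "Q \<in> borel_measurable M" "Y \<in> borel_measurable M"
    and Q: "\<And>\<omega>. \<omega> \<in> space M \<Longrightarrow> 0 \<le> Q \<omega> \<and> Q \<omega> \<le> 1"
    and Y: "\<And>\<omega>. \<omega> \<in> space M \<Longrightarrow> 0 \<le> Y \<omega> \<and> Y \<omega> \<le> 1"
    and mean: "expectation Q = expectation Y"
    and hinge: "\<And>t. 0 \<le> t \<Longrightarrow> t \<le> 1 \<Longrightarrow> expectation (\<lambda>\<omega>. max 0 (Q \<omega> - t)) \<le> expectation (\<lambda>\<omega>. max 0 (Y \<omega> - t))"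
    and f: "concave_on {0..1} f"
  shows "expectation (\<lambda>\<omega>. f (Y \<omega>)) \<le> expectation (\<lambda>\<omega>. f (Q \<omega>))"
proof -
  obtain B where B: "\<And>x. 0 \<le> x \<Longrightarrow> x \<le> 1 \<Longrightarrow> \<bar>f x\<bar> \<le> B" by (rule concave_on_bounded[OF f]) blast
  have bnd: "\<bar>interpolant f (Suc n) x\<bar> \<le> B" if x: "0 \<le> x" "x \<le> 1" for n x
  proof -
    obtain k where k: "k < Suc n" "0 \<le> real (Suc n) * x - real k" "real (Suc n) * x - real k \<le> 1"
      "interpolant f (Suc n) x = (1 - (real (Suc n) * x - real k)) * f (real k / real (Suc n)) + (real (Suc n) * x - real k) * f ((real k + 1) / real (Suc n))"
      using interpolant_eq[of "Suc n" x f] x by auto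
    define l where "l = real (Suc n) * x - real k"
    have l: "0 \<le> l" "l \<le> 1" using k by (auto simp: l_def)
    have "\<bar>f (real k / real (Suc n))\<bar> \<le> B" "\<bar>f ((real k + 1) / real (Suc n))\<bar> \<le> B"
      using k(1) by (auto intro!: B simp: field_simps)
    hence "(1 - l) * \<bar>f (real k / real (Suc n))\<bar> + l * \<bar>f ((real k + 1) / real (Suc n))\<bar> \<le> B"
      using l by (intro convex_bound_le) auto
    moreover have "\<bar>interpolant f (Suc n) x\<bar> \<le> (1 - l) * \<bar>f (real k / real (Suc n))\<bar> + l * \<bar>f ((real k + 1) / real (Suc n))\<bar>"
      unfolding k(4) l_def[symmetric] using l by (intro order_trans[OF abs_triangle_ineq]) (simp add: abs_mult)
    ultimately show ?thesis by linarith
  qed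
  have lim: "(\<lambda>n. expectation (\<lambda>\<omega>. interpolant f (Suc n) (Z \<omega>))) \<longlonglongrightarrow> expectation (\<lambda>\<omega>. f (Z \<omega>))"
    if [measurable]: "Z \<in> borel_measurable M" and Z: "\<And>\<omega>. \<omega> \<in> space M \<Longrightarrow> 0 \<le> Z \<omega> \<and> Z \<omega> \<le> 1" for Z
  proof (rule integral_dominated_convergence[where w = "\<lambda>_. B"])
    \<comment> \<open>Measurability is inherited from the interpolants, which converge at every
      point, including end points where \<open>f\<close> may jump.\<close>
    show "(\<lambda>\<omega>. f (Z \<omega>)) \<in> borel_measurable M"
      by (rule borel_measurable_LIMSEQ_real[of _ "\<lambda>n \<omega>. interpolant f (Suc n) (Z \<omega>)"])
         (use Z interpolant_LIMSEQ[OF f] in \<open>auto\<close>)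
    show "AE \<omega> in M. (\<lambda>n. interpolant f (Suc n) (Z \<omega>)) \<longlonglongrightarrow> f (Z \<omega>)"
      using Z interpolant_LIMSEQ[OF f] by (intro AE_I2) auto
    show "AE \<omega> in M. norm (interpolant f (Suc n) (Z \<omega>)) \<le> B" for n
      using Z bnd by (intro AE_I2) auto
  qed auto
  have int: "integrable M Z" if "Z \<in> borel_measurable M" "\<And>\<omega>. \<omega> \<in> space M \<Longrightarrow> 0 \<le> Z \<omega> \<and> Z \<omega> \<le> 1" for Z :: "'a \<Rightarrow> real"
    using that by (intro integrable_const_bound[where B = 1]) auto
  have inth: "integrable M (\<lambda>\<omega>. max 0 (Z \<omega> - t))"
    if [measurable]: "Z \<in> borel_measurable M" and Z: "\<And>\<omega>. \<omega> \<in> space M \<Longrightarrow> 0 \<le> Z \<omega> \<and> Z \<omega> \<le> 1" and "0 \<le> t" for Z :: "'a \<Rightarrow> real" and t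
    using Z \<open>0 \<le> t\<close> by (intro integrable_const_bound[where B = 1] AE_I2) (auto simp: max_def, force)
  have expand: "expectation (\<lambda>\<omega>. interpolant f n (Z \<omega>)) = f 0 + real n * (f (1 / real n) - f 0) * expectation Z
     + (\<Sum>i=1..<n. real n * (f ((real i + 1) / real n) - 2 * f (real i / real n) + f ((real i - 1) / real n)) * expectation (\<lambda>\<omega>. max 0 (Z \<omega> - real i / real n)))"
    if "Z \<in> borel_measurable M" "\<And>\<omega>. \<omega> \<in> space M \<Longrightarrow> 0 \<le> Z \<omega> \<and> Z \<omega> \<le> 1" for Z n
    unfolding interpolant_def using int[OF that] inth[OF that] by (simp add: prob_space)
  have "expectation (\<lambda>\<omega>. interpolant f n (Y \<omega>)) \<le> expectation (\<lambda>\<omega>. interpolant f n (Q \<omega>))" for n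
  proof -
    have "(\<Sum>i=1..<n. real n * (f ((real i + 1) / real n) - 2 * f (real i / real n) + f ((real i - 1) / real n)) * expectation (\<lambda>\<omega>. max 0 (Y \<omega> - real i / real n)))
      \<le> (\<Sum>i=1..<n. real n * (f ((real i + 1) / real n) - 2 * f (real i / real n) + f ((real i - 1) / real n)) * expectation (\<lambda>\<omega>. max 0 (Q \<omega> - real i / real n)))"
    proof (intro sum_mono mult_left_mono_neg)
      fix i assume i: "i \<in> {1..<n}"
      show "expectation (\<lambda>\<omega>. max 0 (Q \<omega> - real i / real n)) \<le> expectation (\<lambda>\<omega>. max 0 (Y \<omega> - real i / real n))"
        using i by (intro hinge) auto
      have "(1 - 1/2) * f ((real i - 1) / real n) + 1/2 * f ((real i + 1) / real n)
          \<le> f ((1 - 1/2) *\<^sub>R ((real i - 1) / real n) + (1/2) *\<^sub>R ((real i + 1) / real n))"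
        using i by (intro concave_onD[OF f]) (auto simp: field_simps)
      also have "(1 - 1/2) *\<^sub>R ((real i - 1) / real n) + (1/2) *\<^sub>R ((real i + 1) / real n) = real i / real n"
        using i by (simp add: field_simps)
      finally show "real n * (f ((real i + 1) / real n) - 2 * f (real i / real n) + f ((real i - 1) / real n)) \<le> 0"
        by (intro mult_nonneg_nonpos) auto
    qed
    thus ?thesis using expand[OF assms(1) Q] expand[OF assms(2) Y] mean by simp
  qed
  thus ?thesis by (intro LIMSEQ_le[OF lim[OF assms(2) Y] lim[OF assms(1) Q]]) auto
qed

section \<open>The semiclassical limit\<close>

text \<open>Factor by factor \<open>(a - M) / (K - M) \<le> a / K\<close>. The products are left
  multiplied out because \<open>K choose M\<close> may vanish; truncated subtraction covers
  \<open>a < M\<close>.\<close>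

lemma binomial_ratio_le_power:
  assumes "a \<le> K"
  shows "real (a choose M) * real K ^ M \<le> real (K choose M) * real a ^ M"
proof (induction M)
  case 0 show ?case by simp
next
  case (Suc M)
  have rec: "real (Suc M) * real (n choose Suc M) = real (n - M) * real (n choose M)" for n
    by (simp only: of_nat_mult[symmetric] binomial_absorption binomial_absorb_comp)
  have le: "real (a - M) * real K \<le> real (K - M) * real a"
  proof (cases "M \<le> a")
    case True
    have "real M * real a \<le> real M * real K" using assms by (intro mult_left_mono) auto
    thus ?thesis using True assms by (simp add: of_nat_diff algebra_simps)
  qed simp
  have "real (Suc M) * (real (a choose Suc M) * real K ^ Suc M)
      = (real (a choose M) * real K ^ M) * (real (a - M) * real K)"
    unfolding mult.assoc[symmetric] rec by (simp add: mult_ac)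
  also have "\<dots> \<le> (real (K choose M) * real a ^ M) * (real (K - M) * real a)"
    by (intro mult_mono Suc.IH le) auto
  also have "\<dots> = real (Suc M) * (real (K choose Suc M) * real a ^ Suc M)"
    unfolding mult.assoc[of "real (Suc M)", symmetric] rec by (simp add: mult_ac)
  finally show ?case by (simp only: mult_le_cancel_left_pos of_nat_0_less_iff zero_less_Suc)
qed

text \<open>The admissible thresholds come from integers \<open>m\<close>; with \<open>m\<close> the
  floor of \<open>\<tau> * k\<close> their ratios reach any prescribed \<open>\<tau> ^ M\<close> in
  the limit, each of the \<open>M\<close> factors tending to \<open>\<tau>\<close>.\<close>

lemma binomial_ratio_LIMSEQ:
  assumes "0 \<le> \<tau>"
  shows "(\<lambda>k. real ((nat \<lfloor>\<tau> * real k\<rfloor> + M) choose M) / real ((k + M) choose M)) \<longlonglongrightarrow> \<tau> ^ M"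
proof (induction M)
  case 0 show ?case by simp
next
  case (Suc M)
  have "(\<lambda>k. (real (nat \<lfloor>\<tau> * real k\<rfloor>) + real (Suc M)) / (real k + real (Suc M))) \<longlonglongrightarrow> \<tau>"
  proof (rule tendsto_sandwich)
    show "\<forall>\<^sub>F k in sequentially. (\<tau> * real k + real M) / (real k + real (Suc M)) \<le> (real (nat \<lfloor>\<tau> * real k\<rfloor>) + real (Suc M)) / (real k + real (Suc M))"
    proof (rule always_eventually, rule allI)
      fix k
      have "\<tau> * real k \<le> real (nat \<lfloor>\<tau> * real k\<rfloor>) + 1" by linarith
      thus "(\<tau> * real k + real M) / (real k + real (Suc M)) \<le> (real (nat \<lfloor>\<tau> * real k\<rfloor>) + real (Suc M)) / (real k + real (Suc M))"
        by (intro divide_right_mono) auto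
    qed
    show "\<forall>\<^sub>F k in sequentially. (real (nat \<lfloor>\<tau> * real k\<rfloor>) + real (Suc M)) / (real k + real (Suc M)) \<le> (\<tau> * real k + real (Suc M)) / (real k + real (Suc M))"
      using assms by (intro always_eventually allI divide_right_mono) auto
    have "(\<lambda>k. (c - \<tau> * real (Suc M)) / real (k + Suc M)) \<longlonglongrightarrow> 0" for c
      by (rule LIMSEQ_ignore_initial_segment[OF lim_const_over_n])
    from tendsto_add[OF tendsto_const this]
    have "(\<lambda>k. \<tau> + (c - \<tau> * real (Suc M)) / (real k + real (Suc M))) \<longlonglongrightarrow> \<tau> + 0" for c
      unfolding of_nat_add .
    moreover have "\<tau> + (c - \<tau> * real (Suc M)) / (real k + real (Suc M)) = (\<tau> * real k + c) / (real k + real (Suc M))" for c k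
      by (simp add: field_simps)
    ultimately have lim: "(\<lambda>k. (\<tau> * real k + c) / (real k + real (Suc M))) \<longlonglongrightarrow> \<tau>" for c by simp
    show "(\<lambda>k. (\<tau> * real k + real M) / (real k + real (Suc M))) \<longlonglongrightarrow> \<tau>" by (rule lim)
    show "(\<lambda>k. (\<tau> * real k + real (Suc M)) / (real k + real (Suc M))) \<longlonglongrightarrow> \<tau>" by (rule lim)
  qed
  from tendsto_mult[OF this Suc.IH]
  have l: "(\<lambda>k. (real (nat \<lfloor>\<tau> * real k\<rfloor>) + real (Suc M)) / (real k + real (Suc M))
      * (real ((nat \<lfloor>\<tau> * real k\<rfloor> + M) choose M) / real ((k + M) choose M))) \<longlonglongrightarrow> \<tau> ^ Suc M" by simp
  have rec: "real ((m + Suc M) choose Suc M) = (real m + real (Suc M)) * real ((m + M) choose M) / real (Suc M)" for m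
  proof -
    have "real (Suc M) * real (Suc (m + M) choose Suc M) = real (Suc (m + M)) * real ((m + M) choose M)"
      by (simp only: of_nat_mult[symmetric] Suc_times_binomial)
    thus ?thesis by (simp add: field_simps)
  qed
  have "real ((m + Suc M) choose Suc M) / real ((k + Suc M) choose Suc M)
     = (real m + real (Suc M)) / (real k + real (Suc M)) * (real ((m + M) choose M) / real ((k + M) choose M))" for m k
    unfolding rec by simp
  thus ?case using l by simp
qed

context haar_orbit
begin

definition dim_mi :: "nat \<Rightarrow> real" where
  "dim_mi K = real (card (mi K :: ('n \<Rightarrow> nat) set))"

lemma dim_mi_pos: "dim_mi K > 0"
proof -
  obtain i :: 'n where True by blast
  have "(\<lambda>j. if j = i then K else 0) \<in> mi K" by (simp add: mi_def)
  thus ?thesis unfolding dim_mi_def by (auto simp: card_gt_0_iff)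
qed

lemma cip_xv_measurable [measurable]: "(\<lambda>v. cip (mi K) y (xv K v)) \<in> borel_measurable borel"
  unfolding cip_def by measurable

lemma cip_xv_bounded:
  obtains B where "\<And>R. R \<in> space \<mu> \<Longrightarrow> (cmod (cip (mi K) y (xv K (R *v u))))\<^sup>2 \<le> B"
proof
  fix R assume R: "R \<in> space \<mu>"
  have "cmod (cip (mi K) y (xv K (R *v u))) \<le> (\<Sum>n\<in>mi K. cmod (y n))"
    unfolding cip_def
  proof (rule sum_norm_le)
    fix n :: "'n \<Rightarrow> nat" assume "n \<in> mi K"
    from xv_orbit_le_1[OF R this] have "cmod (xv K (R *v u) n) \<le> 1" by (simp add: abs_square_le_1)
    thus "cmod (cnj (y n) * xv K (R *v u) n) \<le> cmod (y n)" by (simp add: norm_mult mult_left_le)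
  qed
  thus "(cmod (cip (mi K) y (xv K (R *v u))))\<^sup>2 \<le> (\<Sum>n\<in>mi K. cmod (y n))\<^sup>2"
    by (intro power_mono) auto
qed

lemma integrable_weighted:
  assumes [measurable]: "g \<in> borel_measurable \<mu>" and g: "\<And>R. R \<in> space \<mu> \<Longrightarrow> 0 \<le> g R \<and> g R \<le> (1 :: real)"
  shows "integrable \<mu> (\<lambda>R. g R * (cmod (cip (mi K) y (xv K (R *v u))))\<^sup>2)"
proof -
  obtain B where B: "\<And>R. R \<in> space \<mu> \<Longrightarrow> (cmod (cip (mi K) y (xv K (R *v u))))\<^sup>2 \<le> B"
    by (rule cip_xv_bounded[of K y]) blast
  show ?thesis
  proof (rule integrable_const_bound[where B = B])
    show "AE R in \<mu>. norm (g R * (cmod (cip (mi K) y (xv K (R *v u))))\<^sup>2) \<le> B"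
    proof (rule AE_I2)
      fix R assume R: "R \<in> space \<mu>"
      have "g R * (cmod (cip (mi K) y (xv K (R *v u))))\<^sup>2 \<le> 1 * (cmod (cip (mi K) y (xv K (R *v u))))\<^sup>2"
        using g[OF R] by (intro mult_right_mono) auto
      thus "norm (g R * (cmod (cip (mi K) y (xv K (R *v u))))\<^sup>2) \<le> B" using B[OF R] g[OF R] by simp
    qed
  qed measurable
qed

lemma integrable_cip: "integrable \<mu> (\<lambda>R. (cmod (cip (mi K) y (xv K (R *v u))))\<^sup>2)"
  using integrable_weighted[of "\<lambda>_. 1" K y] by simp

text \<open>The coherent states weighted by \<open>g\<close> form a positive operator \<open>\<le> 1\<close> on \<open>H\<^bsub>k+M\<^esub>\<close> by the resolution of the
  identity; testing it against the spectral bound is the lower Berezin-Lieb inequality.\<close>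

lemma weighted_bound:
  fixes i0 :: 'n
  assumes [measurable]: "g \<in> borel_measurable \<mu>" and g: "\<And>R. R \<in> space \<mu> \<Longrightarrow> 0 \<le> g R \<and> g R \<le> (1 :: real)"
    and \<phi>: "nrm2 (mi M) \<phi> = 1"
  shows "dim_mi (k + M) * real ((k + M) choose M) * (LINT R|\<mu>. g R * (cmod (cip (mi M) \<phi> (xv M (R *v u))))\<^sup>2)
     \<le> real ((m + M) choose M) * (dim_mi (k + M) * (LINT R|\<mu>. g R))
       + (\<Sum>n\<in>(mi k :: ('n \<Rightarrow> nat) set). max 0 (real ((n i0 + M) choose M) - real ((m + M) choose M)))"
proof -
  define K where "K = k + M"
  define d where "d = dim_mi K"
  have d: "d > 0" by (simp add: d_def dim_mi_pos)
  obtain e f :: "('n \<Rightarrow> nat) \<Rightarrow> ('n \<Rightarrow> nat) \<Rightarrow> complex" where e: "orthonormal_on (mi k) (mi k) e"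
    and sv: "\<And>y. nrm2 (mi k) (madj (mi K) (vmat \<phi>) y)
       = (\<Sum>l\<in>mi k. nrm2 (mi K) (mapp (mi k) (vmat \<phi>) (e l)) * (cmod (cip (mi K) (f l) y))\<^sup>2)"
    and f1: "\<And>l. l \<in> mi k \<Longrightarrow> nrm2 (mi K) (f l) \<le> 1"
    and f2: "\<And>y. (\<Sum>l\<in>mi k. (cmod (cip (mi K) (f l) y))\<^sup>2) \<le> nrm2 (mi K) y"
    by (rule singular_values[OF finite_mi finite_mi, of k K "vmat \<phi>"]) (rule that, assumption+)
  have intw: "integrable \<mu> (\<lambda>R. g R * (cmod (cip (mi K) y (xv K (R *v u))))\<^sup>2)" for K y
    by (rule integrable_weighted[OF assms(1) g])
  \<comment> \<open>The expectation at \<open>f l\<close> of the coherent average with density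
    \<open>d * g\<close>. The factor \<open>d\<close> normalises the average for
    \<open>g = 1\<close> to the identity, so expectations lie in [0,1] and the trace is
    \<open>d\<close> times the integral of \<open>g\<close>.\<close>
  define \<gamma> where "\<gamma> l = d * (LINT R|\<mu>. g R * (cmod (cip (mi K) (f l) (xv K (R *v u))))\<^sup>2)" for l
  have \<gamma>: "0 \<le> \<gamma> l \<and> \<gamma> l \<le> 1" if l: "l \<in> mi k" for l
  proof
    have "0 \<le> (LINT R|\<mu>. g R * (cmod (cip (mi K) (f l) (xv K (R *v u))))\<^sup>2)"
      using g by (intro Bochner_Integration.integral_nonneg) auto
    thus "0 \<le> \<gamma> l" using d by (simp add: \<gamma>_def)
    have "(LINT R|\<mu>. g R * (cmod (cip (mi K) (f l) (xv K (R *v u))))\<^sup>2) \<le> (LINT R|\<mu>. (cmod (cip (mi K) (f l) (xv K (R *v u))))\<^sup>2)"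
    proof (rule integral_mono[OF intw integrable_cip])
      fix R assume R: "R \<in> space \<mu>"
      show "g R * (cmod (cip (mi K) (f l) (xv K (R *v u))))\<^sup>2 \<le> (cmod (cip (mi K) (f l) (xv K (R *v u))))\<^sup>2"
        using g[OF R] by (simp add: mult_left_le_one_le)
    qed
    hence "\<gamma> l \<le> d * (nrm2 (mi K) (f l) / d)"
      unfolding \<gamma>_def resolution_of_identity dim_mi_def[symmetric] d_def[symmetric]
      using d by (intro mult_left_mono) auto
    thus "\<gamma> l \<le> 1" using f1[OF l] d by simp
  qed
  have \<gamma>sum: "(\<Sum>l\<in>mi k. \<gamma> l) \<le> d * (LINT R|\<mu>. g R)"
  proof -
    have "(\<Sum>l\<in>mi k. \<gamma> l) = d * (\<Sum>l\<in>mi k. LINT R|\<mu>. g R * (cmod (cip (mi K) (f l) (xv K (R *v u))))\<^sup>2)"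
      by (simp add: \<gamma>_def sum_distrib_left)
    also have "(\<Sum>l\<in>mi k. LINT R|\<mu>. g R * (cmod (cip (mi K) (f l) (xv K (R *v u))))\<^sup>2)
        = (LINT R|\<mu>. (\<Sum>l\<in>mi k. g R * (cmod (cip (mi K) (f l) (xv K (R *v u))))\<^sup>2))"
      by (rule Bochner_Integration.integral_sum[symmetric]) (rule intw)
    also have "d * (LINT R|\<mu>. (\<Sum>l\<in>mi k. g R * (cmod (cip (mi K) (f l) (xv K (R *v u))))\<^sup>2)) \<le> d * (LINT R|\<mu>. g R)"
    proof (intro mult_left_mono integral_mono)
      show "integrable \<mu> (\<lambda>R. \<Sum>l\<in>mi k. g R * (cmod (cip (mi K) (f l) (xv K (R *v u))))\<^sup>2)"
        using intw by (intro Bochner_Integration.integrable_sum) auto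
      show "integrable \<mu> g" using g by (intro integrable_const_bound[where B = 1] AE_I2) auto
      fix R assume R: "R \<in> space \<mu>"
      have "(\<Sum>l\<in>mi k. (cmod (cip (mi K) (f l) (xv K (R *v u))))\<^sup>2) \<le> 1"
        using f2[of "xv K (R *v u)"] by (simp add: nrm2_xv norm_orbit[OF R])
      thus "(\<Sum>l\<in>mi k. g R * (cmod (cip (mi K) (f l) (xv K (R *v u))))\<^sup>2) \<le> g R"
        unfolding sum_distrib_left[symmetric] using g[OF R] by (intro mult_left_le) auto
    qed (use d in simp)
    finally show ?thesis .
  qed
  have "real (K choose M) * (LINT R|\<mu>. g R * (cmod (cip (mi M) \<phi> (xv M (R *v u))))\<^sup>2)
      = (LINT R|\<mu>. g R * nrm2 (mi k) (madj (mi K) (vmat \<phi>) (xv K (R *v u))))"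
    unfolding integral_mult_right_zero[symmetric] K_def
    by (intro Bochner_Integration.integral_cong refl) (simp add: nrm2_madj_xv norm_orbit)
  also have "\<dots> = (LINT R|\<mu>. (\<Sum>l\<in>mi k. nrm2 (mi K) (mapp (mi k) (vmat \<phi>) (e l)) * (g R * (cmod (cip (mi K) (f l) (xv K (R *v u))))\<^sup>2)))"
    unfolding sv sum_distrib_left by (simp add: mult_ac)
  also have "\<dots> = (\<Sum>l\<in>mi k. nrm2 (mi K) (mapp (mi k) (vmat \<phi>) (e l)) * (LINT R|\<mu>. g R * (cmod (cip (mi K) (f l) (xv K (R *v u))))\<^sup>2))"
    using intw by (subst Bochner_Integration.integral_sum) auto
  finally have "d * (real (K choose M) * (LINT R|\<mu>. g R * (cmod (cip (mi M) \<phi> (xv M (R *v u))))\<^sup>2))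
      = (\<Sum>l\<in>mi k. \<gamma> l * nrm2 (mi (k + M)) (mapp (mi k) (vmat \<phi>) (e l)))"
    by (simp add: \<gamma>_def K_def sum_distrib_left mult_ac)
  also have "\<dots> \<le> nrm2 (mi M) \<phi> * (real ((m + M) choose M) * (\<Sum>l\<in>mi k. \<gamma> l)
       + (\<Sum>n\<in>(mi k :: ('n \<Rightarrow> nat) set). max 0 (real ((n i0 + M) choose M) - real ((m + M) choose M))))"
    by (rule majorized_mapp[OF majorized_at e \<gamma>])
  also have "\<dots> \<le> real ((m + M) choose M) * (d * (LINT R|\<mu>. g R))
       + (\<Sum>n\<in>(mi k :: ('n \<Rightarrow> nat) set). max 0 (real ((n i0 + M) choose M) - real ((m + M) choose M)))"
    unfolding \<phi> using \<gamma>sum by (simp add: mult_left_mono)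
  finally show ?thesis by (simp add: d_def K_def mult_ac)
qed

end

context haar_orbit
begin

text \<open>The normalised trace of a function of the occupation number equals the integral of its
  coherent expectation: each basis vector has averaged weight \<open>1 / dim_mi K\<close>, and the
  expectation is a Bernstein sum.\<close>

lemma average_eq_Bernstein:
  fixes i0 :: 'n
  shows "(\<Sum>n\<in>(mi K :: ('n \<Rightarrow> nat) set). F (n i0)) / dim_mi K
     = (LINT R|\<mu>. (\<Sum>k\<le>K. F k * Bernstein K k ((cmod ((R *v u) $ i0))\<^sup>2)))"
proof -
  have d: "(LINT R|\<mu>. (cmod (xv K (R *v u) n))\<^sup>2) = 1 / dim_mi K"
    and i: "integrable \<mu> (\<lambda>R. (cmod (xv K (R *v u) n))\<^sup>2)" if n: "n \<in> mi K" for n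
  proof -
    have c: "(cmod (cip (mi K) (\<lambda>s. if s = n then 1 else 0) x))\<^sup>2 = (cmod (x n))\<^sup>2" for x
      unfolding cip_commute[of _ "\<lambda>s. if s = n then 1 else 0"] using cip_delta[OF finite_mi n, of x] by simp
    show "(LINT R|\<mu>. (cmod (xv K (R *v u) n))\<^sup>2) = 1 / dim_mi K"
      using resolution_of_identity[of K "\<lambda>s. if s = n then 1 else 0"]
      unfolding c nrm2_delta[OF finite_mi n] dim_mi_def .
    show "integrable \<mu> (\<lambda>R. (cmod (xv K (R *v u) n))\<^sup>2)"
      using integrable_cip[of K "\<lambda>s. if s = n then 1 else 0"] unfolding c .
  qed
  have "(\<Sum>n\<in>(mi K :: ('n \<Rightarrow> nat) set). F (n i0)) / dim_mi K
      = (\<Sum>n\<in>mi K. F (n i0) * (LINT R|\<mu>. (cmod (xv K (R *v u) n))\<^sup>2))"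
    unfolding sum_divide_distrib by (intro sum.cong refl) (simp add: d)
  also have "\<dots> = (\<Sum>n\<in>mi K. (LINT R|\<mu>. F (n i0) * (cmod (xv K (R *v u) n))\<^sup>2))"
    by simp
  also have "\<dots> = (LINT R|\<mu>. (\<Sum>n\<in>mi K. F (n i0) * (cmod (xv K (R *v u) n))\<^sup>2))"
    using i by (intro Bochner_Integration.integral_sum[symmetric] integrable_mult_right)
  also have "\<dots> = (LINT R|\<mu>. (\<Sum>k\<le>K. F k * Bernstein K k ((cmod ((R *v u) $ i0))\<^sup>2)))"
    by (intro Bochner_Integration.integral_cong refl) (rule sum_xv_Bernstein[OF norm_orbit])
  finally show ?thesis .
qed

lemma component_le_1:
  assumes "R \<in> space \<mu>" shows "(cmod ((R *v u) $ i))\<^sup>2 \<le> 1"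
  using Finite_Cartesian_Product.norm_nth_le[of "R *v u" i] norm_orbit[OF assms] by (simp add: abs_square_le_1)

lemma component_measurable [measurable]: "(\<lambda>v :: complex^'n. v $ i) \<in> borel_measurable borel"
  by (intro borel_measurable_continuous_onI continuous_intros)

end

section \<open>Comparison of the Husimi function with the coherent case\<close>

locale haar_density = haar_orbit \<mu> u for \<mu> :: "(complex^'n::finite^'n) measure" and u +
  fixes M :: nat and e :: "('n \<Rightarrow> nat) \<Rightarrow> ('n \<Rightarrow> nat) \<Rightarrow> complex" and p :: "('n \<Rightarrow> nat) \<Rightarrow> real"
  assumes e: "orthonormal_on (mi M) (mi M) e" and p: "\<And>l. l \<in> mi M \<Longrightarrow> 0 \<le> p l"
    and p1: "(\<Sum>l\<in>mi M. p l) = 1"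
begin

definition husimi :: "complex^'n^'n \<Rightarrow> real" where
  "husimi R = (\<Sum>l\<in>mi M. p l * (cmod (cip (mi M) (e l) (xv M (R *v u))))\<^sup>2)"

lemma husimi_measurable [measurable]: "husimi \<in> borel_measurable \<mu>"
  unfolding husimi_def[abs_def] by measurable

lemma husimi_bounds: "R \<in> space \<mu> \<Longrightarrow> 0 \<le> husimi R \<and> husimi R \<le> 1"
proof
  assume R: "R \<in> space \<mu>"
  show "0 \<le> husimi R" unfolding husimi_def using p by (intro sum_nonneg mult_nonneg_nonneg) auto
  have "husimi R \<le> (\<Sum>l\<in>mi M. p l * 1)"
    unfolding husimi_def
  proof (intro sum_mono mult_left_mono p)
    fix l :: "'n \<Rightarrow> nat" assume l: "l \<in> mi M"
    have "orthonormal_on (mi M) {l} e" using e l by (simp add: orthonormal_on_def)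
    from bessel[OF _ this, of "xv M (R *v u)"]
    show "(cmod (cip (mi M) (e l) (xv M (R *v u))))\<^sup>2 \<le> 1" by (simp add: nrm2_xv norm_orbit[OF R])
  qed
  thus "husimi R \<le> 1" using p1 by simp
qed

lemma integral_husimi: "(LINT R|\<mu>. husimi R) = 1 / dim_mi M"
proof -
  have "(LINT R|\<mu>. husimi R) = (\<Sum>l\<in>mi M. (LINT R|\<mu>. p l * (cmod (cip (mi M) (e l) (xv M (R *v u))))\<^sup>2))"
    unfolding husimi_def using integrable_cip by (intro Bochner_Integration.integral_sum integrable_mult_right)
  also have "\<dots> = (\<Sum>l\<in>mi M. p l * (1 / dim_mi M))"
    by (intro sum.cong refl) (simp add: resolution_of_identity orthonormal_nrm2[OF e] dim_mi_def)
  also have "\<dots> = 1 / dim_mi M" unfolding sum_distrib_right[symmetric] p1 by simp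
  finally show ?thesis .
qed

lemma integrable_hinge:
  assumes [measurable]: "Z \<in> borel_measurable \<mu>" and Z: "\<And>R. R \<in> space \<mu> \<Longrightarrow> 0 \<le> Z R \<and> Z R \<le> (1 :: real)" and "0 \<le> t"
  shows "integrable \<mu> (\<lambda>R. max 0 (Z R - t))"
  using Z \<open>0 \<le> t\<close> by (intro integrable_const_bound[where B = 1] AE_I2) (auto simp: max_def, force)

text \<open>The test weight \<open>g\<close> is the indicator of \<open>husimi > t\<close>, for
  which the hinge integral becomes linear in the state. One and the same \<open>g\<close> and bound
  serve all eigenvectors, so averaging with the weights \<open>p\<close> settles mixed
  states.\<close>

lemma hinge_finite:
  fixes i0 :: 'n and m k :: nat
  defines "t \<equiv> real ((m + M) choose M) / real ((k + M) choose M)"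
  shows "(LINT R|\<mu>. max 0 (husimi R - t))
    \<le> (\<Sum>n\<in>(mi (k + M) :: ('n \<Rightarrow> nat) set). max 0 (real (n i0 choose M) / real ((k + M) choose M) - t)) / dim_mi (k + M)"
proof -
  define C where "C = real ((k + M) choose M)"
  define d where "d = dim_mi (k + M)"
  have C: "C > 0" by (simp add: C_def)
  have d: "d > 0" by (simp add: d_def dim_mi_pos)
  define g where "g R = (if husimi R > t then 1 else 0 :: real)" for R
  have [measurable]: "g \<in> borel_measurable \<mu>" unfolding g_def by measurable
  have g: "0 \<le> g R \<and> g R \<le> 1" for R by (simp add: g_def)
  have gi: "integrable \<mu> g" using g by (intro integrable_const_bound[where B = 1] AE_I2) auto
  have intw: "integrable \<mu> (\<lambda>R. g R * (cmod (cip (mi M) y (xv M (R *v u))))\<^sup>2)" for y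
    by (rule integrable_weighted) (simp_all add: g)
  define A where "A = (LINT R|\<mu>. g R)"
  define s where "s = (\<Sum>n\<in>(mi (k + M) :: ('n \<Rightarrow> nat) set). max 0 (real (n i0 choose M) / C - t))"
  have bound: "(LINT R|\<mu>. g R * (cmod (cip (mi M) (e l) (xv M (R *v u))))\<^sup>2) \<le> t * A + s / d"
    if l: "l \<in> mi M" for l
  proof -
    define J where "J = (LINT R|\<mu>. g R * (cmod (cip (mi M) (e l) (xv M (R *v u))))\<^sup>2)"
    have tC: "real ((m + M) choose M) = t * C" using C by (simp add: t_def C_def)
    have "d * C * J \<le> t * C * (d * A) + (\<Sum>n\<in>(mi k :: ('n \<Rightarrow> nat) set). max 0 (real ((n i0 + M) choose M) - t * C))"
      using weighted_bound[of g M "e l" k m i0] g orthonormal_nrm2[OF e l]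
      by (simp add: J_def A_def d_def tC) (simp add: C_def)
    also have "(\<Sum>n\<in>(mi k :: ('n \<Rightarrow> nat) set). max 0 (real ((n i0 + M) choose M) - t * C))
        \<le> (\<Sum>n\<in>(mi (k + M) :: ('n \<Rightarrow> nat) set). max 0 (real (n i0 choose M) - t * C))"
      by (rule sum_mi_shift[where h = "\<lambda>n. max 0 (real (n choose M) - t * C)"]) simp
    also have "\<dots> = C * s"
      unfolding s_def sum_distrib_left
    proof (rule sum.cong[OF refl])
      fix n :: "'n \<Rightarrow> nat"
      have "real (n i0 choose M) - t * C = C * (real (n i0 choose M) / C - t)" using C by (simp add: field_simps)
      thus "max 0 (real (n i0 choose M) - t * C) = C * max 0 (real (n i0 choose M) / C - t)"
        using C by (simp add: max_mult_distrib_left)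
    qed
    finally have "(C * d) * J \<le> (C * d) * (t * A + s / d)"
      using d by (simp add: algebra_simps)
    thus ?thesis unfolding J_def[symmetric] using C d by (simp only: mult_le_cancel_left_pos mult_pos_pos)
  qed
  have "(LINT R|\<mu>. max 0 (husimi R - t)) = (LINT R|\<mu>. g R * husimi R - t * g R)"
    by (intro Bochner_Integration.integral_cong refl) (auto simp: g_def max_def)
  also have "\<dots> = (LINT R|\<mu>. g R * husimi R) - t * A"
    unfolding A_def
  proof (subst Bochner_Integration.integral_diff)
    show "integrable \<mu> (\<lambda>R. g R * husimi R)"
    proof (intro integrable_const_bound[where B = 1] AE_I2)
      fix R assume "R \<in> space \<mu>"
      thus "norm (g R * husimi R) \<le> 1" using husimi_bounds[of R] by (simp add: g_def)
    qed measurable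
  qed (use gi in auto)
  also have "(LINT R|\<mu>. g R * husimi R) = (LINT R|\<mu>. (\<Sum>l\<in>mi M. p l * (g R * (cmod (cip (mi M) (e l) (xv M (R *v u))))\<^sup>2)))"
    unfolding husimi_def sum_distrib_left by (simp add: mult_ac)
  also have "\<dots> = (\<Sum>l\<in>mi M. (LINT R|\<mu>. p l * (g R * (cmod (cip (mi M) (e l) (xv M (R *v u))))\<^sup>2)))"
    by (intro Bochner_Integration.integral_sum integrable_mult_right intw)
  also have "\<dots> = (\<Sum>l\<in>mi M. p l * (LINT R|\<mu>. g R * (cmod (cip (mi M) (e l) (xv M (R *v u))))\<^sup>2))"
    by simp
  also have "\<dots> \<le> (\<Sum>l\<in>mi M. p l * (t * A + s / d))"
    by (intro sum_mono mult_left_mono bound p)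
  also have "\<dots> = t * A + s / d" unfolding sum_distrib_right[symmetric] p1 by simp
  finally show ?thesis by (simp add: s_def d_def C_def)
qed

text \<open>Large \<open>k\<close> turns the discrete threshold into \<open>\<tau> ^ M\<close> and
  the averages over occupation numbers into Bernstein approximations of \<open>F\<close>. Only the
  upper bound of binomial ratios by powers is needed on the coherent side.\<close>

lemma hinge_limit:
  fixes i0 :: 'n
  assumes \<tau>: "0 \<le> \<tau>" "\<tau> \<le> 1"
  shows "(LINT R|\<mu>. max 0 (husimi R - \<tau> ^ M)) \<le> (LINT R|\<mu>. max 0 (((cmod ((R *v u) $ i0))\<^sup>2) ^ M - \<tau> ^ M))"
proof (rule field_le_epsilon)
  fix \<epsilon> :: real assume "\<epsilon> > 0"
  \<comment> \<open>Three errors are incurred: moving the threshold on the left, moving it on the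
    right, and the Bernstein approximation.\<close>
  define r where "r = \<epsilon> / 3"
  have r: "r > 0" using \<open>\<epsilon> > 0\<close> by (simp add: r_def)
  define F where "F x = max 0 (x ^ M - \<tau> ^ M)" for x :: real
  have "continuous_on {0..1} F" unfolding F_def by (intro continuous_intros)
  from Bernstein_Weierstrass[OF this r] obtain N where
    N: "\<And>n x. N \<le> n \<Longrightarrow> x \<in> {0..1} \<Longrightarrow> \<bar>F x - (\<Sum>k\<le>n. F (real k / real n) * Bernstein n k x)\<bar> < r"
    by blast
  define t where "t k = real ((nat \<lfloor>\<tau> * real k\<rfloor> + M) choose M) / real ((k + M) choose M)" for k
  have "t \<longlonglongrightarrow> \<tau> ^ M" unfolding t_def by (rule binomial_ratio_LIMSEQ[OF \<tau>(1)])
  then obtain N' where N': "\<And>k. N' \<le> k \<Longrightarrow> \<bar>t k - \<tau> ^ M\<bar> < r"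
    using LIMSEQ_D[OF _ r] by (metis real_norm_def)
  define k where "k = Suc (max N N')"
  define K where "K = k + M"
  have tk: "\<bar>t k - \<tau> ^ M\<bar> < r" by (rule N') (simp add: k_def)
  have K: "N \<le> K" "K > 0" by (auto simp: K_def k_def)
  have t0: "0 \<le> t k" by (simp add: t_def)
  have \<tau>M: "0 \<le> \<tau> ^ M" using \<tau> by simp
  define X where "X R = (cmod ((R *v u) $ i0))\<^sup>2" for R
  have [measurable]: "X \<in> borel_measurable \<mu>" unfolding X_def by measurable
  have X: "0 \<le> X R \<and> X R \<le> 1" if "R \<in> space \<mu>" for R using component_le_1[OF that] by (simp add: X_def)
  have XM: "0 \<le> X R ^ M \<and> X R ^ M \<le> 1" if "R \<in> space \<mu>" for R using X[OF that] by (simp add: power_le_one)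
  have iF: "integrable \<mu> (\<lambda>R. F (X R))"
    unfolding F_def using XM \<tau>M by (intro integrable_hinge) auto
  have "(LINT R|\<mu>. max 0 (husimi R - \<tau> ^ M)) \<le> (LINT R|\<mu>. max 0 (husimi R - t k) + r)"
  proof (rule integral_mono)
    show "integrable \<mu> (\<lambda>R. max 0 (husimi R - \<tau> ^ M))"
      using husimi_bounds \<tau>M by (intro integrable_hinge) auto
    show "integrable \<mu> (\<lambda>R. max 0 (husimi R - t k) + r)"
      using husimi_bounds t0 by (intro Bochner_Integration.integrable_add integrable_hinge) auto
  qed (use tk in \<open>auto simp: max_def\<close>)
  also have "\<dots> = (LINT R|\<mu>. max 0 (husimi R - t k)) + r"
    using husimi_bounds t0 by (subst Bochner_Integration.integral_add) (auto intro!: integrable_hinge simp: prob_space)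
  also have "(LINT R|\<mu>. max 0 (husimi R - t k))
      \<le> (\<Sum>n\<in>(mi K :: ('n \<Rightarrow> nat) set). max 0 (real (n i0 choose M) / real (K choose M) - t k)) / dim_mi K"
    unfolding t_def K_def by (rule hinge_finite)
  also have "\<dots> \<le> (\<Sum>n\<in>(mi K :: ('n \<Rightarrow> nat) set). F (real (n i0) / real K) + r) / dim_mi K"
  proof (rule divide_right_mono, rule sum_mono)
    fix n :: "'n \<Rightarrow> nat" assume n: "n \<in> mi K"
    have "n i0 \<le> K" using n member_le_sum[of i0 UNIV n] by (simp add: mi_def)
    from binomial_ratio_le_power[OF this, of M]
    have "real (n i0 choose M) * real K ^ M \<le> real (n i0) ^ M * real (K choose M)"
      by (simp only: mult.commute)
    moreover have "real (K choose M) > 0" by (simp add: K_def)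
    moreover have "real K ^ M > 0" using K(2) by simp
    ultimately have "real (n i0 choose M) / real (K choose M) \<le> (real (n i0) / real K) ^ M"
      unfolding power_divide by (simp add: pos_divide_le_eq pos_le_divide_eq)
    thus "max 0 (real (n i0 choose M) / real (K choose M) - t k) \<le> F (real (n i0) / real K) + r"
      using tk r by (auto simp: F_def max_def)
  qed (simp add: dim_mi_pos less_imp_le)
  also have "\<dots> = (\<Sum>n\<in>(mi K :: ('n \<Rightarrow> nat) set). F (real (n i0) / real K)) / dim_mi K + r"
  proof -
    have "(\<Sum>n\<in>(mi K :: ('n \<Rightarrow> nat) set). F (real (n i0) / real K) + r)
        = (\<Sum>n\<in>(mi K :: ('n \<Rightarrow> nat) set). F (real (n i0) / real K)) + dim_mi K * r"
      by (simp add: sum.distrib dim_mi_def)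
    thus ?thesis using dim_mi_pos[of K] by (simp add: add_divide_distrib)
  qed
  also have "(\<Sum>n\<in>(mi K :: ('n \<Rightarrow> nat) set). F (real (n i0) / real K)) / dim_mi K
      = (LINT R|\<mu>. (\<Sum>j\<le>K. F (real j / real K) * Bernstein K j (X R)))"
    unfolding X_def by (rule average_eq_Bernstein[where F = "\<lambda>j. F (real j / real K)"])
  also have "\<dots> \<le> (LINT R|\<mu>. F (X R) + r)"
  proof (rule integral_mono)
    have b: "\<bar>F (X R) - (\<Sum>j\<le>K. F (real j / real K) * Bernstein K j (X R))\<bar> < r" if "R \<in> space \<mu>" for R
      using X[OF that] by (intro N K(1)) auto
    show "(\<Sum>j\<le>K. F (real j / real K) * Bernstein K j (X R)) \<le> F (X R) + r" if "R \<in> space \<mu>" for R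
      using b[OF that] by linarith
    show "integrable \<mu> (\<lambda>R. \<Sum>j\<le>K. F (real j / real K) * Bernstein K j (X R))"
    proof (rule integrable_const_bound[where B = "1 + r"], rule AE_I2)
      fix R assume R: "R \<in> space \<mu>"
      have "0 \<le> F (X R)" "F (X R) \<le> 1" using XM[OF R] \<tau>M by (auto simp: F_def)
      thus "norm (\<Sum>j\<le>K. F (real j / real K) * Bernstein K j (X R)) \<le> 1 + r"
        using b[OF R] unfolding real_norm_def by linarith
    next
      show "(\<lambda>R. \<Sum>j\<le>K. F (real j / real K) * Bernstein K j (X R)) \<in> borel_measurable \<mu>"
        unfolding Bernstein_def by measurable
    qed
    show "integrable \<mu> (\<lambda>R. F (X R) + r)" using iF by simp
  qed
  also have "\<dots> = (LINT R|\<mu>. F (X R)) + r"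
    using iF by (subst Bochner_Integration.integral_add) (auto simp: prob_space)
  finally show "(LINT R|\<mu>. max 0 (husimi R - \<tau> ^ M)) \<le> (LINT R|\<mu>. max 0 (((cmod ((R *v u) $ i0))\<^sup>2) ^ M - \<tau> ^ M)) + \<epsilon>"
    by (simp add: F_def X_def r_def)
qed

end

theorem theorem1:
  fixes \<mu> :: "(complex^'n::finite^'n) measure"
    and M :: nat and f :: "real \<Rightarrow> real"
    and \<rho> :: "'n list \<Rightarrow> 'n list \<Rightarrow> complex" and u :: "complex^'n"
  assumes "CARD('n) \<ge> 2" and "M \<ge> 1"
    and "concave_on {0..1} f"
    and "haar_SU \<mu>"
    and "density_sym M \<rho>"
    and "norm u = 1"
  shows "(LINT R|\<mu>. f (Re (qform M \<rho> (tensor_pow M (R *v u)))))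
         \<ge> (LINT R|\<mu>. f ((cmod (tinner M (tensor_pow M (R *v u)) (tensor_pow M u)))\<^sup>2))"
proof -
  obtain e :: "('n \<Rightarrow> nat) \<Rightarrow> ('n \<Rightarrow> nat) \<Rightarrow> complex" and p where ep: "orthonormal_on (mi M) (mi M) e"
    "\<And>l. l \<in> mi M \<Longrightarrow> (0 :: real) \<le> p l" "(\<Sum>l\<in>mi M. p l) = 1"
    and q: "\<And>v. Re (qform M \<rho> (tensor_pow M v)) = (\<Sum>l\<in>mi M. p l * (cmod (cip (mi M) (e l) (xv M v)))\<^sup>2)"
    by (rule density_decomposition[OF assms(5)]) (rule that, assumption+)
  interpret haar_density \<mu> u M e p
    using assms(4,6) ep by unfold_locales
  have q: "Re (qform M \<rho> (tensor_pow M (R *v u))) = husimi R" for R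
    unfolding husimi_def by (rule q)
  define Y where "Y R = (cmod (hip u (R *v u))) ^ (2 * M)" for R
  have [measurable]: "Y \<in> borel_measurable \<mu>" unfolding Y_def by measurable
  have y: "(cmod (tinner M (tensor_pow M (R *v u)) (tensor_pow M u)))\<^sup>2 = Y R" for R
    unfolding tinner_tensor_pow Y_def hip_commute[of "R *v u" u]
    by (simp add: norm_power power_mult[symmetric] mult.commute)
  have Ycip: "Y R = (cmod (cip (mi M) (xv M u) (xv M (R *v u))))\<^sup>2" for R
    unfolding cip_xv Y_def by (simp add: norm_power power_mult[symmetric] mult.commute)
  have Y: "0 \<le> Y R \<and> Y R \<le> 1" if R: "R \<in> space \<mu>" for R
  proof
    \<comment> \<open>Bessel's inequality for a one-element system is the Cauchy-Schwarz
      bound.\<close>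
    have "orthonormal_on (mi M) {()} (\<lambda>_. xv M u)"
      by (simp add: orthonormal_on_def cip_self nrm2_xv norm_u)
    from bessel[OF _ this, of "xv M (R *v u)"]
    show "Y R \<le> 1" by (simp add: Ycip nrm2_xv norm_orbit[OF R])
  qed (simp add: Y_def)
  have mean: "expectation husimi = expectation Y"
    unfolding integral_husimi Ycip resolution_of_identity nrm2_xv norm_u by (simp add: dim_mi_def)
  have hinge: "expectation (\<lambda>R. max 0 (husimi R - t)) \<le> expectation (\<lambda>R. max 0 (Y R - t))"
    if t: "0 \<le> t" "t \<le> 1" for t
  proof -
    \<comment> \<open>Every threshold in [0,1] is an \<open>M\<close>-th power because
      \<open>M \<ge> 1\<close>.\<close>
    define \<tau> where "\<tau> = root M t"
    have \<tau>: "0 \<le> \<tau>" "\<tau> \<le> 1" "\<tau> ^ M = t" using t assms(2) by (simp_all add: \<tau>_def)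
    obtain i0 :: 'n where True by blast
    have ha: "hip (axis i0 1) v = v $ i0" for v :: "complex^'n"
    proof -
      have "hip (axis i0 1) v = (\<Sum>i\<in>UNIV. if i = i0 then v $ i else 0)"
        unfolding hip_def axis_def by (intro sum.cong refl) auto
      thus ?thesis by simp
    qed
    have "complex_of_real ((norm (axis i0 1 :: complex^'n))\<^sup>2) = of_real 1"
      unfolding hip_self[symmetric] ha by (simp add: axis_def)
    hence "(norm (axis i0 1 :: complex^'n))\<^sup>2 = 1" by (simp only: of_real_eq_iff)
    hence na: "norm (axis i0 1 :: complex^'n) = 1"
      using norm_ge_zero[of "axis i0 1 :: complex^'n"] by (auto simp: power2_eq_1_iff)
    have "expectation (\<lambda>R. max 0 (husimi R - t)) \<le> (LINT R|\<mu>. max 0 (((cmod ((R *v u) $ i0))\<^sup>2) ^ M - t))"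
      using hinge_limit[OF \<tau>(1,2), of i0] unfolding \<tau>(3) .
    also have "\<dots> = (LINT R|\<mu>. max 0 (cmod (hip (axis i0 1) (R *v u)) ^ (2 * M) - t))"
      unfolding ha by (simp add: power_mult)
    \<comment> \<open>The comparison was made along a coordinate axis; unitary invariance moves the
      axis to \<open>u\<close>.\<close>
    also have "\<dots> = (LINT R|\<mu>. max 0 (cmod (hip u (R *v u)) ^ (2 * M) - t))"
      by (rule integral_hip_indep[where G = "\<lambda>x. max 0 (x ^ (2 * M) - t)"]) (simp_all add: norm_u na)
    finally show ?thesis by (simp add: Y_def)
  qed
  show ?thesis
    unfolding q y
    by (rule concave_order[OF husimi_measurable \<open>Y \<in> borel_measurable \<mu>\<close> husimi_bounds Y mean hinge assms(3)])
qed

end
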